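(* Let $\alpha\in(0,1)$, $b\ge1$, $f\in L^2(\Omega)$, $f_h=\pi_hf$, $u_h=(\mathcal{A}_h^\alpha+b\mathcal{I})^{-1}f_h$, and for $\tau>0$ and integers $M,N\ge 0$ let $$U_{h,\tau}^{M,N}=\frac{\sin\pi\alpha}{\alpha\pi}\,\tau\sum_{n=-M}^{N}\frac{(1+e^{-n\tau/\alpha}\mathcal{A}_h)^{-1}f_h}{e^{n\tau}+2b\cos\pi\alpha+b^2e^{-n\tau}}.$$ Let $\beta$ be the index of $\mathcal{A}$, $\kappa_1=\alpha(\pi-\arctan\beta)$, $\kappa_2=(1-\alpha)\pi$, let $0<\tau<\pi-\arctan\beta$, and choose $$M=\max\left\{\frac{\alpha}{\alpha+1}\left(\frac{2\pi\min(\kappa_1,\kappa_2)}{\tau^2}-\frac{\ln b}{\tau}\right),0\right\},\qquad N=\frac{2\pi\min(\kappa_1,\kappa_2)}{\tau^2}+\frac{\ln b}{\tau}$$ (these being integers). If $M>0$, then $$\|u_h-U_{h,\tau}^{M,N}\|\le\frac{C'(\alpha)\,C(\tau)}{b}\,e^{-\sqrt{\pi\min(\kappa_1,\kappa_2)\left[(1+\alpha^{-1})M+N\right]}}\,\|f_h\|,$$ where $C'(\alpha)$ is a constant independent of $h$, $\tau$, $b$, $M$, $N$ and $f$, and $$C(\tau)=\begin{cases}\sin^{-1}\!\Big(\min\Big\{\frac{\kappa_1-\kappa_2}{\alpha}+\frac{1-\alpha}{\alpha}\tau,\ \frac{\pi}{2}\Big\}\Big)\,(1+|\ln\tau|), &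 \kappa_1>\kappa_2,\\[4pt] \sin^{-1}\!\Big(\min\Big\{\tau,\ \frac{\pi}{2}\Big\}\Big)\,\big(1+|\ln(\kappa_2-\kappa_1+\alpha\tau)|\big), & \kappa_1\le\kappa_2.\end{cases}$$
   Context: Here $\sin^{-1}(x)$ denotes the reciprocal $1/\sin(x)$ (not the arcsine). Setting. $\Omega\subset\mathbb{R}^d$ ($d\ge1$) is a bounded polygonal domain with Lipschitz boundary $\Gamma=\Gamma_D\cup\Gamma_N$, $\Gamma_D\cap\Gamma_N=\emptyset$, with $\Gamma_D$ nonempty and containing no part of dimension less than $d-1$. $V\subset H^1(\Omega)$ is the set of (complex-valued) functions with vanishing trace on $\Gamma_D$, equipped with the $H^1(\Omega)$-norm $\|\cdot\|_V$. $(\cdot,\cdot)$ and $\|\cdot\|$ are the inner product and norm of complex $L^2(\Omega)$. The sesquilinear form $$A(w,v)=\int_\Omega \nabla w\,\mathbf{C}(x)(\overline{\nabla v})^T+(\mathbf{a}(x)\cdot\nabla w)\overline{v}+r(x)w\overline{v}\,dx,\qquad w,v\in V,$$ with complex-valued $d\times d$ matrix $\mathbf{C}$, complex $d$-vector $\mathbf{a}$ and complex scalar function $r$, satisfies, for positive constants $c_0,c_1$, $\Re(A(v,v))\ge c_0\|v\|_V^2$ and $|A(w,v)|\le c_1\|w\|_V\|v\|_V$ for all $w,v\in V$. Operator. For $G$ in the space of bounded antilinear functionals on $V$, let $TG\in V$ be the unique element (Lax–Milgram) with $A(TG,v)=G(v)$ for all $v\in V$; $\mathcal{A}=T^{-1}$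 is the operator associated with $A(\cdot,\cdot)$. Let $A^*(v,w)=\overline{A(w,v)}$, $A_{\mathrm{Re}}=\frac12(A+A^* )$ and $A_{\mathrm{Im}}=\frac1{2\mathrm i}(A-A^* )$. The index $\beta$ of $\mathcal{A}$ is the smallest number $\widetilde\beta\ge0$ such that $|A_{\mathrm{Im}}(v,v)|\le\widetilde\beta A_{\mathrm{Re}}(v,v)$ for all $v\in V$. Discretization. $\mathcal{T}_h$ is a quasi-uniform triangulation of $\Omega$ into finitely many simplices with mesh size $h$, such that any simplex of the mesh of dimension less than $d$ lying on $\Gamma$ is contained either in $\Gamma_D$ or in $\Gamma_N$. $V_h$ is the space of continuous piecewise linear functions on $\mathcal{T}_h$ belonging to $V$. $\mathcal{A}_h:V_h\to V_h$ is defined by $(\mathcal{A}_hw_h,v_h)=A(w_h,v_h)$ for all $w_h,v_h\in V_h$, and $\pi_h:L^2(\Omega)\to V_h$ is the $L^2$-projection. The fractional power $\mathcal{A}_h^\alpha$ is defined by the Dunford–Taylor calculus with the principal branch of $z^\alpha$. *)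

theory Defs
  imports "HOL-Complex_Analysis.Complex_Analysis"
begin

section \<open>Domains and boundary measure\<close>

text \<open>Near each boundary point, \<open>\<Omega>\<close> is the strict epigraph, in some direction \<open>e\<close>, of a
  Lipschitz function on the hyperplane orthogonal to \<open>e\<close>.\<close>

definition lipschitz_boundary :: "(real^'d) set \<Rightarrow> bool" where
  "lipschitz_boundary \<Omega> \<longleftrightarrow>
    (\<forall>x\<in>frontier \<Omega>. \<exists>U e L g. open U \<and> x \<in> U \<and> norm e = 1 \<and>
       L-lipschitz_on {y. y \<bullet> e = 0} (g :: real^'d \<Rightarrow> real) \<and>
       U \<inter> \<Omega> = {y\<in>U. g (y - (y \<bullet> e) *\<^sub>R e) < y \<bullet> e})"

definition polygonal_lipschitz_domain :: "(real^'d) set \<Rightarrow> bool" where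
  "polygonal_lipschitz_domain \<Omega> \<longleftrightarrow>
    open \<Omega> \<and> connected \<Omega> \<and> bounded \<Omega> \<and> \<Omega> \<noteq> {} \<and>
    (\<exists>\<P>. finite \<P> \<and> (\<forall>P\<in>\<P>. polytope P) \<and> closure \<Omega> = \<Union>\<P>) \<and>
    lipschitz_boundary \<Omega>"

text \<open>The (unnormalised) \<open>s\<close>-dimensional Hausdorff measure. Covers use bounded sets because
  \<^const>\<open>diameter\<close> is unspecified on unbounded ones; empty sets contribute nothing, which matters
  for \<open>s = 0\<close> (counting measure), the case of the boundary of an interval.\<close>

definition hausdorff_pre :: "nat \<Rightarrow> real \<Rightarrow> 'a::metric_space set \<Rightarrow> ennreal" where
  "hausdorff_pre s \<delta> E =
    (INF U\<in>{U :: nat \<Rightarrow> 'a set. E \<subseteq> (\<Union>i. U i) \<and> (\<forall>i. bounded (U i) \<and> diameter (U i) \<le> \<delta>)}.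
       \<Sum>i. if U i = {} then 0 else ennreal (diameter (U i) ^ s))"

definition hausdorff_outer :: "nat \<Rightarrow> 'a::metric_space set \<Rightarrow> ennreal" where
  "hausdorff_outer s E = (SUP \<delta>\<in>{0<..}. hausdorff_pre s \<delta> E)"

text \<open>The Hausdorff outer measure is countably additive on Borel sets, so \<^const>\<open>measure_of\<close>
  yields the \<open>(d - 1)\<close>-dimensional surface measure and not its null default.\<close>

definition boundary_measure :: "(real^'d) set \<Rightarrow> (real^'d) measure" where
  "boundary_measure \<Omega> =
    restrict_space (measure_of UNIV (sets borel) (hausdorff_outer (CARD('d) - 1))) (frontier \<Omega>)"

text \<open>\<open>\<Gamma>\<^sub>D\<close> is nonempty and has no part of dimension less than \<open>d - 1\<close>: each nonempty relatively
  open part of it has positive \<open>(d - 1)\<close>-dimensional measure.\<close>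

definition boundary_partition ::
    "(real^'d) set \<Rightarrow> (real^'d) set \<Rightarrow> (real^'d) set \<Rightarrow> bool" where
  "boundary_partition \<Omega> \<Gamma>\<^sub>D \<Gamma>\<^sub>N \<longleftrightarrow>
    frontier \<Omega> = \<Gamma>\<^sub>D \<union> \<Gamma>\<^sub>N \<and> \<Gamma>\<^sub>D \<inter> \<Gamma>\<^sub>N = {} \<and> \<Gamma>\<^sub>D \<noteq> {} \<and>
    (\<forall>x\<in>\<Gamma>\<^sub>D. \<forall>\<epsilon>>0. hausdorff_outer (CARD('d) - 1) (\<Gamma>\<^sub>D \<inter> ball x \<epsilon>) > 0)"


section \<open>Function spaces\<close>

text \<open>Elements of \<open>L\<^sup>2(\<Omega>)\<close> and \<open>H\<^sup>1(\<Omega>)\<close> are represented by functions on the whole space whose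
  values outside \<open>\<Omega>\<close> are irrelevant.\<close>

definition L2 :: "(real^'d) set \<Rightarrow> (real^'d \<Rightarrow> complex) set" where
  "L2 \<Omega> = {u \<in> borel_measurable (lebesgue_on \<Omega>). integrable (lebesgue_on \<Omega>) (\<lambda>x. (cmod (u x))\<^sup>2)}"

definition L2_inner :: "(real^'d) set \<Rightarrow> (real^'d \<Rightarrow> complex) \<Rightarrow> (real^'d \<Rightarrow> complex) \<Rightarrow> complex" where
  "L2_inner \<Omega> u v = (LINT x|lebesgue_on \<Omega>. u x * cnj (v x))"

definition L2_norm :: "(real^'d) set \<Rightarrow> (real^'d \<Rightarrow> complex) \<Rightarrow> real" where
  "L2_norm \<Omega> u = sqrt (LINT x|lebesgue_on \<Omega>. (cmod (u x))\<^sup>2)"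

text \<open>Weak derivatives are tested against \<open>C\<^sup>1\<close> functions with compact support in \<open>\<Omega>\<close>
  (the convention of Gilbarg and Trudinger).\<close>

definition test_function :: "(real^'d) set \<Rightarrow> (real^'d \<Rightarrow> real) \<Rightarrow> (real^'d \<Rightarrow> real^'d) \<Rightarrow> bool" where
  "test_function \<Omega> \<phi> D\<phi> \<longleftrightarrow>
    (\<forall>x. GDERIV \<phi> x :> D\<phi> x) \<and> continuous_on UNIV D\<phi> \<and>
    compact (closure {x. \<phi> x \<noteq> 0}) \<and> closure {x. \<phi> x \<noteq> 0} \<subseteq> \<Omega>"

definition is_weak_gradient ::
    "(real^'d) set \<Rightarrow> (real^'d \<Rightarrow> complex) \<Rightarrow> (real^'d \<Rightarrow> complex^'d) \<Rightarrow> bool" where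
  "is_weak_gradient \<Omega> u g \<longleftrightarrow>
    (\<forall>i. (\<lambda>x. g x $ i) \<in> L2 \<Omega>) \<and>
    (\<forall>\<phi> D\<phi> i. test_function \<Omega> \<phi> D\<phi> \<longrightarrow>
       (LINT x|lebesgue_on \<Omega>. u x * of_real (D\<phi> x $ i)) =
       - (LINT x|lebesgue_on \<Omega>. g x $ i * of_real (\<phi> x)))"

definition H1 :: "(real^'d) set \<Rightarrow> (real^'d \<Rightarrow> complex) set" where
  "H1 \<Omega> = {u \<in> L2 \<Omega>. \<exists>g. is_weak_gradient \<Omega> u g}"

definition weak_gradient :: "(real^'d) set \<Rightarrow> (real^'d \<Rightarrow> complex) \<Rightarrow> real^'d \<Rightarrow> complex^'d" where
  "weak_gradient \<Omega> u = (SOME g. is_weak_gradient \<Omega> u g)"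

definition H1_norm :: "(real^'d) set \<Rightarrow> (real^'d \<Rightarrow> complex) \<Rightarrow> real" where
  "H1_norm \<Omega> u =
    sqrt (LINT x|lebesgue_on \<Omega>. (cmod (u x))\<^sup>2 + (norm (weak_gradient \<Omega> u x))\<^sup>2)"

text \<open>The graph of the trace operator: the closure, in \<open>H\<^sup>1(\<Omega>) \<times> L\<^sup>2(\<Gamma>)\<close>, of the restriction to
  \<open>\<Gamma>\<close> of functions in \<open>H\<^sup>1(\<Omega>)\<close> that are continuous up to the boundary.\<close>

definition has_trace :: "(real^'d) set \<Rightarrow> (real^'d \<Rightarrow> complex) \<Rightarrow> (real^'d \<Rightarrow> complex) \<Rightarrow> bool" where
  "has_trace \<Omega> u g \<longleftrightarrow>
    u \<in> H1 \<Omega> \<and> g \<in> borel_measurable (boundary_measure \<Omega>) \<and>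
    (\<exists>w :: nat \<Rightarrow> real^'d \<Rightarrow> complex.
       (\<forall>n. w n \<in> H1 \<Omega> \<and> continuous_on (closure \<Omega>) (w n)) \<and>
       (\<lambda>n. H1_norm \<Omega> (\<lambda>x. w n x - u x)) \<longlonglongrightarrow> 0 \<and>
       (\<lambda>n. \<integral>\<^sup>+x. ennreal ((cmod (w n x - g x))\<^sup>2) \<partial>boundary_measure \<Omega>) \<longlonglongrightarrow> 0)"

definition H1_vanishing :: "(real^'d) set \<Rightarrow> (real^'d) set \<Rightarrow> (real^'d \<Rightarrow> complex) set" where
  "H1_vanishing \<Omega> \<Gamma>\<^sub>D =
    {u \<in> H1 \<Omega>. \<exists>g. has_trace \<Omega> u g \<and> (AE x in boundary_measure \<Omega>. x \<in> \<Gamma>\<^sub>D \<longrightarrow> g x = 0)}"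


section \<open>The sesquilinear form and its index\<close>

definition form_integrand ::
    "(real^'d) set \<Rightarrow> (real^'d \<Rightarrow> complex^'d^'d) \<Rightarrow> (real^'d \<Rightarrow> complex^'d) \<Rightarrow> (real^'d \<Rightarrow> complex) \<Rightarrow>
     (real^'d \<Rightarrow> complex) \<Rightarrow> (real^'d \<Rightarrow> complex) \<Rightarrow> real^'d \<Rightarrow> complex" where
  "form_integrand \<Omega> C a r w v x =
    (\<Sum>i\<in>UNIV. \<Sum>j\<in>UNIV. weak_gradient \<Omega> w x $ i * C x $ i $ j * cnj (weak_gradient \<Omega> v x $ j)) +
    (\<Sum>i\<in>UNIV. a x $ i * weak_gradient \<Omega> w x $ i) * cnj (v x) +
    r x * w x * cnj (v x)"

definition sesq_form ::
    "(real^'d) set \<Rightarrow> (real^'d \<Rightarrow> complex^'d^'d) \<Rightarrow> (real^'d \<Rightarrow> complex^'d) \<Rightarrow> (real^'d \<Rightarrow> complex) \<Rightarrow>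
     (real^'d \<Rightarrow> complex) \<Rightarrow> (real^'d \<Rightarrow> complex) \<Rightarrow> complex" where
  "sesq_form \<Omega> C a r w v = (LINT x|lebesgue_on \<Omega>. form_integrand \<Omega> C a r w v x)"

definition adj_form :: "('f \<Rightarrow> 'f \<Rightarrow> complex) \<Rightarrow> 'f \<Rightarrow> 'f \<Rightarrow> complex" where
  "adj_form A v w = cnj (A w v)"

definition re_form :: "('f \<Rightarrow> 'f \<Rightarrow> complex) \<Rightarrow> 'f \<Rightarrow> 'f \<Rightarrow> complex" where
  "re_form A w v = (A w v + adj_form A w v) / 2"

definition im_form :: "('f \<Rightarrow> 'f \<Rightarrow> complex) \<Rightarrow> 'f \<Rightarrow> 'f \<Rightarrow> complex" where
  "im_form A w v = (A w v - adj_form A w v) / (2 * \<i>)"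

text \<open>\<^term>\<open>re_form A v v\<close> is real, so taking \<^const>\<open>Re\<close> below only changes its type.\<close>

definition form_index :: "('f \<Rightarrow> 'f \<Rightarrow> complex) \<Rightarrow> 'f set \<Rightarrow> real" where
  "form_index A V = (LEAST \<beta>. 0 \<le> \<beta> \<and> (\<forall>v\<in>V. cmod (im_form A v v) \<le> \<beta> * Re (re_form A v v)))"


section \<open>Finite elements\<close>

definition mesh_size :: "(real^'d) set set \<Rightarrow> real" where
  "mesh_size \<T> = Max (diameter ` \<T>)"

definition triangulation_of :: "(real^'d) set \<Rightarrow> (real^'d) set set \<Rightarrow> bool" where
  "triangulation_of \<Omega> \<T> \<longleftrightarrow>
    triangulation \<T> \<and> (\<forall>T\<in>\<T>. int CARD('d) simplex T) \<and> \<Union>\<T> = closure \<Omega>"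

text \<open>Quasi-uniformity of a family of meshes means that one \<open>\<sigma> > 0\<close> serves all of them.\<close>

definition quasi_uniform :: "real \<Rightarrow> (real^'d) set set \<Rightarrow> bool" where
  "quasi_uniform \<sigma> \<T> \<longleftrightarrow> (\<forall>T\<in>\<T>. \<exists>x. cball x (\<sigma> * mesh_size \<T>) \<subseteq> T)"

text \<open>The lower-dimensional simplices of the mesh are taken relatively open here: closed ones
  could not separate \<open>\<Gamma>\<^sub>D\<close> from an adjacent \<open>\<Gamma>\<^sub>N\<close>.\<close>

definition mesh_respects_boundary ::
    "(real^'d) set \<Rightarrow> (real^'d) set \<Rightarrow> (real^'d) set \<Rightarrow> (real^'d) set set \<Rightarrow> bool" where
  "mesh_respects_boundary \<Omega> \<Gamma>\<^sub>D \<Gamma>\<^sub>N \<T> \<longleftrightarrow>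
    (\<forall>T\<in>\<T>. \<forall>F. F face_of T \<and> aff_dim F < int CARD('d) \<and> F \<subseteq> frontier \<Omega> \<longrightarrow>
       rel_interior F \<subseteq> \<Gamma>\<^sub>D \<or> rel_interior F \<subseteq> \<Gamma>\<^sub>N)"

text \<open>Finite element functions are set to zero outside the closure of \<open>\<Omega>\<close>, so that an element of
  \<open>V\<^sub>h\<close> is a single function and not a class of functions.\<close>

definition fe_space :: "(real^'d) set \<Rightarrow> (real^'d) set \<Rightarrow> (real^'d) set set \<Rightarrow> (real^'d \<Rightarrow> complex) set" where
  "fe_space \<Omega> \<Gamma>\<^sub>D \<T> =
    {v \<in> H1_vanishing \<Omega> \<Gamma>\<^sub>D. continuous_on (closure \<Omega>) v \<and>
       (\<forall>T\<in>\<T>. \<exists>L c. linear L \<and> (\<forall>x\<in>T. v x = L x + c)) \<and>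
       (\<forall>x. x \<notin> closure \<Omega> \<longrightarrow> v x = 0)}"

definition discrete_operator ::
    "(real^'d) set \<Rightarrow> ((real^'d \<Rightarrow> complex) \<Rightarrow> (real^'d \<Rightarrow> complex) \<Rightarrow> complex) \<Rightarrow>
     (real^'d \<Rightarrow> complex) set \<Rightarrow> (real^'d \<Rightarrow> complex) \<Rightarrow> real^'d \<Rightarrow> complex" where
  "discrete_operator \<Omega> A W w = (THE g. g \<in> W \<and> (\<forall>v\<in>W. L2_inner \<Omega> g v = A w v))"

definition L2_projection ::
    "(real^'d) set \<Rightarrow> (real^'d \<Rightarrow> complex) set \<Rightarrow> (real^'d \<Rightarrow> complex) \<Rightarrow> real^'d \<Rightarrow> complex" where
  "L2_projection \<Omega> W f = (THE g. g \<in> W \<and> (\<forall>v\<in>W. L2_inner \<Omega> g v = L2_inner \<Omega> f v))"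


section \<open>Dunford--Taylor calculus on a finite-dimensional space of functions\<close>

definition op_spectrum :: "('x \<Rightarrow> complex) set \<Rightarrow> (('x \<Rightarrow> complex) \<Rightarrow> 'x \<Rightarrow> complex) \<Rightarrow> complex set" where
  "op_spectrum W T = {z. \<not> bij_betw (\<lambda>w x. z * w x - T w x) W W}"

definition op_resolvent ::
    "('x \<Rightarrow> complex) set \<Rightarrow> (('x \<Rightarrow> complex) \<Rightarrow> 'x \<Rightarrow> complex) \<Rightarrow> complex \<Rightarrow> ('x \<Rightarrow> complex) \<Rightarrow> 'x \<Rightarrow> complex" where
  "op_resolvent W T z = the_inv_into W (\<lambda>w x. z * w x - T w x)"

text \<open>A closed contour in the domain of analyticity of the principal branch, winding once around
  each point of the spectrum. By Cauchy's theorem the choice of contour is immaterial.\<close>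

definition dunford_contour ::
    "('x \<Rightarrow> complex) set \<Rightarrow> (('x \<Rightarrow> complex) \<Rightarrow> 'x \<Rightarrow> complex) \<Rightarrow> (real \<Rightarrow> complex) \<Rightarrow> bool" where
  "dunford_contour W T \<gamma> \<longleftrightarrow>
    valid_path \<gamma> \<and> pathfinish \<gamma> = pathstart \<gamma> \<and>
    path_image \<gamma> \<subseteq> - (\<real>\<^sub>\<le>\<^sub>0 \<union> op_spectrum W T) \<and>
    (\<forall>z\<in>op_spectrum W T. winding_number \<gamma> z = 1)"

text \<open>On a finite-dimensional space of functions an operator-valued integral may be evaluated
  pointwise.\<close>

definition frac_power ::
    "('x \<Rightarrow> complex) set \<Rightarrow> (('x \<Rightarrow> complex) \<Rightarrow> 'x \<Rightarrow> complex) \<Rightarrow> real \<Rightarrow> ('x \<Rightarrow> complex) \<Rightarrow> 'x \<Rightarrow> complex" where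
  "frac_power W T \<alpha> w x =
    contour_integral (SOME \<gamma>. dunford_contour W T \<gamma>)
      (\<lambda>z. z powr of_real \<alpha> * op_resolvent W T z w x) / (2 * of_real pi * \<i>)"


section \<open>The discrete problem and its sinc quadrature\<close>

definition discrete_solution ::
    "('x \<Rightarrow> complex) set \<Rightarrow> (('x \<Rightarrow> complex) \<Rightarrow> 'x \<Rightarrow> complex) \<Rightarrow> real \<Rightarrow> real \<Rightarrow> ('x \<Rightarrow> complex) \<Rightarrow> 'x \<Rightarrow> complex" where
  "discrete_solution W T \<alpha> b = the_inv_into W (\<lambda>w x. frac_power W T \<alpha> w x + of_real b * w x)"

definition sinc_approx ::
    "('x \<Rightarrow> complex) set \<Rightarrow> (('x \<Rightarrow> complex) \<Rightarrow> 'x \<Rightarrow> complex) \<Rightarrow> real \<Rightarrow> real \<Rightarrow> real \<Rightarrow> nat \<Rightarrow> nat \<Rightarrow>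
     ('x \<Rightarrow> complex) \<Rightarrow> 'x \<Rightarrow> complex" where
  "sinc_approx W T \<alpha> b \<tau> M N F x =
    of_real (sin (pi * \<alpha>) / (\<alpha> * pi) * \<tau>) *
    (\<Sum>n\<in>{- int M..int N}.
       the_inv_into W (\<lambda>w y. w y + of_real (exp (- of_int n * \<tau> / \<alpha>)) * T w y) F x /
       of_real (exp (of_int n * \<tau>) + 2 * b * cos (pi * \<alpha>) + b\<^sup>2 * exp (- of_int n * \<tau>)))"

definition tau_factor :: "real \<Rightarrow> real \<Rightarrow> real \<Rightarrow> real \<Rightarrow> real" where
  "tau_factor \<alpha> \<kappa>1 \<kappa>2 \<tau> =
    (if \<kappa>1 > \<kappa>2
     then 1 / sin (min ((\<kappa>1 - \<kappa>2) / \<alpha> + (1 - \<alpha>) / \<alpha> * \<tau>) (pi / 2)) * (1 + \<bar>ln \<tau>\<bar>)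
     else 1 / sin (min \<tau> (pi / 2)) * (1 + \<bar>ln (\<kappa>2 - \<kappa>1 + \<alpha> * \<tau>)\<bar>))"

end

theory Submission
  imports Defs "HOL-Computational_Algebra.Fundamental_Theorem_Algebra"
begin

text \<open>Deforming the Dunford--Taylor contour onto the negative axis (both banks of the slit) gives the
  Balakrishnan formula, which after \<open>\<mu> = e\<^sup>y\<close> reads
  \<open>u\<^sub>h = sin (\<pi> \<alpha>) / (\<alpha> \<pi>) \<integral> (1 + e\<^bsup>-y/\<alpha>\<^esup> A\<^sub>h)\<^sup>-\<^sup>1 f\<^sub>h / (e\<^sup>y + 2 b cos (\<pi> \<alpha>) + b\<^sup>2 e\<^bsup>-y\<^esup>) dy\<close> over the real line; the sinc
  approximation is its truncated trapezoidal sum. The integrand extends analytically to a strip: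
  since the numerical range of \<open>A\<^sub>h\<close> lies in the sector of half-angle \<open>arctan \<beta>\<close>, the resolvent limits
  the half-width to \<open>\<kappa>1\<close>, and the zeros of the scalar denominator limit it to \<open>\<kappa>2\<close>. The discretisation
  error of the trapezoidal rule is exponentially small in the width, up to integrals along the edges
  of the strip; stopping at distance of order \<open>\<tau>\<close> from the singularities costs the factors
  \<open>1 / sin\<close> and \<open>\<bar>ln\<bar>\<close> in \<^const>\<open>tau_factor\<close>. The choice of \<open>M\<close> and \<open>N\<close> balances this error against
  the two truncated tails. All bounds depend on \<open>A\<^sub>h\<close> only through its sector and its coercivity
  constant, so they do not depend on the mesh.\<close>

section \<open>Trapezoidal sums of functions analytic in a strip\<close>

text \<open>\<open>frac_power\<close> refers to a contour picked by \<open>SOME\<close>, and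
  \<open>fe_space\<close> is a set of functions and not a type, so the operator calculus is built on
  a carrier set. Its basis is a list \<open>LS\<close> of complex numbers for which the product of
  the T - l is 0 on that set. Peeling off one factor at a time makes the resolvent an explicit
  rational function and each Dunford-Taylor integral a Newton interpolation, in which the contour no
  longer occurs. No operator-valued quadrature is needed: the error e is paired with itself, so
  ||e||^2 is the quadrature error of a scalar function, which Cauchy-Schwarz bounds by a multiple of
  ||f|| ||e||, and one factor ||e|| cancels. Coercivity acts twice. It keeps the spectrum off the
  slit, and it gives the integrand the decay e^{(1 + 1/\<alpha>) y} towards -\<infinity>, against
  e^{-y} towards +\<infinity>; hence the weight 1 + 1/\<alpha> of M. The logarithm arises because
  near the edge of the strip only one of the two factors of the denominator can be small, and it is
  so linearly in the distance to its zero: integrating the reciprocal along the edge gives a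
  logarithm, whereas the sine is a uniform bound of the resolvent.\<close>

lemma contour_integral_rectpath:
  assumes "continuous_on (path_image (rectpath a b)) f"
  shows "contour_integral (rectpath a b) f =
    contour_integral (linepath a (Complex (Re b) (Im a))) f +
    contour_integral (linepath (Complex (Re b) (Im a)) b) f -
    contour_integral (linepath (Complex (Re a) (Im b)) b) f -
    contour_integral (linepath a (Complex (Re a) (Im b))) f"
proof -
  define p where "p = Complex (Re b) (Im a)"
  define q where "q = Complex (Re a) (Im b)"
  have im: "path_image (rectpath a b) =
      closed_segment a p \<union> closed_segment p b \<union> closed_segment b q \<union> closed_segment q a"
    by (auto simp: rectpath_def Let_def path_image_join p_def q_def)
  have ci: "f contour_integrable_on linepath a p" "f contour_integrable_on linepath p b"
    "f contour_integrable_on linepath b q" "f contour_integrable_on linepath q a"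
    using assms unfolding im
    by (auto intro!: contour_integrable_continuous_linepath elim: continuous_on_subset)
  have "contour_integral (rectpath a b) f =
    contour_integral (linepath a p) f + (contour_integral (linepath p b) f +
    (contour_integral (linepath b q) f + contour_integral (linepath q a) f))"
    using ci by (simp add: rectpath_def Let_def flip: p_def q_def)
  moreover have "contour_integral (linepath b q) f = - contour_integral (linepath q b) f"
    "contour_integral (linepath q a) f = - contour_integral (linepath a q) f"
    using assms unfolding im
    by (auto intro!: contour_integral_reverse_linepath elim: continuous_on_subset
        simp: closed_segment_commute)
  ultimately show ?thesis by (simp add: p_def q_def)
qed

text \<open>A vertical translation reduces this to a segment of the real axis.\<close>

lemma has_contour_integral_linepath_horizontal:
  assumes "a < b"
  shows "(f has_contour_integral I) (linepath (Complex a y) (Complex b y)) \<longleftrightarrow>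
    ((\<lambda>x. f (Complex x y)) has_integral I) {a..b}"
proof -
  have eq: "Complex x y = of_real x + \<i> * of_real y" for x
    by (simp add: complex_eq_iff)
  have "linepath (Complex a y) (Complex b y) t = linepath (of_real a) (of_real b) t + \<i> * of_real y" for t
    by (simp add: linepath_def complex_eq_iff algebra_simps)
  then have "(f has_contour_integral I) (linepath (Complex a y) (Complex b y)) \<longleftrightarrow>
      ((\<lambda>z. f (z + \<i> * of_real y)) has_contour_integral I) (linepath (of_real a) (of_real b))"
    by (simp add: has_contour_integral_linepath eq)
  also have "\<dots> \<longleftrightarrow> ((\<lambda>x. f (Complex x y)) has_integral I) {a..b}"
    using assms by (subst has_contour_integral_linepath_Reals_iff) (auto simp: eq)
  finally show ?thesis .
qed

lemma contour_integral_linepath_horizontal: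
  assumes "a < b" "continuous_on (closed_segment (Complex a y) (Complex b y)) f"
  shows "((\<lambda>x. f (Complex x y)) has_integral
    contour_integral (linepath (Complex a y) (Complex b y)) f) {a..b}"
  using assms contour_integrable_continuous_linepath has_contour_integral_integral
  by (metis has_contour_integral_linepath_horizontal)

lemma contour_integral_horizontal_bound:
  assumes "a < b" "continuous_on (closed_segment (Complex a y) (Complex b y)) f"
    "\<And>x. x \<in> {a..b} \<Longrightarrow> cmod (f (Complex x y)) \<le> g x" "g integrable_on {a..b}"
  shows "cmod (contour_integral (linepath (Complex a y) (Complex b y)) f) \<le> integral {a..b} g"
  using integral_norm_bound_integral[OF has_integral_integrable assms(4,3)]
    contour_integral_linepath_horizontal[OF assms(1,2)]
  by (metis integral_unique)

lemma contour_integral_vertical_bound: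
  assumes "y \<le> y'" "continuous_on (closed_segment (Complex x y) (Complex x y')) f"
    "\<And>t. y \<le> t \<Longrightarrow> t \<le> y' \<Longrightarrow> cmod (f (Complex x t)) \<le> B"
  shows "cmod (contour_integral (linepath (Complex x y) (Complex x y')) f) \<le> B * (y' - y)"
proof -
  have "0 \<le> B" using assms(3)[of y] assms(1) norm_ge_zero order_trans by blast
  moreover have "cmod (f z) \<le> B" if "z \<in> closed_segment (Complex x y) (Complex x y')" for z
  proof -
    have "z = Complex x (Im z)" "y \<le> Im z" "Im z \<le> y'"
      using that assms(1) by (auto simp: closed_segment_same_Re closed_segment_eq_real_ivl complex_eq_iff)
    then show ?thesis using assms(3) by metis
  qed
  ultimately have "cmod (contour_integral (linepath (Complex x y) (Complex x y')) f) \<le>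
      B * cmod (Complex x y' - Complex x y)"
    using contour_integrable_continuous_linepath[OF assms(2)]
    by (intro contour_integral_bound_linepath) auto
  also have "cmod (Complex x y' - Complex x y) = y' - y"
    using assms(1) by (simp add: complex_norm cmod_def)
  finally show ?thesis .
qed

section \<open>Strips, rectangles and the error of trapezoidal sums\<close>

lemma open_strip: "open {z. \<bar>Im z\<bar> < d}"
proof -
  have "{z. \<bar>Im z\<bar> < d} = {z. Im z < d} \<inter> {z. Im z > - d}" by auto
  then show ?thesis by (auto intro!: open_Int open_halfspace_Im_lt open_halfspace_Im_gt)
qed

lemma convex_strip: "convex {z. \<bar>Im z\<bar> < d}"
proof -
  have "{z. \<bar>Im z\<bar> < d} = {z. Im z < d} \<inter> {z. Im z > - d}" by auto
  then show ?thesis by (auto intro!: convex_Int convex_halfspace_Im_lt convex_halfspace_Im_gt)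
qed

lemma convex_open_rectangle: "open {z. \<bar>Re z\<bar> < c \<and> \<bar>Im z\<bar> < d}" "convex {z. \<bar>Re z\<bar> < c \<and> \<bar>Im z\<bar> < d}"
proof -
  have *: "{z. \<bar>Re z\<bar> < c \<and> \<bar>Im z\<bar> < d} = {z. Re z < c} \<inter> {z. Re z > - c} \<inter> {z. \<bar>Im z\<bar> < d}" by auto
  show "open {z. \<bar>Re z\<bar> < c \<and> \<bar>Im z\<bar> < d}" unfolding *
    by (intro open_Int open_halfspace_Re_lt open_halfspace_Re_gt open_strip)
  show "convex {z. \<bar>Re z\<bar> < c \<and> \<bar>Im z\<bar> < d}" unfolding *
    by (intro convex_Int convex_halfspace_Re_lt convex_halfspace_Re_gt convex_strip)
qed

text \<open>The trapezoidal sum is a contour integral of \<^term>\<open>G\<close> against a kernel with poles at the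
  nodes; the kernel is exponentially close to \<open>0\<close> on the upper side of the strip and to \<open>1\<close> on the
  lower one.\<close>

lemma trapezoidal_sum_error:
  fixes G :: "complex \<Rightarrow> complex" and g :: "real \<Rightarrow> real" and K :: nat
  assumes \<tau>: "0 < \<tau>" and d: "0 < d" "d < d1"
    and holo: "G holomorphic_on {z. \<bar>Im z\<bar> < d1}"
    and bound: "\<And>z. \<bar>Im z\<bar> \<le> d \<Longrightarrow> cmod (G z) \<le> g (Re z)"
    and g_int: "\<And>a b. g integrable_on {a..b}"
    and g_le: "\<And>a b. a < b \<Longrightarrow> integral {a..b} g \<le> J"
    and L: "L = (real K + 1 / 2) * \<tau>"
  shows "cmod (of_real \<tau> * (\<Sum>n\<in>{- int K..int K}. G (of_real (of_int n * \<tau>))) -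
            integral {- L..L} (\<lambda>x. G (of_real x)))
         \<le> 2 * J / (exp (2 * pi * d / \<tau>) - 1) + 6 * d * (g L + g (- L))"
proof -
  \<comment> \<open>\<open>e\<close> equals 1 exactly at the nodes n \<tau>, and its modulus exp (2
    pi Im z / \<tau>) depends on the height alone.\<close>
  define e where "e z = exp (- (2 * of_real pi * \<i> * z / of_real \<tau>))" for z
  define E where "E = exp (2 * pi * d / \<tau>)"
  \<comment> \<open>Contains the nodes with \<bar>n\<bar> \<le> K and no others: the next ones lie
    on the boundary of this open rectangle.\<close>
  define S where "S = {z. \<bar>Re z\<bar> < (K + 1) * \<tau> \<and> \<bar>Im z\<bar> < d1}"
  define node where "node n = complex_of_real (of_int n * \<tau>)" for n :: int
  define pts where "pts = node ` {- int K..int K}"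
  define F where "F z = G z / (1 - e z)" for z
  define R where "R = rectpath (Complex (-L) (-d)) (Complex L d)"
  have L0: "0 < L" using \<tau> L by simp
  have E1: "1 < E" unfolding E_def using \<tau> d by simp
  have S: "open S" "convex S" unfolding S_def by (rule convex_open_rectangle)+
  have inj: "inj node" using \<tau> by (auto simp: inj_def node_def)
  have e_eq_1: "e z = 1 \<longleftrightarrow> (\<exists>n. z = node n)" for z
  proof
    assume "e z = 1"
    then obtain k :: int where "- (2 * of_real pi * \<i> * z / of_real \<tau>) = of_int (2 * k) * of_real pi * \<i>"
      unfolding e_def exp_eq_1 by (auto simp: complex_eq_iff)
    then have "(2 * of_real pi * \<i>) * z = (2 * of_real pi * \<i>) * node (- k)"
      using \<tau> by (simp add: node_def field_simps) (metis add.inverse_inverse mult_minus_right)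
    then have "z = node (- k)" by simp
    then show "\<exists>n. z = node n" ..
  next
    assume "\<exists>n. z = node n"
    then obtain n where "z = node n" ..
    then have "- (2 * of_real pi * \<i> * z / of_real \<tau>) = of_int (2 * (-n)) * of_real pi * \<i>"
      using \<tau> by (simp add: node_def)
    then have "Im (- (2 * of_real pi * \<i> * z / of_real \<tau>)) = of_int (2 * (-n)) * pi"
      "Re (- (2 * of_real pi * \<i> * z / of_real \<tau>)) = 0"
      by simp_all
    then show "e z = 1" unfolding e_def exp_eq_1 by blast
  qed
  have node_S: "node n \<in> S \<longleftrightarrow> n \<in> {- int K..int K}" for n
  proof -
    have "\<bar>of_int n * \<tau>\<bar> < (K + 1) * \<tau> \<longleftrightarrow> \<bar>real_of_int n\<bar> < real_of_int (int K + 1)"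
      using \<tau> by (simp add: abs_mult add.commute)
    also have "\<dots> \<longleftrightarrow> \<bar>n\<bar> < int K + 1" by linarith
    finally show ?thesis using d by (auto simp: S_def node_def)
  qed
  have hG: "G holomorphic_on S" using holo by (rule holomorphic_on_subset) (auto simp: S_def)
  have he: "(\<lambda>z. 1 - e z) holomorphic_on A" for A unfolding e_def by (intro holomorphic_intros) (use \<tau> in auto)
  have hF: "F holomorphic_on S - pts" unfolding F_def
    using hG he e_eq_1 node_S
    by (intro holomorphic_on_divide) (auto simp: pts_def elim: holomorphic_on_subset)
  have norm_e: "cmod (e z) = exp (2 * pi * Im z / \<tau>)" for z
    by (simp add: e_def)
  have imR: "path_image R = {z. Re z \<in> {- L, L} \<and> Im z \<in> {- d..d}} \<union> {z. Im z \<in> {- d, d} \<and> Re z \<in> {- L..L}}"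
    unfolding R_def using L0 d by (subst path_image_rectpath) auto
  have L_less: "L < (K + 1) * \<tau>" using \<tau> L by (simp add: algebra_simps)
  have boxS: "z \<in> S" if "\<bar>Re z\<bar> \<le> L" "\<bar>Im z\<bar> \<le> d" for z
    using that d L_less by (auto simp: S_def)
  \<comment> \<open>The abscissa L is a half-integer multiple of \<tau>, so \<open>e\<close> is
    negative there and \<bar>1 - e\<bar> is at least 1. The vertical sides pass midway between two
    poles.\<close>
  have e_vert: "e (Complex x y) = - exp (2 * pi * y / \<tau>)" if "x = L \<or> x = - L" for x y
  proof -
    have "- (2 * of_real pi * \<i> * Complex L y / of_real \<tau>) =
        of_real (2 * pi * y / \<tau>) + of_int (2 * (- int K - 1)) * of_real pi * \<i> + of_real pi * \<i>"
      "- (2 * of_real pi * \<i> * Complex (- L) y / of_real \<tau>) =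
        of_real (2 * pi * y / \<tau>) + of_int (2 * int K) * of_real pi * \<i> + of_real pi * \<i>"
      using \<tau> by (simp_all add: L complex_eq_iff field_simps)
    moreover have "exp (of_real r + of_int (2 * k) * of_real pi * \<i> + of_real pi * \<i>) = - complex_of_real (exp r)"
      for r and k :: int
    proof -
      have "exp (of_int (2 * k) * complex_of_real pi * \<i>) = 1" unfolding exp_eq_1 by simp
      then show ?thesis by (simp only: exp_add exp_pi_i exp_of_real) simp
    qed
    ultimately have "e (Complex L y) = - complex_of_real (exp (2 * pi * y / \<tau>))"
      "e (Complex (- L) y) = - complex_of_real (exp (2 * pi * y / \<tau>))"
      unfolding e_def by (simp_all only:)
    then show ?thesis using that by auto
  qed
  have ne_vert: "1 \<le> cmod (1 - e (Complex x y))" if "x = L \<or> x = - L" for x y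
  proof -
    have "1 - e (Complex x y) = of_real (1 + exp (2 * pi * y / \<tau>))"
      by (simp add: e_vert[OF that] flip: exp_of_real)
    then show ?thesis by (simp only: norm_of_real) simp
  qed
  have ptsR: "path_image R \<inter> pts = {}"
  proof -
    have "z \<notin> path_image R" if "e z = 1" for z
    proof
      assume "z \<in> path_image R"
      then consider "Re z = L \<or> Re z = - L" | "\<bar>Im z\<bar> = d"
        using d by (auto simp: imR)
      then show False
      proof cases
        case 1
        then show False using ne_vert[of "Re z" "Im z"] that by simp
      next
        case 2
        then have "exp (2 * pi * Im z / \<tau>) \<noteq> 1" using d \<tau> by auto
        then show False using norm_e[of z] that by simp
      qed
    qed
    then show ?thesis using e_eq_1 by (auto simp: pts_def)
  qed
  have R_sub: "path_image R \<subseteq> S - pts"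
    using ptsR boxS L0 d by (fastforce simp: imR)
  \<comment> \<open>Simple pole: 1 - e has derivative 2 pi i / \<tau> at a node, so the factor 2 pi
    i of the residue theorem turns into the step size \<tau>.\<close>
  have res: "residue F (node n) = G (node n) * (of_real \<tau> / (2 * of_real pi * \<i>))" if n: "n \<in> {- int K..int K}" for n
  proof (rule residue_simple')
    show "open (S - (pts - {node n}))" using S by (intro open_Diff finite_imp_closed) (auto simp: pts_def)
    show "node n \<in> S - (pts - {node n})" using n node_S by auto
    show "F holomorphic_on S - (pts - {node n}) - {node n}"
      using hF by (rule holomorphic_on_subset) auto
    have "((\<lambda>z. 1 - e z) has_field_derivative e (node n) * (2 * of_real pi * \<i> / of_real \<tau>)) (at (node n))"
      unfolding e_def by (auto intro!: derivative_eq_intros simp: \<tau>[THEN less_imp_neq, symmetric])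
    then have lim: "((\<lambda>w. (1 - e w) / (w - node n)) \<longlongrightarrow> 2 * of_real pi * \<i> / of_real \<tau>) (at (node n))"
      using e_eq_1[of "node n"] by (auto simp: has_field_derivative_iff)
    have "isCont G (node n)"
      using hG S n node_S holomorphic_on_imp_continuous_on continuous_on_eq_continuous_at by blast
    then have "((\<lambda>w. G w / ((1 - e w) / (w - node n))) \<longlongrightarrow> G (node n) / (2 * of_real pi * \<i> / of_real \<tau>)) (at (node n))"
      unfolding isCont_def by (rule tendsto_divide[OF _ lim]) (use \<tau> in simp)
    then show "((\<lambda>w. F w * (w - node n)) \<longlongrightarrow> G (node n) * (of_real \<tau> / (2 * of_real pi * \<i>))) (at (node n))"
      by (simp add: F_def)
  qed
  have "contour_integral R F = 2 * pi * \<i> * (\<Sum>p\<in>pts. winding_number R p * residue F p)"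
  proof (rule Residue_theorem[OF S(1) _ _ hF _ _ R_sub])
    show "connected S" using S by (simp add: convex_connected)
    show "finite pts" by (simp add: pts_def)
    show "valid_path R" "pathfinish R = pathstart R" by (simp_all add: R_def)
    show "\<forall>z. z \<notin> S \<longrightarrow> winding_number R z = 0"
      using boxS L0 d unfolding R_def
      by (intro allI impI winding_number_rectpath_outside) (auto simp: in_cbox_complex_iff abs_le_iff)
  qed
  also have "(\<Sum>p\<in>pts. winding_number R p * residue F p) = (\<Sum>p\<in>pts. residue F p)"
  proof (rule sum.cong)
    fix p assume "p \<in> pts"
    then obtain n where n: "n \<in> {- int K..int K}" "p = node n" by (auto simp: pts_def)
    then have "\<bar>real_of_int n\<bar> \<le> K" by auto
    then have "\<bar>real_of_int n\<bar> * \<tau> \<le> K * \<tau>" using \<tau> by (intro mult_right_mono) auto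
    moreover have "K * \<tau> < L" using \<tau> by (simp add: L algebra_simps)
    ultimately have "\<bar>real_of_int n\<bar> * \<tau> < L" by linarith
    then have "\<bar>of_int n * \<tau>\<bar> < L" using \<tau> by (simp add: abs_mult)
    then have "p \<in> box (Complex (- L) (- d)) (Complex L d)"
      using n d by (auto simp: in_box_complex_iff node_def)
    then have "winding_number R p = 1" unfolding R_def by (rule winding_number_rectpath)
    then show "winding_number R p * residue F p = residue F p" by simp
  qed simp
  also have "\<dots> = (\<Sum>n\<in>{- int K..int K}. residue F (node n))"
    unfolding pts_def using inj by (subst sum.reindex) (auto intro: inj_on_subset)
  also have "\<dots> = (\<Sum>n\<in>{- int K..int K}. G (node n)) * (of_real \<tau> / (2 * of_real pi * \<i>))"
    unfolding sum_distrib_right by (intro sum.cong refl res)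
  finally have sum_eq: "contour_integral R F = of_real \<tau> * (\<Sum>n\<in>{- int K..int K}. G (node n))"
    by simp
  have contF: "continuous_on (path_image R) F"
    using hF R_sub by (meson continuous_on_subset holomorphic_on_imp_continuous_on)
  have contG: "continuous_on A G" if "A \<subseteq> S" for A
    using hG that by (meson continuous_on_subset holomorphic_on_imp_continuous_on)
  define low where "low f = contour_integral (linepath (Complex (-L) (-d)) (Complex L (-d))) f" for f
  define up where "up f = contour_integral (linepath (Complex (-L) d) (Complex L d)) f" for f
  define rgt where "rgt f = contour_integral (linepath (Complex L (-d)) (Complex L d)) f" for f
  define lft where "lft f = contour_integral (linepath (Complex (-L) (-d)) (Complex (-L) d)) f" for f
  have split: "contour_integral R F = low F + rgt F - up F - lft F"
    using contour_integral_rectpath[OF contF[unfolded R_def]]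
    by (simp add: R_def low_def up_def rgt_def lft_def)
  have segs: "closed_segment (Complex (-L) y) (Complex L y) \<subseteq> path_image R" if "\<bar>y\<bar> = d" for y
    using that L0 d by (auto simp: imR closed_segment_same_Im closed_segment_eq_real_ivl)
  have segs': "closed_segment (Complex x (-d)) (Complex x d) \<subseteq> path_image R" if "\<bar>x\<bar> = L" for x
    using that L0 d by (auto simp: imR closed_segment_same_Re closed_segment_eq_real_ivl)
  have up: "cmod (up F) \<le> J / (E - 1)"
  proof -
    have "cmod (up F) \<le> integral {-L..L} (\<lambda>x. g x * (1 / (E - 1)))"
      unfolding up_def
    proof (rule contour_integral_horizontal_bound)
      show "- L < L" using L0 by simp
      show "continuous_on (closed_segment (Complex (- L) d) (Complex L d)) F"
        using contF segs[of d] d by (auto elim: continuous_on_subset)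
      show "(\<lambda>x. g x * (1 / (E - 1))) integrable_on {- L..L}"
        by (intro integrable_on_mult_left g_int)
      fix x assume "x \<in> {- L..L}"
      have "cmod (e (Complex x d)) = E" by (simp add: norm_e E_def)
      then have "E - 1 \<le> cmod (1 - e (Complex x d))"
        using norm_triangle_ineq3[of 1 "e (Complex x d)"] by simp
      moreover have "cmod (G (Complex x d)) \<le> g x" using bound[of "Complex x d"] d by simp
      ultimately show "cmod (F (Complex x d)) \<le> g x * (1 / (E - 1))"
        using E1 by (simp add: F_def norm_divide frac_le order_trans[OF norm_ge_zero])
    qed
    also have "\<dots> = integral {-L..L} g / (E - 1)" by (subst integral_mult_left) simp
    also have "\<dots> \<le> J / (E - 1)" using E1 g_le L0 by (intro divide_right_mono) auto
    finally show ?thesis .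
  qed
  \<comment> \<open>Below the axis F differs from G by G e / (1 - e), and \<bar>e\<bar> = 1/E yields
    the same factor 1 / (E - 1) as on the upper side.\<close>
  have low: "cmod (low F - low G) \<le> J / (E - 1)"
  proof -
    have ci: "f contour_integrable_on linepath (Complex (-L) (-d)) (Complex L (-d))"
      if "continuous_on (path_image R) f" for f
      using that segs[of "-d"] d by (auto intro!: contour_integrable_continuous_linepath elim: continuous_on_subset)
    have contG': "continuous_on (path_image R) G" using R_sub by (intro contG) auto
    have "low F - low G = low (\<lambda>z. F z - G z)"
      unfolding low_def using contF contG' by (intro contour_integral_diff[symmetric] ci)
    also have "cmod \<dots> \<le> integral {-L..L} (\<lambda>x. g x * (1 / (E - 1)))"
      unfolding low_def
    proof (rule contour_integral_horizontal_bound)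
      show "- L < L" using L0 by simp
      show "continuous_on (closed_segment (Complex (- L) (-d)) (Complex L (-d))) (\<lambda>z. F z - G z)"
        using contF contG' segs[of "-d"] d by (auto intro!: continuous_on_diff elim: continuous_on_subset)
      show "(\<lambda>x. g x * (1 / (E - 1))) integrable_on {- L..L}"
        by (intro integrable_on_mult_left g_int)
      fix x assume "x \<in> {- L..L}"
      define q where "q = e (Complex x (-d))"
      have q: "cmod q = 1 / E" by (simp add: q_def norm_e E_def exp_minus field_simps)
      then have "1 - 1 / E \<le> cmod (1 - q)"
        using norm_triangle_ineq2[of 1 q] by simp
      moreover have "0 < 1 - 1 / E" using E1 by simp
      ultimately have "cmod q / cmod (1 - q) \<le> (1 / E) / (1 - 1 / E)" and nz: "1 - q \<noteq> 0"
        unfolding q using E1 by (auto intro!: divide_left_mono mult_pos_pos simp del: less_divide_eq_1 divide_less_eq_1 zero_less_diff le_divide_eq divide_le_eq)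
      moreover have "(1 / E) / (1 - 1 / E) = 1 / (E - 1)" using E1 by (simp add: field_simps)
      moreover have "cmod (G (Complex x (-d))) \<le> g x" using bound[of "Complex x (-d)"] d by simp
      ultimately have "cmod (G (Complex x (-d))) * (cmod q / cmod (1 - q)) \<le> g x * (1 / (E - 1))"
        by (intro mult_mono) (auto intro: order_trans[OF norm_ge_zero])
      moreover have "F (Complex x (-d)) - G (Complex x (-d)) = G (Complex x (-d)) * (q / (1 - q))"
        using nz by (simp add: F_def field_simps flip: q_def)
      ultimately show "cmod (F (Complex x (-d)) - G (Complex x (-d))) \<le> g x * (1 / (E - 1))"
        by (simp add: norm_mult norm_divide)
    qed
    also have "\<dots> = integral {-L..L} g / (E - 1)" by (subst integral_mult_left) simp
    also have "\<dots> \<le> J / (E - 1)" using E1 g_le L0 by (intro divide_right_mono) auto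
    finally show ?thesis .
  qed
  have vert: "cmod (contour_integral (linepath (Complex x (-d)) (Complex x d)) F) \<le> g x * (2 * d)"
    if x: "x = L \<or> x = - L" for x
  proof -
    have "cmod (contour_integral (linepath (Complex x (-d)) (Complex x d)) F) \<le> g x * (d - - d)"
    proof (rule contour_integral_vertical_bound)
      show "continuous_on (closed_segment (Complex x (- d)) (Complex x d)) F"
        using contF segs'[of x] x L0 by (auto elim: continuous_on_subset)
      fix t assume t: "- d \<le> t" "t \<le> d"
      then have "cmod (G (Complex x t)) \<le> g x" using bound[of "Complex x t"] by simp
      moreover have "cmod (G (Complex x t)) / cmod (1 - e (Complex x t)) \<le> cmod (G (Complex x t)) / 1"
        using ne_vert[OF x, of t] norm_ge_zero[of "G (Complex x t)"] by (intro divide_left_mono mult_pos_pos) linarith+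
      ultimately show "cmod (F (Complex x t)) \<le> g x" by (simp add: F_def norm_divide)
    qed (use d in auto)
    then show ?thesis by simp
  qed
  \<comment> \<open>Cauchy's theorem on the lower half of the rectangle brings the integral of G
    back to the real axis; two vertical pieces of length d remain.\<close>
  have shift: "cmod (low G - integral {-L..L} (\<lambda>x. G (of_real x))) \<le> d * (g L + g (- L))"
  proof -
    define Q where "Q = rectpath (Complex (-L) (-d)) (Complex L 0)"
    have Q_sub: "path_image Q \<subseteq> S"
    proof -
      have "path_image Q \<subseteq> cbox (Complex (-L) (-d)) (Complex L 0)"
        unfolding Q_def using L0 d by (intro path_image_rectpath_subset_cbox) auto
      then show ?thesis using boxS d by (force simp: in_cbox_complex_iff)
    qed
    have Q0: "contour_integral Q G = 0"
      using S(2) hG Q_sub by (intro contour_integral_unique Cauchy_theorem_convex_simple) (auto simp: Q_def)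
    have *: "contour_integral Q G = low G + contour_integral (linepath (Complex L (-d)) (Complex L 0)) G
        - contour_integral (linepath (Complex (-L) 0) (Complex L 0)) G
        - contour_integral (linepath (Complex (-L) (-d)) (Complex (-L) 0)) G"
      using contour_integral_rectpath[of "Complex (-L) (-d)" "Complex L 0" G] contG[OF Q_sub]
      by (simp add: Q_def low_def)
    have real: "contour_integral (linepath (Complex (-L) 0) (Complex L 0)) G = integral {-L..L} (\<lambda>x. G (of_real x))"
    proof -
      have "closed_segment (Complex (-L) 0) (Complex L 0) \<subseteq> S"
        using L0 d boxS by (auto simp: closed_segment_same_Im closed_segment_eq_real_ivl)
      then have "((\<lambda>x. G (Complex x 0)) has_integral contour_integral (linepath (Complex (-L) 0) (Complex L 0)) G) {-L..L}"
        using L0 by (intro contour_integral_linepath_horizontal contG) auto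
      then show ?thesis by (simp add: integral_unique complex_of_real_def)
    qed
    have side: "cmod (contour_integral (linepath (Complex x (-d)) (Complex x 0)) G) \<le> g x * d"
      if x: "x = L \<or> x = - L" for x
    proof -
      have "cmod (contour_integral (linepath (Complex x (-d)) (Complex x 0)) G) \<le> g x * (0 - - d)"
      proof (rule contour_integral_vertical_bound)
        show "continuous_on (closed_segment (Complex x (- d)) (Complex x 0)) G"
          using x L0 d boxS by (intro contG) (auto simp: closed_segment_same_Re closed_segment_eq_real_ivl)
        fix t assume t: "- d \<le> t" "t \<le> 0"
        then show "cmod (G (Complex x t)) \<le> g x" using bound[of "Complex x t"] by simp
      qed (use d in auto)
      then show ?thesis by simp
    qed
    have "low G - integral {-L..L} (\<lambda>x. G (of_real x)) =
        contour_integral (linepath (Complex (-L) (-d)) (Complex (-L) 0)) G -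
        contour_integral (linepath (Complex L (-d)) (Complex L 0)) G"
      using * unfolding Q0 real by (simp add: algebra_simps)
    also have "cmod \<dots> \<le> g (-L) * d + g L * d"
      using side[of L] side[of "-L"] by (intro norm_triangle_le_diff add_mono) auto
    finally show ?thesis by (simp add: algebra_simps)
  qed
  define I where "I = integral {-L..L} (\<lambda>x. G (of_real x))"
  have "contour_integral R F - I = (low F - low G) + (low G - I) + rgt F + (- up F) + (- lft F)"
    unfolding split by simp
  also have "cmod \<dots> \<le> cmod (low F - low G) + cmod (low G - I) + cmod (rgt F) + cmod (up F) + cmod (lft F)"
    by (intro norm_triangle_le add_mono) (simp_all add: norm_minus_cancel)
  also have "\<dots> \<le> J / (E - 1) + d * (g L + g (- L)) + g L * (2 * d) + J / (E - 1) + g (- L) * (2 * d)"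
    using low up vert shift unfolding rgt_def lft_def I_def by (intro add_mono) auto
  \<comment> \<open>Each vertical side costs 2 d for F and d for the shift of G; 6 d is twice that
    total.\<close>
  also have "\<dots> \<le> 2 * J / (E - 1) + 6 * d * (g L + g (- L))"
  proof -
    have "0 \<le> g L" "0 \<le> g (-L)" using bound[of "of_real L"] bound[of "of_real (-L)"] d
      by (auto intro: order_trans[OF norm_ge_zero])
    then have "0 \<le> d * (g L + g (-L))" using d by simp
    then show ?thesis by (simp add: algebra_simps)
  qed
  finally show ?thesis unfolding sum_eq I_def E_def node_def .
qed

section \<open>The scalar kernel\<close>

text \<open>The sum is 2 cosh w, and \<bar>cosh (x + i y)\<bar>^2 = sinh^2 x + cos^2 y. Replacing
  \<bar>sinh x\<bar> by the smaller \<bar>x\<bar> keeps linear growth, which is enough: two such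
  factors make the reciprocal integrable.\<close>

lemma norm_exp_plus_exp_minus_ge:
  "\<bar>Re w\<bar> + \<bar>cos (Im w)\<bar> \<le> cmod (exp w + exp (- w))"
proof -
  define x y where "x = Re w" and "y = Im w"
  have "exp w + exp (- w) = Complex (2 * cosh x * cos y) (2 * sinh x * sin y)"
    by (simp add: complex_eq_iff Re_exp Im_exp x_def y_def cosh_field_def sinh_field_def algebra_simps)
  then have "(cmod (exp w + exp (- w)))\<^sup>2 = (2 * cosh x * cos y)\<^sup>2 + (2 * sinh x * sin y)\<^sup>2"
    by (simp add: cmod_power2)
  also have "\<dots> = 4 * ((1 + (sinh x)\<^sup>2) * (cos y)\<^sup>2 + (sinh x)\<^sup>2 * (1 - (cos y)\<^sup>2))"
    by (simp add: power_mult_distrib cosh_square_eq sin_squared_eq)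
  also have "\<dots> = 4 * ((sinh x)\<^sup>2 + (cos y)\<^sup>2)" by (simp add: algebra_simps)
  finally have eq: "(cmod (exp w + exp (- w)))\<^sup>2 = 4 * ((sinh x)\<^sup>2 + (cos y)\<^sup>2)" .
  have "\<bar>x\<bar> \<le> \<bar>sinh x\<bar>" using real_le_abs_sinh[of x] by (simp add: sinh_field_def exp_minus)
  then have "x\<^sup>2 \<le> (sinh x)\<^sup>2" by (simp add: abs_le_square_iff)
  moreover have "(\<bar>x\<bar> + \<bar>cos y\<bar>)\<^sup>2 \<le> 2 * (x\<^sup>2 + (cos y)\<^sup>2)"
    using sum_squares_ge_zero[of "\<bar>x\<bar> - \<bar>cos y\<bar>" 0] by (simp add: power2_eq_square algebra_simps)
  moreover have "A \<le> 4 * (s + q)" if "p \<le> s" "A \<le> 2 * (p + q)" "0 \<le> p" "0 \<le> q" for A p q s :: real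
    using that by argo
  ultimately have "(\<bar>x\<bar> + \<bar>cos y\<bar>)\<^sup>2 \<le> (cmod (exp w + exp (- w)))\<^sup>2"
    unfolding eq using zero_le_power2 by blast
  then show ?thesis using norm_ge_zero power2_le_imp_le unfolding x_def y_def by blast
qed

text \<open>A weak form of Jordan's inequality. Up to pi/3 the derivative cos x - 1/3 is
  nonnegative; beyond, sin x \<ge> sqrt 3 / 2 \<ge> 2/3 \<ge> x/3.\<close>

lemma sin_ge_third:
  assumes "0 \<le> x" "x \<le> pi / 2"
  shows "x / 3 \<le> sin x"
proof (cases "x \<le> pi / 3")
  case True
  have "sin 0 - 0 / 3 \<le> sin x - x / 3"
  proof (rule DERIV_nonneg_imp_nondecreasing[OF assms(1)])
    fix t assume t: "0 \<le> t" "t \<le> x"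
    have "((\<lambda>x. sin x - x / 3) has_real_derivative cos t - 1 / 3) (at t)"
      by (auto intro!: derivative_eq_intros)
    moreover have "cos (pi / 3) \<le> cos t" using t True by (intro cos_monotone_0_pi_le) auto
    ultimately show "\<exists>y. ((\<lambda>x. sin x - x / 3) has_real_derivative y) (at t) \<and> 0 \<le> y"
      by (auto simp: cos_60)
  qed
  then show ?thesis by simp
next
  case False
  have "sin (pi / 3) \<le> sin x" using False assms by (intro sin_monotone_2pi_le) auto
  moreover have "4 / 3 \<le> sqrt (3 :: real)" by (rule real_le_rsqrt) (simp add: power2_eq_square)
  moreover have "x / 3 \<le> 2 / 3" using assms pi_less_4 by simp
  ultimately show ?thesis by (simp add: sin_60)
qed

text \<open>Equals e^{-s} (e^s + b e^{i pi \<alpha>}) (e^s + b e^{-i pi \<alpha>}). The zeros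
  closest to the real axis are ln b \<plusminus> i (1 - \<alpha>) pi, which is the origin of
  \<open>\<kappa>2\<close>.\<close>

definition kernel_den :: "real \<Rightarrow> real \<Rightarrow> complex \<Rightarrow> complex" where
  "kernel_den \<alpha> b s = exp s + of_real (2 * b * cos (pi * \<alpha>)) + of_real (b\<^sup>2) * exp (- s)"

text \<open>Shaped after the lower bounds for the two factors of \<open>kernel_den\<close>: one may
  be as small as \<delta>, the other stays away from 0. Quadratic decay makes it integrable, with a
  mass that grows only like \<bar>ln \<delta>\<bar> as \<delta> tends to 0.\<close>

definition log_majorant :: "real \<Rightarrow> real \<Rightarrow> real" where
  "log_majorant \<delta> x = 1 / ((\<bar>x\<bar> + \<delta>) * (\<bar>x\<bar> + \<delta> + 1))"

text \<open>With u = (s - ln b) / 2 and v = i pi \<alpha> / 2 this is 2 cosh (u + v) 2 cosh (u - v)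
  = 2 cosh 2u + 2 cosh 2v; centring at ln b takes out the factor b.\<close>

lemma kernel_den_factor:
  assumes "b > 0"
  shows "kernel_den \<alpha> b s = of_real b *
    ((exp ((s - ln b + \<i> * pi * \<alpha>) / 2) + exp (- ((s - ln b + \<i> * pi * \<alpha>) / 2))) *
     (exp ((s - ln b - \<i> * pi * \<alpha>) / 2) + exp (- ((s - ln b - \<i> * pi * \<alpha>) / 2))))"
proof -
  define z where "z = s - complex_of_real (ln b)"
  have s: "s = z + complex_of_real (ln b)" by (simp add: z_def)
  have eb: "exp (complex_of_real (ln b)) = of_real b" using assms by (simp add: exp_of_real)
  have "exp (- complex_of_real (ln b)) = inverse (of_real b)" by (simp add: exp_minus eb)
  then have "of_real b * (exp z + 2 * of_real (cos (pi * \<alpha>)) + exp (- z)) = kernel_den \<alpha> b s"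
    using assms unfolding kernel_den_def s
    by (simp add: exp_add exp_diff eb algebra_simps power2_eq_square) (simp add: exp_minus)?
  moreover have "2 * complex_of_real (cos (pi * \<alpha>)) = exp (2 * (\<i> * pi * \<alpha> / 2)) + exp (- (2 * (\<i> * pi * \<alpha> / 2)))"
    by (simp add: cos_exp_eq mult.assoc flip: cos_of_real)
  moreover have "(exp (u + v) + exp (- (u + v))) * (exp (u - v) + exp (- (u - v))) =
      exp (2 * u) + (exp (2 * v) + exp (- (2 * v))) + exp (- (2 * u))" for u v :: complex
    by (simp add: algebra_simps flip: exp_add)
  from this[of "z / 2" "\<i> * pi * \<alpha> / 2"]
  have "(exp ((z + \<i> * pi * \<alpha>) / 2) + exp (- ((z + \<i> * pi * \<alpha>) / 2))) *
     (exp ((z - \<i> * pi * \<alpha>) / 2) + exp (- ((z - \<i> * pi * \<alpha>) / 2))) =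
     exp z + (exp (2 * (\<i> * pi * \<alpha> / 2)) + exp (- (2 * (\<i> * pi * \<alpha> / 2)))) + exp (- z)"
    by (simp add: add_divide_distrib diff_divide_distrib)
  ultimately show ?thesis by (simp add: z_def)
qed

text \<open>Put x = Re s - ln b. Both cosh factors are at least a multiple of \<bar>x\<bar> +
  \<delta>, and the one whose shift opposes the sign of Im s is even at least a multiple of
  \<bar>x\<bar> + \<delta> + 1; so at most one factor can be small.\<close>

lemma kernel_den_ge:
  assumes "0 < \<alpha>" "\<alpha> < 1" "b > 0" "0 < \<delta>" "\<bar>Im s\<bar> \<le> pi - pi * \<alpha> - \<delta>"
  shows "b * min (cos (pi * \<alpha> / 2)) (sin (pi * \<alpha> / 2)) / 30 / log_majorant \<delta> (Re s - ln b) \<le> cmod (kernel_den \<alpha> b s)"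
proof -
  define c where "c = min (cos (pi * \<alpha> / 2)) (sin (pi * \<alpha> / 2))"
  define y where "y = \<bar>Re s - ln b\<bar>"
  define P where "P \<epsilon> = (s - ln b + \<epsilon> * (\<i> * pi * \<alpha>)) / 2" for \<epsilon> :: real
  have pa: "0 < pi * \<alpha>" "pi * \<alpha> < pi" using assms by auto
  have c: "0 < c" "c \<le> 1" unfolding c_def using pa
    by (auto intro!: cos_gt_zero sin_gt_zero simp: min_le_iff_disj)
  have \<delta>: "\<delta> \<le> pi" "\<delta> < 4" using assms pa pi_less_4 by linarith+
  have ImP: "Im (P \<epsilon>) = (Im s + \<epsilon> * (pi * \<alpha>)) / 2" for \<epsilon> by (simp add: P_def)
  have cos_ge: "cos v \<le> \<bar>cos u\<bar>" if "\<bar>u\<bar> \<le> v" "v \<le> pi" for u v :: real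
    using cos_monotone_0_pi_le[of "\<bar>u\<bar>" v] that by (auto simp: abs_le_iff intro: order_trans[OF _ abs_ge_self])
  have far: "\<delta> / 6 \<le> \<bar>cos (Im (P \<epsilon>))\<bar>" if "\<epsilon> = 1 \<or> \<epsilon> = -1" for \<epsilon>
  proof -
    have "\<delta> / 6 \<le> sin (\<delta> / 2)" using sin_ge_third[of "\<delta> / 2"] assms \<delta> by simp
    also have "\<dots> = cos ((pi - \<delta>) / 2)"
      by (simp add: sin_cos_eq diff_divide_distrib)
    also have "\<dots> \<le> \<bar>cos (Im (P \<epsilon>))\<bar>"
    proof (rule cos_ge)
      show "\<bar>Im (P \<epsilon>)\<bar> \<le> (pi - \<delta>) / 2"
        using that assms(5) pa unfolding ImP abs_le_iff by (elim disjE) (hypsubst, argo)+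
    qed (use assms(4) pa in argo)
    finally show ?thesis .
  qed
  \<comment> \<open>Shifting against the sign of Im s leaves, up to sign, an imaginary part between
    - pi \<alpha> / 2 and (pi - pi \<alpha>) / 2, where the cosine is at least
    \<open>c\<close>.\<close>
  have near: "\<exists>\<epsilon>\<in>{1, -1}. c \<le> \<bar>cos (Im (P \<epsilon>))\<bar>"
  proof -
    define \<epsilon> :: real where "\<epsilon> = (if 0 \<le> Im s then -1 else 1)"
    have Im: "\<bar>Im (P \<epsilon>)\<bar> \<le> max (pi * \<alpha> / 2) (pi / 2 - pi * \<alpha> / 2)"
    proof -
      have "- (pi * \<alpha> / 2) \<le> Im (P \<epsilon>) \<and> Im (P \<epsilon>) \<le> pi / 2 - pi * \<alpha> / 2 \<or>
          - (pi / 2 - pi * \<alpha> / 2) \<le> Im (P \<epsilon>) \<and> Im (P \<epsilon>) \<le> pi * \<alpha> / 2"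
        using assms(4,5) pa unfolding ImP \<epsilon>_def abs_le_iff
        by (cases "0 \<le> Im s") (simp_all only: if_True if_False, argo+)
      then show ?thesis using pa by (auto simp: abs_le_iff le_max_iff_disj)
    qed
    have "cos (max (pi * \<alpha> / 2) (pi / 2 - pi * \<alpha> / 2)) \<le> \<bar>cos (Im (P \<epsilon>))\<bar>"
      by (rule cos_ge[OF Im]) (use pa in linarith)
    moreover have "c \<le> cos (max (pi * \<alpha> / 2) (pi / 2 - pi * \<alpha> / 2))"
      unfolding c_def by (simp add: max_def min_def sin_cos_eq)
    ultimately have "c \<le> \<bar>cos (Im (P \<epsilon>))\<bar>" by linarith
    moreover have "\<epsilon> \<in> {1, -1}" by (simp add: \<epsilon>_def)
    ultimately show ?thesis by blast
  qed
  define F where "F \<epsilon> = cmod (exp (P \<epsilon>) + exp (- P \<epsilon>))" for \<epsilon>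
  have F: "y / 2 + \<bar>cos (Im (P \<epsilon>))\<bar> \<le> F \<epsilon>" for \<epsilon>
    using norm_exp_plus_exp_minus_ge[of "P \<epsilon>"] by (simp add: F_def y_def) (simp add: P_def)
  have y0: "0 \<le> y" by (simp add: y_def)
  have F_far: "(y + \<delta>) / 6 \<le> F \<epsilon>" if "\<epsilon> = 1 \<or> \<epsilon> = -1" for \<epsilon>
    using F[of \<epsilon>] far[OF that] y0 by simp
  obtain \<epsilon> where \<epsilon>: "\<epsilon> \<in> {1, -1}" "c \<le> \<bar>cos (Im (P \<epsilon>))\<bar>" using near by blast
  \<comment> \<open>As c \<le> 1 and \<delta> < 4, c (y + \<delta> + 1) \<le> y + 5 c. This is the 5
    in 30 = 6 * 5.\<close>
  have "c * (y + \<delta> + 1) / 5 \<le> F \<epsilon>"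
  proof -
    have "c * y \<le> 1 * y" using c y0 by (intro mult_right_mono) auto
    moreover have "c * \<delta> \<le> c * 4" using c \<delta> by (intro mult_left_mono) auto
    moreover have "c * (y + \<delta> + 1) = c * y + c * \<delta> + c" by (simp add: algebra_simps)
    ultimately have "c * (y + \<delta> + 1) / 5 \<le> y / 2 + c" using c y0 by linarith
    then show ?thesis using F[of \<epsilon>] \<epsilon>(2) by linarith
  qed
  moreover have "(y + \<delta>) / 6 \<le> F (- \<epsilon>)" using \<epsilon>(1) by (intro F_far) auto
  ultimately have "((y + \<delta>) / 6) * (c * (y + \<delta> + 1) / 5) \<le> F (- \<epsilon>) * F \<epsilon>"
    using y0 c assms(4) by (intro mult_mono) (auto simp: F_def)
  also have "F (- \<epsilon>) * F \<epsilon> = F 1 * F (-1)" using \<epsilon>(1) by auto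
  also have "\<dots> = cmod (kernel_den \<alpha> b s) / b"
    using assms(3) unfolding kernel_den_factor[OF assms(3)] F_def P_def by (simp add: norm_mult)
  finally have "b * c / 30 * ((y + \<delta>) * (y + \<delta> + 1)) \<le> cmod (kernel_den \<alpha> b s)"
    using assms(3) by (simp add: field_simps)
  then show ?thesis by (simp add: log_majorant_def c_def y_def)
qed

text \<open>The arithmetic-geometric mean inequality 2 b \<le> e^x + b^2 e^{-x} absorbs the cosine.
  Unlike \<open>kernel_den_ge\<close> this keeps the exponential growth at both ends, on which the
  tail estimates rest.\<close>

lemma kernel_den_real_ge:
  assumes "b > 0"
  shows "(1 - \<bar>cos (pi * \<alpha>)\<bar>) * (exp x + b\<^sup>2 * exp (- x)) \<le> Re (kernel_den \<alpha> b (of_real x))"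
    "Im (kernel_den \<alpha> b (of_real x)) = 0"
proof -
  define p q where "p = exp (x / 2)" and "q = exp (- x / 2)"
  have "p\<^sup>2 = exp x" "q\<^sup>2 = exp (- x)" "p * q = 1"
    by (simp_all add: p_def q_def power2_eq_square mult_exp_exp)
  moreover have "0 \<le> (p - b * q)\<^sup>2" by simp
  moreover have "(p - b * q)\<^sup>2 = p\<^sup>2 + b\<^sup>2 * q\<^sup>2 - 2 * b * (p * q)"
    by (simp add: power2_eq_square algebra_simps)
  ultimately have "0 \<le> exp x + b\<^sup>2 * exp (- x) - 2 * b" by simp
  then have le: "2 * b \<le> exp x + b\<^sup>2 * exp (- x)" by simp
  have eq: "kernel_den \<alpha> b (of_real x) = of_real (exp x + 2 * b * cos (pi * \<alpha>) + b\<^sup>2 * exp (- x))"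
    using exp_of_real[of x, where ?'a = complex] exp_of_real[of "- x", where ?'a = complex]
    by (simp only: kernel_den_def of_real_add of_real_mult of_real_minus)
  have "(1 - \<bar>c\<bar>) * S \<le> S + b * 2 * c" if "2 * b \<le> S" for c S :: real
  proof -
    have "\<bar>c\<bar> * (2 * b) \<le> \<bar>c\<bar> * S" using that by (intro mult_left_mono) auto
    moreover have "- \<bar>c\<bar> * (2 * b) \<le> c * (2 * b)" using assms by (intro mult_right_mono) auto
    moreover have "(1 - \<bar>c\<bar>) * S = S - \<bar>c\<bar> * S" "b * 2 * c = c * (2 * b)"
      "- \<bar>c\<bar> * (2 * b) = - (\<bar>c\<bar> * (2 * b))"
      by (simp_all add: left_diff_distrib)
    ultimately show ?thesis by linarith
  qed
  from this[OF le, of "cos (pi * \<alpha>)"]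
  show "(1 - \<bar>cos (pi * \<alpha>)\<bar>) * (exp x + b\<^sup>2 * exp (- x)) \<le> Re (kernel_den \<alpha> b (of_real x))"
    unfolding eq Re_complex_of_real by (simp only: ac_simps)
  show "Im (kernel_den \<alpha> b (of_real x)) = 0"
    unfolding eq by (rule Im_complex_of_real)
qed

section \<open>The majorant along the edge of the strip and its mass\<close>

lemma log_majorant_pos: "0 < \<delta> \<Longrightarrow> 0 < log_majorant \<delta> x"
  by (simp add: log_majorant_def add_nonneg_pos)

lemma continuous_log_majorant: "0 < \<delta> \<Longrightarrow> continuous_on A (\<lambda>x. log_majorant \<delta> (x - c))"
  unfolding log_majorant_def
  by (intro continuous_intros) (metis abs_ge_zero add_nonneg_pos add_pos_pos less_irrefl mult_eq_0_iff zero_less_one)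

text \<open>Partial fractions: 1 / (p (p + 1)) = 1/p - 1/(p + 1) has the primitive ln p - ln (p +
  1), which increases to 0. Each half-line therefore contributes at most ln (1 + 1/\<delta>),
  wherever the centre c lies.\<close>

lemma integral_log_majorant_le:
  assumes "0 < \<delta>" "a < b"
  shows "integral {a..b} (\<lambda>x. log_majorant \<delta> (x - c)) \<le> 2 * ln (1 + 1 / \<delta>)"
proof -
  define f where "f x = log_majorant \<delta> (x - 0)" for x
  have f_int: "f integrable_on {p..q}" for p q
    unfolding f_def by (intro integrable_continuous_real continuous_log_majorant assms)
  have f0: "0 \<le> f x" for x using log_majorant_pos[OF assms(1)] by (simp add: f_def less_imp_le)
  have half: "integral {0..R} f \<le> ln (1 + 1 / \<delta>)" if R: "0 \<le> R" for R
  proof -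
    define \<Phi> where "\<Phi> x = ln (x + \<delta>) - ln (x + \<delta> + 1)" for x
    have "(f has_integral \<Phi> R - \<Phi> 0) {0..R}"
    proof (rule fundamental_theorem_of_calculus)
      fix x assume x: "x \<in> {0..R}"
      have "(\<Phi> has_real_derivative 1 / (x + \<delta>) - 1 / (x + \<delta> + 1)) (at x)"
        unfolding \<Phi>_def using x assms by (auto intro!: derivative_eq_intros)
      also have "1 / (x + \<delta>) - 1 / (x + \<delta> + 1) = f x"
      proof -
        have "1 / p - 1 / (p + 1) = 1 / (p * (p + 1))" if "0 < p" for p :: real
          using that by (simp add: field_simps)
        from this[of "x + \<delta>"] show ?thesis using x assms by (simp add: f_def log_majorant_def)
      qed
      finally show "(\<Phi> has_vector_derivative f x) (at x within {0..R})"
        by (simp add: has_real_derivative_iff_has_vector_derivative has_vector_derivative_at_within)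
    qed (use R in auto)
    then have "integral {0..R} f = \<Phi> R - \<Phi> 0" by (rule integral_unique)
    also have "\<Phi> R \<le> 0" using R assms by (simp add: \<Phi>_def)
    also have "0 - \<Phi> 0 = ln (1 + 1 / \<delta>)"
    proof -
      have "ln (1 + 1 / \<delta>) = ln ((\<delta> + 1) / \<delta>)" using assms by (simp add: field_simps)
      also have "\<dots> = ln (\<delta> + 1) - ln \<delta>" using assms by (simp add: ln_div)
      finally show ?thesis by (simp add: \<Phi>_def)
    qed
    finally show ?thesis by simp
  qed
  define R where "R = max \<bar>a - c\<bar> \<bar>b - c\<bar>"
  have "integral {a..b} (\<lambda>x. log_majorant \<delta> (x - c)) = integral {a - c..b - c} f"
    using integral_shift[of "a" "- c" "b" f] continuous_log_majorant[OF assms(1), of "{a - c..b - c}" 0]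
    by (simp add: f_def o_def)
  also have "\<dots> \<le> integral {- R..R} f"
    by (rule integral_subset_le) (use f_int f0 in \<open>auto simp: R_def\<close>)
  also have "\<dots> = integral {- R..0} f + integral {0..R} f"
    using f_int[of "-R" R] by (subst Henstock_Kurzweil_Integration.integral_combine) (auto simp: R_def)
  also have "integral {- R..0} f = integral {0..R} f"
  proof -
    have "(\<lambda>x. f (- x)) = f" by (simp add: fun_eq_iff f_def log_majorant_def)
    then show ?thesis using Henstock_Kurzweil_Integration.integral_reflect_real[of R 0 f] by (simp only: minus_zero)
  qed
  also have "\<dots> \<le> ln (1 + 1 / \<delta>)" by (rule half) (simp add: R_def)
  finally show ?thesis using half[of R] by (simp add: R_def)
qed

text \<open>Makes the vertical sides of the rectangle disappear when the number of nodes tends to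
  infinity.\<close>

lemma log_majorant_tendsto_0:
  fixes \<delta> c :: real
  assumes "0 < \<delta>"
  shows "((\<lambda>x::real. log_majorant \<delta> (x - c)) \<longlongrightarrow> 0) at_infinity"
proof (rule tendsto_sandwich)
  show "\<forall>\<^sub>F x :: real in at_infinity. 0 \<le> log_majorant \<delta> (x - c)"
    using log_majorant_pos[OF assms] by (simp add: less_imp_le)
  show "\<forall>\<^sub>F x :: real in at_infinity. log_majorant \<delta> (x - c) \<le> inverse (norm (x - c :: real))"
    unfolding eventually_at_infinity
  proof (intro exI allI impI)
    fix x :: real assume "\<bar>c\<bar> + 1 \<le> norm x"
    then have "0 < \<bar>x - c\<bar>" by auto
    moreover have "\<bar>x - c\<bar> * 1 \<le> (\<bar>x - c\<bar> + \<delta>) * (\<bar>x - c\<bar> + \<delta> + 1)" using assms by (intro mult_mono) auto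
    ultimately show "log_majorant \<delta> (x - c) \<le> inverse (norm (x - c))"
      unfolding log_majorant_def real_norm_def inverse_eq_divide by (intro divide_left_mono) (auto intro!: mult_pos_pos)
  qed
  have "filterlim (\<lambda>x::real. - c + x) at_infinity at_infinity"
    by (rule tendsto_add_filterlim_at_infinity[OF tendsto_const filterlim_ident])
  then have "filterlim (\<lambda>x::real. x - c) at_infinity at_infinity" by simp
  then show "((\<lambda>x. inverse (norm (x - c :: real))) \<longlongrightarrow> 0) at_infinity"
    by (intro tendsto_inverse_0_at_top filterlim_at_infinity_imp_norm_at_top)
qed simp

text \<open>By sin u = 2 sin (u/2) cos (u/2), halving the argument costs at most a factor 2. This
  pays for stopping half a step short of the edge of the strip.\<close>

lemma sin_min_half_le:
  fixes x :: real
  assumes "0 < x"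
  shows "sin (min x (pi / 2)) \<le> 2 * sin (min (x / 2) (pi / 2))" "0 < sin (min x (pi / 2))"
proof -
  define u where "u = min x (pi / 2)"
  have u: "0 < u" "u \<le> pi / 2" "u \<le> x" using assms by (auto simp: u_def)
  then have "u / 2 \<le> x / 2" "u / 2 \<le> pi / 2" by linarith+
  then have "u / 2 \<le> min (x / 2) (pi / 2)" by (rule min.boundedI)
  note u = u this
  have u': "u < pi" "- (pi / 2) \<le> u / 2" using u pi_gt_zero by linarith+
  have "0 \<le> sin (u / 2)" using u u' by (intro sin_ge_zero) linarith+
  note u' = u' this
  have "sin u = 2 * sin (u / 2) * cos (u / 2)" using sin_double[of "u / 2"] by simp
  also have "\<dots> \<le> 2 * sin (u / 2) * 1" using u' by (intro mult_left_mono) auto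
  also have "sin (u / 2) \<le> sin (min (x / 2) (pi / 2))" using u by (intro sin_monotone_2pi_le) auto
  finally show "sin (min x (pi / 2)) \<le> 2 * sin (min (x / 2) (pi / 2))" by (simp add: u_def)
  show "0 < sin (min x (pi / 2))" using sin_gt_zero[OF u(1) u'(1)] by (simp add: u_def)
qed

text \<open>From \<delta> \<le> 4 follows 1 + 1/\<delta> \<le> 5 / (t/2) = 10/t, and ln 10 \<le>
  9.\<close>

lemma ln_one_plus_inverse_le:
  fixes t \<delta> :: real
  assumes "0 < t" "t / 2 \<le> \<delta>" "\<delta> \<le> 4"
  shows "ln (1 + 1 / \<delta>) \<le> 10 + \<bar>ln t\<bar>"
proof -
  have \<delta>: "0 < \<delta>" using assms by simp
  have "1 + 1 / \<delta> = (1 + \<delta>) / \<delta>" using \<delta> by (simp add: field_simps)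
  also have "\<dots> \<le> 5 / (t / 2)" using assms \<delta> by (intro frac_le) auto
  also have "\<dots> = 10 / t" by simp
  finally have "ln (1 + 1 / \<delta>) \<le> ln (10 / t)" using \<delta> assms by (subst ln_le_cancel_iff) (auto intro: add_pos_pos)
  also have "\<dots> = ln 10 - ln t" using assms by (simp add: ln_div)
  finally show ?thesis using ln_le_minus_one[of "10 :: real"] by linarith
qed

text \<open>The contour is kept at distance of order \<open>\<tau>\<close> from the singularities on the edge of the
  strip, which costs only a bounded factor in the exponential.\<close>

lemma strip_width_exists:
  fixes \<alpha> \<omega> \<tau> :: real
  defines "\<kappa>1 \<equiv> \<alpha> * (pi - \<omega>)" and "\<kappa>2 \<equiv> (1 - \<alpha>) * pi" and "\<mu> \<equiv> min \<alpha> (1 - \<alpha>)"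
  assumes \<alpha>: "0 < \<alpha>" "\<alpha> < 1" and \<omega>: "0 \<le> \<omega>" and \<tau>: "0 < \<tau>" "\<tau> < pi - \<omega>"
  obtains d where "0 < d" "d < \<kappa>1" "d < \<kappa>2" "pi * \<mu> \<le> 2 * pi * d / \<tau>"
    "exp (- (2 * pi * d / \<tau>)) \<le> exp pi * exp (- (2 * pi * min \<kappa>1 \<kappa>2 / \<tau>))"
    "0 < sin (min ((\<kappa>1 - d) / \<alpha>) (pi / 2))"
    "ln (1 + 1 / (\<kappa>2 - d)) / sin (min ((\<kappa>1 - d) / \<alpha>) (pi / 2)) \<le> 22 / \<mu> * tau_factor \<alpha> \<kappa>1 \<kappa>2 \<tau>"
proof -
  have \<mu>: "0 < \<mu>" "\<mu> \<le> \<alpha>" "\<mu> \<le> 1 - \<alpha>" "\<mu> \<le> 1" using \<alpha> by (auto simp: \<mu>_def)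
  have \<tau>pi: "\<tau> < pi" using \<tau> \<omega> by simp
  \<comment> \<open>The retreat from the edge is \<theta> \<tau> / 2. This weight makes the distance
    to the nearer obstruction a fixed multiple of \<tau>: (1 - \<alpha>) \<tau> / 2 from
    \<open>\<kappa>2\<close> or \<alpha> \<tau> / 2 from \<open>\<kappa>1\<close>, which reproduces
    the arguments in \<open>tau_factor\<close> up to halving.\<close>
  define \<theta> where "\<theta> = (if \<kappa>1 > \<kappa>2 then 1 - \<alpha> else \<alpha>)"
  define m where "m = min \<kappa>1 \<kappa>2"
  define d where "d = m - \<theta> * \<tau> / 2"
  define x where "x = (if \<kappa>1 > \<kappa>2 then (\<kappa>1 - \<kappa>2) / \<alpha> + (1 - \<alpha>) / \<alpha> * \<tau> else \<tau>)"
  define t where "t = (if \<kappa>1 > \<kappa>2 then (1 - \<alpha>) * \<tau> else \<kappa>2 - \<kappa>1 + \<alpha> * \<tau>)"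
  define l where "l = (if \<kappa>1 > \<kappa>2 then \<tau> else \<kappa>2 - \<kappa>1 + \<alpha> * \<tau>)"
  have \<theta>: "0 < \<theta>" "\<mu> \<le> \<theta>" "\<theta> \<le> 1" using \<alpha> \<mu> by (auto simp: \<theta>_def)
  \<comment> \<open>The upper bound on \<tau> enters here: the retreat uses up less than half of the
    strip, so d stays positive and even exceeds \<theta> \<tau> / 2.\<close>
  have m: "\<theta> * \<tau> < m"
  proof (cases "\<kappa>1 > \<kappa>2")
    case True
    then show ?thesis using \<alpha> \<tau>pi by (simp add: \<theta>_def m_def \<kappa>2_def)
  next
    case False
    then show ?thesis using \<alpha> \<tau> by (simp add: \<theta>_def m_def min_def) (simp add: \<kappa>1_def)
  qed
  have \<theta>\<tau>: "0 < \<theta> * \<tau>" using \<theta> \<tau> by simp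
  have d: "0 < d" "d < m" "\<theta> * \<tau> / 2 < d" using m \<theta>\<tau> unfolding d_def by argo+
  have x0: "0 < x" using \<alpha> \<tau> by (simp add: x_def add_pos_pos)
  have t0: "0 < t" using \<alpha> \<tau> by (simp add: t_def add_nonneg_pos)
  have x: "x / 2 \<le> (\<kappa>1 - d) / \<alpha>"
  proof (cases "\<kappa>1 > \<kappa>2")
    case True
    then have "(\<kappa>1 - d) / \<alpha> - x / 2 = (\<kappa>1 - \<kappa>2) / \<alpha> / 2"
      using \<alpha> by (simp add: x_def d_def m_def \<theta>_def field_simps)
    moreover have "0 \<le> (\<kappa>1 - \<kappa>2) / \<alpha> / 2" using True \<alpha> by simp
    ultimately show ?thesis by linarith
  next
    case False
    then show ?thesis using \<alpha> by (simp add: x_def d_def m_def \<theta>_def)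
  qed
  have t: "t / 2 \<le> \<kappa>2 - d"
    unfolding t_def d_def m_def \<theta>_def by (auto simp: field_simps)
  have "\<kappa>2 \<le> pi" using \<alpha> by (simp add: \<kappa>2_def)
  then have \<delta>4: "\<kappa>2 - d \<le> 4" using d pi_less_4 by linarith
  define s where "s = sin (min ((\<kappa>1 - d) / \<alpha>) (pi / 2))"
  define s0 where "s0 = sin (min x (pi / 2))"
  have s0: "0 < s0" "s0 \<le> 1" using sin_min_half_le[OF x0] by (auto simp: s0_def)
  have "s0 \<le> 2 * sin (min (x / 2) (pi / 2))" unfolding s0_def by (rule sin_min_half_le[OF x0])
  also have "sin (min (x / 2) (pi / 2)) \<le> s" unfolding s_def
  proof (rule sin_monotone_2pi_le)
    have "0 \<le> min (x / 2) (pi / 2)" using x0 by simp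
    then show "- (pi / 2) \<le> min (x / 2) (pi / 2)" using pi_gt_zero by linarith
    show "min (x / 2) (pi / 2) \<le> min ((\<kappa>1 - d) / \<alpha>) (pi / 2)" by (rule min.mono[OF x order_refl])
  qed (rule min.cobounded2)
  finally have s: "s0 / 2 \<le> s" by simp
  have "ln (1 + 1 / (\<kappa>2 - d)) \<le> 10 + \<bar>ln t\<bar>" using t0 t \<delta>4 by (rule ln_one_plus_inverse_le)
  \<comment> \<open>\<open>t\<close> measures the distance to the zeros of the denominator,
    \<open>l\<close> is the argument of the logarithm in \<open>tau_factor\<close>. They differ by
    the factor 1 - \<alpha>, and only in the first case.\<close>
  also have "\<bar>ln t\<bar> \<le> 1 / \<mu> + \<bar>ln l\<bar>"
  proof (cases "\<kappa>1 > \<kappa>2")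
    case True
    have "- ln (1 - \<alpha>) = ln (1 / (1 - \<alpha>))" using \<alpha> by (simp add: ln_div)
    also have "\<dots> \<le> 1 / (1 - \<alpha>)" using ln_le_minus_one[of "1 / (1 - \<alpha>)"] \<alpha> by simp
    also have "\<dots> \<le> 1 / \<mu>" using \<mu> \<alpha> by (intro divide_left_mono) auto
    finally have "\<bar>ln (1 - \<alpha>)\<bar> \<le> 1 / \<mu>" using \<alpha> by simp
    moreover have "ln t = ln (1 - \<alpha>) + ln l" using True \<alpha> \<tau> by (simp add: t_def l_def ln_mult)
    ultimately show ?thesis by linarith
  next
    case False
    then show ?thesis using \<mu> by (simp add: t_def l_def)
  qed
  also have "10 + (1 / \<mu> + \<bar>ln l\<bar>) \<le> 11 / \<mu> * (1 + \<bar>ln l\<bar>)"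
  proof -
    have "1 * 11 \<le> 1 / \<mu> * 11" "1 * \<bar>ln l\<bar> \<le> 11 / \<mu> * \<bar>ln l\<bar>"
      using \<mu> by (intro mult_right_mono; simp add: field_simps)+
    moreover have "11 / \<mu> * (1 + \<bar>ln l\<bar>) = 1 / \<mu> * 11 + 11 / \<mu> * \<bar>ln l\<bar>" by (simp add: distrib_left)
    moreover have "10 + 1 / \<mu> \<le> 1 / \<mu> * 11" using \<mu> by (simp add: field_simps)
    ultimately show ?thesis by linarith
  qed
  finally have ln: "ln (1 + 1 / (\<kappa>2 - d)) \<le> 11 / \<mu> * (1 + \<bar>ln l\<bar>)" by simp
  show thesis
  proof (rule that[of d])
    show "0 < d" "d < \<kappa>1" "d < \<kappa>2" using d by (auto simp: m_def)
    have "\<mu> * \<tau> \<le> \<theta> * \<tau>" using \<theta> \<tau> by (intro mult_right_mono) auto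
    then have "\<mu> * \<tau> \<le> 2 * d" using d by argo
    then have "\<mu> \<le> 2 * d / \<tau>" using \<tau> by (simp add: field_simps)
    then have "pi * \<mu> \<le> pi * (2 * d / \<tau>)" by (rule mult_left_mono) simp
    then show "pi * \<mu> \<le> 2 * pi * d / \<tau>" by (simp add: ac_simps)
    \<comment> \<open>The retreat changes the exponent by pi \<theta> \<le> pi; hence the factor
      e^pi.\<close>
    have "2 * pi * d / \<tau> = 2 * pi * m / \<tau> - pi * \<theta>" using \<tau> by (simp add: d_def field_simps)
    moreover have "pi * \<theta> \<le> pi * 1" using \<theta> by (intro mult_left_mono) auto
    ultimately have "- (2 * pi * d / \<tau>) \<le> pi + - (2 * pi * m / \<tau>)" by simp
    then show "exp (- (2 * pi * d / \<tau>)) \<le> exp pi * exp (- (2 * pi * min \<kappa>1 \<kappa>2 / \<tau>))"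
      unfolding exp_add[symmetric] m_def by simp
    show "0 < sin (min ((\<kappa>1 - d) / \<alpha>) (pi / 2))" using s s0 by (simp add: s_def)
    have "ln (1 + 1 / (\<kappa>2 - d)) / s \<le> (11 / \<mu> * (1 + \<bar>ln l\<bar>)) / (s0 / 2)"
      using ln s s0 \<mu> by (intro frac_le) auto
    also have "\<dots> = 22 / \<mu> * (1 / s0 * (1 + \<bar>ln l\<bar>))" by simp
    also have "1 / s0 * (1 + \<bar>ln l\<bar>) = tau_factor \<alpha> \<kappa>1 \<kappa>2 \<tau>"
      by (simp add: tau_factor_def s0_def x_def l_def)
    finally show "ln (1 + 1 / (\<kappa>2 - d)) / sin (min ((\<kappa>1 - d) / \<alpha>) (pi / 2)) \<le> 22 / \<mu> * tau_factor \<alpha> \<kappa>1 \<kappa>2 \<tau>"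
      by (simp add: s_def)
  qed
qed

section \<open>Truncated tails and the total quadrature error\<close>

lemma exp_tail_sum_le:
  fixes a \<tau> :: real
  assumes "0 < a" "0 < \<tau>" "N \<le> K"
  shows "(\<Sum>n\<in>{int N<..int K}. \<tau> * exp (- (a * (of_int n * \<tau>)))) \<le> exp (- (a * (N * \<tau>))) / a"
proof -
  have "(\<Sum>n\<in>{int N<..int K}. \<tau> * exp (- (a * (of_int n * \<tau>)))) \<le>
    (exp (- (a * (N * \<tau>))) - exp (- (a * (K * \<tau>)))) / a"
    using assms(3)
  proof (induction K rule: dec_induct)
    case base
    then show ?case by simp
  next
    case (step k)
    define q where "q = exp (- (a * (Suc k * \<tau>)))"
    have "{int N<..int (Suc k)} = insert (int (Suc k)) {int N<..int k}" using step by auto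
    then have "(\<Sum>n\<in>{int N<..int (Suc k)}. \<tau> * exp (- (a * (of_int n * \<tau>)))) =
        \<tau> * q + (\<Sum>n\<in>{int N<..int k}. \<tau> * exp (- (a * (of_int n * \<tau>))))"
      by (simp add: q_def)
    also have "\<dots> \<le> \<tau> * q + (exp (- (a * (N * \<tau>))) - exp (- (a * (k * \<tau>)))) / a"
      using step by simp
    \<comment> \<open>By 1 + a \<tau> \<le> e^{a \<tau>} the term \<tau> q is at most the integral
      of e^{-a t} over the preceding step. The bound telescopes, and no factor 1/\<tau>
      appears.\<close>
    also have "\<tau> * q \<le> (exp (- (a * (k * \<tau>))) - q) / a"
    proof -
      have "(1 + a * \<tau>) * q \<le> exp (a * \<tau>) * q"
        using exp_ge_add_one_self[of "a * \<tau>"] by (intro mult_right_mono) (auto simp: q_def)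
      also have "\<dots> = exp (- (a * (k * \<tau>)))"
        unfolding q_def mult_exp_exp by (simp add: algebra_simps)
      finally show ?thesis using assms(1) by (simp add: field_simps)
    qed
    finally show ?case by (simp add: q_def diff_divide_distrib)
  qed
  also have "\<dots> \<le> exp (- (a * (N * \<tau>))) / a" using assms by (intro divide_right_mono) auto
  finally show ?thesis .
qed

text \<open>2640 = 120 * 22: the 120 is 30 from \<open>kernel_den_ge\<close>, times 2 for the two
  halves of the mass of \<open>log_majorant\<close>, times 2 for the two horizontal sides; the 22
  comes from \<open>strip_width_exists\<close>. The second summand stems from the two tails.\<close>

definition quad_const :: "real \<Rightarrow> real \<Rightarrow> real" where
  "quad_const \<alpha> c0 =
    (let c = min (cos (pi * \<alpha> / 2)) (sin (pi * \<alpha> / 2)); \<mu> = min \<alpha> (1 - \<alpha>)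
     in 2640 * exp pi / (c * \<mu> * (1 - exp (- (pi * \<mu>)))) + (1 + 1 / c0) / (1 - \<bar>cos (pi * \<alpha>)\<bar>))"

lemma cos_pi_mult_bounds:
  assumes "0 < \<alpha>" "\<alpha> < 1"
  shows "\<bar>cos (pi * \<alpha>)\<bar> < 1" "0 < min (cos (pi * \<alpha> / 2)) (sin (pi * \<alpha> / 2))"
proof -
  have pa: "0 < pi * \<alpha>" "pi * \<alpha> < pi" using assms by auto
  then have "0 < sin (pi * \<alpha>)" by (rule sin_gt_zero)
  then have "(cos (pi * \<alpha>))\<^sup>2 < 1" using sin_cos_squared_add[of "pi * \<alpha>"] zero_less_power2[of "sin (pi * \<alpha>)"] by linarith
  then show "\<bar>cos (pi * \<alpha>)\<bar> < 1" by (simp add: abs_square_less_1)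
  show "0 < min (cos (pi * \<alpha> / 2)) (sin (pi * \<alpha> / 2))"
    using pa by (auto intro!: cos_gt_zero sin_gt_zero)
qed

text \<open>Lets the tails, whose bounds carry no such factor, be absorbed into the common
  estimate.\<close>

lemma tau_factor_ge_1:
  assumes "0 < \<alpha>" "\<alpha> < 1" "0 < \<tau>"
  shows "1 \<le> tau_factor \<alpha> \<kappa>1 \<kappa>2 \<tau>"
proof -
  have *: "1 \<le> 1 / sin (min x (pi / 2)) * (1 + \<bar>l\<bar>)" if "0 < x" for x l :: real
  proof -
    have "1 * 1 \<le> 1 / sin (min x (pi / 2)) * (1 + \<bar>l\<bar>)"
      using sin_min_half_le(2)[OF that] by (intro mult_mono) auto
    then show ?thesis by simp
  qed
  show ?thesis
  proof (cases "\<kappa>1 > \<kappa>2")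
    case True
    then show ?thesis unfolding tau_factor_def using assms
      by (simp only: if_True) (rule *, simp add: add_pos_pos)
  next
    case False
    then show ?thesis unfolding tau_factor_def using assms by (simp only: if_False) (rule *)
  qed
qed

text \<open>\<open>\<psi>\<close> is the resolvent part of the integrand paired with a functional,
  \<open>E\<close> a product of norms. Sums over \<bar>n\<bar> \<le> K are compared with integrals
  over intervals growing with K; the discretisation and tail bounds are uniform in K and the side
  terms vanish, so the infinite range is reached by a single limit in K.\<close>

theorem sinc_quadrature_error:
  fixes \<alpha> \<omega> c0 b E \<tau> :: real and M N :: nat and \<psi> :: "complex \<Rightarrow> complex"
  defines "\<kappa>1 \<equiv> \<alpha> * (pi - \<omega>)" and "\<kappa>2 \<equiv> (1 - \<alpha>) * pi"
  defines "\<epsilon> \<equiv> exp (- (2 * pi * min \<kappa>1 \<kappa>2 / \<tau>))"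
  defines "G \<equiv> \<lambda>z. \<psi> z / kernel_den \<alpha> b z"
  assumes \<alpha>: "0 < \<alpha>" "\<alpha> < 1" and \<omega>: "0 \<le> \<omega>" "\<omega> \<le> pi / 2" and c0: "0 < c0" and b: "1 \<le> b"
    and E: "0 \<le> E" and \<tau>: "0 < \<tau>" "\<tau> < pi - \<omega>"
    and holo: "\<psi> holomorphic_on {z. \<bar>Im z\<bar> < \<kappa>1}"
    and bound: "\<And>z. \<bar>Im z\<bar> < \<kappa>1 \<Longrightarrow> cmod (\<psi> z) \<le> E / sin (min ((\<kappa>1 - \<bar>Im z\<bar>) / \<alpha>) (pi / 2))"
    and bound_real: "\<And>y :: real. cmod (\<psi> (of_real y)) \<le> E * exp (y / \<alpha>) / c0"
    and M: "exp (- ((1 + 1 / \<alpha>) * (M * \<tau>))) \<le> b * \<epsilon>"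
    and N: "exp (- (N * \<tau>)) \<le> \<epsilon> / b"
    and lim: "((\<lambda>L. integral {- L..L} (\<lambda>x. G (of_real x))) \<longlongrightarrow> I) at_top"
  shows "cmod (I - of_real \<tau> * (\<Sum>n\<in>{- int M..int N}. G (of_real (of_int n * \<tau>))))
    \<le> quad_const \<alpha> c0 * E * tau_factor \<alpha> \<kappa>1 \<kappa>2 \<tau> / b * \<epsilon>"
proof -
  define c where "c = min (cos (pi * \<alpha> / 2)) (sin (pi * \<alpha> / 2))"
  define c2 where "c2 = 1 - \<bar>cos (pi * \<alpha>)\<bar>"
  define \<mu> where "\<mu> = min \<alpha> (1 - \<alpha>)"
  define T where "T = tau_factor \<alpha> \<kappa>1 \<kappa>2 \<tau>"
  have \<mu>: "0 < \<mu>" using \<alpha> by (auto simp: \<mu>_def)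
  have c: "0 < c" "0 < c2" using cos_pi_mult_bounds[OF \<alpha>] by (auto simp: c_def c2_def)
  have T: "1 \<le> T" unfolding T_def using \<alpha> \<tau> by (intro tau_factor_ge_1)
  obtain d where d: "0 < d" "d < \<kappa>1" "d < \<kappa>2" and Q: "pi * \<mu> \<le> 2 * pi * d / \<tau>"
    and eps: "exp (- (2 * pi * d / \<tau>)) \<le> exp pi * \<epsilon>"
    and s0: "0 < sin (min ((\<kappa>1 - d) / \<alpha>) (pi / 2))"
    and lns: "ln (1 + 1 / (\<kappa>2 - d)) / sin (min ((\<kappa>1 - d) / \<alpha>) (pi / 2)) \<le> 22 / \<mu> * T"
    using strip_width_exists[OF \<alpha> \<omega>(1) \<tau>] unfolding \<kappa>1_def \<kappa>2_def \<epsilon>_def \<mu>_def T_def by metis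
  define s where "s = sin (min ((\<kappa>1 - d) / \<alpha>) (pi / 2))"
  define \<delta> where "\<delta> = \<kappa>2 - d"
  have \<delta>: "0 < \<delta>" using d by (simp add: \<delta>_def)
  define A where "A = E / s * 30 / (b * c)"
  have A: "0 \<le> A" using E s0 b c by (simp add: A_def s_def)
  define g where "g x = A * log_majorant \<delta> (x - ln b)" for x
  define J where "J = A * (2 * ln (1 + 1 / \<delta>))"
  have den_ge: "b * c / 30 / log_majorant \<delta> (Re z - ln b) \<le> cmod (kernel_den \<alpha> b z)" if "\<bar>Im z\<bar> \<le> d" for z
    unfolding c_def using \<alpha> b \<delta> that
    by (intro kernel_den_ge) (auto simp: \<delta>_def \<kappa>2_def algebra_simps)
  have G_bound: "cmod (G z) \<le> g (Re z)" if z: "\<bar>Im z\<bar> \<le> d" for z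
  proof -
    have m: "0 < log_majorant \<delta> (Re z - ln b)" using \<delta> by (rule log_majorant_pos)
    have "s \<le> sin (min ((\<kappa>1 - \<bar>Im z\<bar>) / \<alpha>) (pi / 2))" unfolding s_def
    proof (rule sin_monotone_2pi_le)
      have "0 < (\<kappa>1 - d) / \<alpha>" using d \<alpha> by simp
      then show "- (pi / 2) \<le> min ((\<kappa>1 - d) / \<alpha>) (pi / 2)" using pi_gt_zero by linarith
      show "min ((\<kappa>1 - d) / \<alpha>) (pi / 2) \<le> min ((\<kappa>1 - \<bar>Im z\<bar>) / \<alpha>) (pi / 2)"
        using z \<alpha> by (intro min.mono divide_right_mono) auto
    qed (rule min.cobounded2)
    then have "E / sin (min ((\<kappa>1 - \<bar>Im z\<bar>) / \<alpha>) (pi / 2)) \<le> E / s"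
      using E s0 unfolding s_def by (intro divide_left_mono mult_pos_pos) auto
    then have "cmod (\<psi> z) \<le> E / s" using bound[of z] z d by simp
    then have "cmod (\<psi> z) / cmod (kernel_den \<alpha> b z) \<le> (E / s) / (b * c / 30 / log_majorant \<delta> (Re z - ln b))"
      using den_ge[OF z] b c m E s0 by (intro frac_le) (auto simp: s_def)
    then show ?thesis by (simp add: G_def g_def A_def norm_divide)
  qed
  \<comment> \<open>Here the role of \<delta> is played by the distance of the individual point to
    the height \<open>\<kappa>2\<close>, which excludes zeros in the whole open strip.\<close>
  have den_nz: "kernel_den \<alpha> b z \<noteq> 0" if "\<bar>Im z\<bar> < min \<kappa>1 \<kappa>2" for z
  proof -
    have "b * min (cos (pi * \<alpha> / 2)) (sin (pi * \<alpha> / 2)) / 30 / log_majorant (\<kappa>2 - \<bar>Im z\<bar>) (Re z - ln b) \<le> cmod (kernel_den \<alpha> b z)"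
      using \<alpha> b that by (intro kernel_den_ge) (auto simp: \<kappa>2_def algebra_simps)
    moreover have "0 < b * c / 30 / log_majorant (\<kappa>2 - \<bar>Im z\<bar>) (Re z - ln b)"
      using b c that by (intro divide_pos_pos mult_pos_pos log_majorant_pos) auto
    ultimately show ?thesis by (auto simp: c_def)
  qed
  have G_holo: "G holomorphic_on {z. \<bar>Im z\<bar> < min \<kappa>1 \<kappa>2}"
    unfolding G_def using den_nz
    by (intro holomorphic_on_divide holomorphic_on_subset[OF holo])
      (auto simp: kernel_den_def[abs_def] intro!: holomorphic_intros)
  define S where "S K = of_real \<tau> * (\<Sum>n\<in>{- int K..int K}. G (of_real (of_int n * \<tau>)))" for K :: nat
  define LL where "LL K = (real K + 1 / 2) * \<tau>" for K :: nat
  define D where "D = 2 * J / (exp (2 * pi * d / \<tau>) - 1)"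
  have S: "cmod (S K - integral {- LL K..LL K} (\<lambda>x. G (of_real x))) \<le> D + 6 * d * (g (LL K) + g (- LL K))" for K
    unfolding S_def D_def
  proof (rule trapezoidal_sum_error[OF \<tau>(1) d(1) _ G_holo G_bound _ _ LL_def])
    show "d < min \<kappa>1 \<kappa>2" using d by simp
    show "g integrable_on {x..y}" for x y
      unfolding g_def by (intro integrable_continuous_real continuous_intros continuous_log_majorant \<delta>)
    show "integral {x..y} g \<le> J" if "x < y" for x y
      unfolding g_def J_def using integral_log_majorant_le[OF \<delta> that] A
      by (simp add: mult_left_mono)
  qed
  have tails: "cmod (S K - of_real \<tau> * (\<Sum>n\<in>{- int M..int N}. G (of_real (of_int n * \<tau>))))
      \<le> (1 + 1 / c0) / c2 * E / b * \<epsilon>" if K: "M \<le> K" "N \<le> K" for K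
  proof -
    define h where "h n = G (of_real (of_int n * \<tau>))" for n :: int
    have den_real: "c2 * (exp x + b\<^sup>2 * exp (- x)) \<le> cmod (kernel_den \<alpha> b (of_real x))" for x
      using kernel_den_real_ge(1)[of b \<alpha> x] b abs_Re_le_cmod[of "kernel_den \<alpha> b (of_real x)"]
      by (simp add: c2_def)
    \<comment> \<open>On the real axis the bound of \<open>\<psi>\<close> is \<open>E\<close>
      itself: \<kappa>1 / \<alpha> = pi - \<omega> \<ge> pi/2, so the sine equals 1.\<close>
    have right: "cmod (h n) \<le> E / c2 * exp (- (1 * (of_int n * \<tau>)))" for n
    proof -
      define x where "x = of_int n * \<tau>"
      have "pi / 2 \<le> \<kappa>1 / \<alpha>" using \<alpha> \<omega> by (simp add: \<kappa>1_def)
      then have "cmod (\<psi> (of_real x)) \<le> E" using bound[of "of_real x"] d by (simp add: min_absorb2)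
      moreover have "c2 * exp x \<le> c2 * (exp x + b\<^sup>2 * exp (- x))" using c by (intro mult_left_mono) auto
      then have "c2 * exp x \<le> cmod (kernel_den \<alpha> b (of_real x))" using den_real[of x] by linarith
      ultimately have "cmod (\<psi> (of_real x)) / cmod (kernel_den \<alpha> b (of_real x)) \<le> E / (c2 * exp x)"
        using c E by (intro frac_le) auto
      then show ?thesis unfolding h_def G_def norm_divide x_def[symmetric] by (simp add: exp_minus field_simps)
    qed
    \<comment> \<open>Towards -\<infinity> the denominator yields e^x and \<open>bound_real\<close>
      a further e^{x/\<alpha>}; together this is the rate 1 + 1/\<alpha>.\<close>
    have left: "cmod (h n) \<le> E / (c0 * c2 * b\<^sup>2) * exp ((1 + 1 / \<alpha>) * (of_int n * \<tau>))" for n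
    proof -
      define x where "x = of_int n * \<tau>"
      have "c2 * (b\<^sup>2 * exp (- x)) \<le> c2 * (exp x + b\<^sup>2 * exp (- x))" using c by (intro mult_left_mono) auto
      then have "c2 * (b\<^sup>2 * exp (- x)) \<le> cmod (kernel_den \<alpha> b (of_real x))" using den_real[of x] by linarith
      then have "cmod (\<psi> (of_real x)) / cmod (kernel_den \<alpha> b (of_real x)) \<le> (E * exp (x / \<alpha>) / c0) / (c2 * (b\<^sup>2 * exp (- x)))"
        using c E b c0 by (intro frac_le bound_real) auto
      also have "\<dots> = E / (c0 * c2 * b\<^sup>2) * (exp x * exp (x / \<alpha>))" by (simp add: exp_minus field_simps)
      also have "exp x * exp (x / \<alpha>) = exp ((1 + 1 / \<alpha>) * x)" by (simp add: mult_exp_exp algebra_simps)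
      finally show ?thesis by (simp add: h_def G_def norm_divide flip: x_def)
    qed
    have tN: "(\<Sum>n\<in>{int N<..int K}. \<tau> * exp (- (1 * (of_int n * \<tau>)))) \<le> \<epsilon> / b"
      using exp_tail_sum_le[of 1 \<tau> N K] \<tau> K N by simp
    have tM: "(\<Sum>n\<in>{int M<..int K}. \<tau> * exp (- ((1 + 1 / \<alpha>) * (of_int n * \<tau>)))) \<le> b * \<epsilon>"
    proof -
      have p: "1 \<le> 1 + 1 / \<alpha>" using \<alpha> by simp
      then have p0: "0 < 1 + 1 / \<alpha>" by linarith
      from p have "exp (- ((1 + 1 / \<alpha>) * (M * \<tau>))) / (1 + 1 / \<alpha>) \<le> exp (- ((1 + 1 / \<alpha>) * (M * \<tau>))) / 1"
        by (rule divide_left_mono) (rule exp_ge_zero, simp only: mult_1_right p0)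
      then show ?thesis using exp_tail_sum_le[of "1 + 1 / \<alpha>" \<tau> M K, OF p0] \<tau> K M by linarith
    qed
    have "{- int K..int K} = {- int K..<- int M} \<union> {- int M..int N} \<union> {int N<..int K}" using K by auto
    moreover have "sum h ({- int K..<- int M} \<union> {- int M..int N} \<union> {int N<..int K}) =
        sum h ({- int K..<- int M} \<union> {- int M..int N}) + sum h {int N<..int K}"
      by (rule sum.union_disjoint) auto
    moreover have "sum h ({- int K..<- int M} \<union> {- int M..int N}) = sum h {- int K..<- int M} + sum h {- int M..int N}"
      by (rule sum.union_disjoint) auto
    ultimately have "sum h {- int K..int K} = sum h {- int K..<- int M} + sum h {- int M..int N} + sum h {int N<..int K}"
      by simp
    then have "S K - of_real \<tau> * sum h {- int M..int N} = of_real \<tau> * sum h {- int K..<- int M} + of_real \<tau> * sum h {int N<..int K}"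
      by (simp add: S_def h_def algebra_simps)
    also have "cmod \<dots> \<le> \<tau> * (\<Sum>n\<in>{- int K..<- int M}. cmod (h n)) + \<tau> * (\<Sum>n\<in>{int N<..int K}. cmod (h n))"
      using \<tau> by (intro norm_triangle_le add_mono) (auto simp: norm_mult intro!: mult_left_mono sum_norm_le)
    also have "(\<Sum>n\<in>{- int K..<- int M}. cmod (h n)) = (\<Sum>n\<in>{int M<..int K}. cmod (h (- n)))"
      by (rule sum.reindex_bij_witness[of _ uminus uminus]) auto
    also have "\<tau> * (\<Sum>n\<in>{int M<..int K}. cmod (h (- n))) \<le>
        E / (c0 * c2 * b\<^sup>2) * (\<Sum>n\<in>{int M<..int K}. \<tau> * exp (- ((1 + 1 / \<alpha>) * (of_int n * \<tau>))))"
    proof -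
      have "\<tau> * cmod (h (- n)) \<le> E / (c0 * c2 * b\<^sup>2) * (\<tau> * exp (- ((1 + 1 / \<alpha>) * (of_int n * \<tau>))))" for n
        using mult_left_mono[OF left[of "- n"], of \<tau>] \<tau> by (simp add: mult.left_commute)
      then show ?thesis unfolding sum_distrib_left by (intro sum_mono)
    qed
    also have "\<tau> * (\<Sum>n\<in>{int N<..int K}. cmod (h n)) \<le>
        E / c2 * (\<Sum>n\<in>{int N<..int K}. \<tau> * exp (- (1 * (of_int n * \<tau>))))"
    proof -
      have "\<tau> * cmod (h n) \<le> E / c2 * (\<tau> * exp (- (1 * (of_int n * \<tau>))))" for n
        using mult_left_mono[OF right[of "n"], of \<tau>] \<tau> by (simp add: mult.left_commute)
      then show ?thesis unfolding sum_distrib_left by (intro sum_mono)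
    qed
    \<comment> \<open>The left tail carries 1/b^2 and the right one none, yet both end up of size
      \<epsilon>/b. This is why ln b enters M and N with opposite signs.\<close>
    also have "E / (c0 * c2 * b\<^sup>2) * (\<Sum>n\<in>{int M<..int K}. \<tau> * exp (- ((1 + 1 / \<alpha>) * (of_int n * \<tau>)))) +
        E / c2 * (\<Sum>n\<in>{int N<..int K}. \<tau> * exp (- (1 * (of_int n * \<tau>)))) \<le>
        E / (c0 * c2 * b\<^sup>2) * (b * \<epsilon>) + E / c2 * (\<epsilon> / b)"
      using E c c0 by (intro add_mono mult_left_mono tM tN) auto
    finally have "cmod (S K - of_real \<tau> * sum h {- int M..int N}) \<le> E / (c0 * c2 * b\<^sup>2) * (b * \<epsilon>) + E / c2 * (\<epsilon> / b)"
      by (simp add: add.commute)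
    also have "\<dots> = (1 + 1 / c0) / c2 * E / b * \<epsilon>" using b c c0 by (simp add: field_simps power2_eq_square)
    finally show ?thesis by (simp add: h_def)
  qed
  have D: "D \<le> 2640 * exp pi / (c * \<mu> * (1 - exp (- (pi * \<mu>)))) * E * T / b * \<epsilon>"
  proof -
    define q where "q = exp (- (2 * pi * d / \<tau>))"
    have q: "q \<le> exp (- (pi * \<mu>))" "0 < q" using Q by (auto simp: q_def)
    have p1: "exp (- (pi * \<mu>)) < 1" using \<mu> by simp
    \<comment> \<open>The exponent is at least pi \<mu>, so 1 - q stays away from 0 uniformly in
      \<tau>.\<close>
    have "1 / (exp (2 * pi * d / \<tau>) - 1) = q / (1 - q)"
      using q p1 by (simp add: q_def exp_minus field_simps)
    also have "\<dots> \<le> (exp pi * \<epsilon>) / (1 - exp (- (pi * \<mu>)))"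
      using q p1 eps by (intro frac_le) (auto simp: q_def \<epsilon>_def)
    finally have 1: "1 / (exp (2 * pi * d / \<tau>) - 1) \<le> (exp pi * \<epsilon>) / (1 - exp (- (pi * \<mu>)))" .
    have "2 * J = 120 * E / (b * c) * (ln (1 + 1 / \<delta>) / s)" by (simp add: J_def A_def ac_simps)
    also have "\<dots> \<le> 120 * E / (b * c) * (22 / \<mu> * T)"
      using lns E b c by (intro mult_left_mono) (auto simp: \<delta>_def s_def)
    finally have 2: "2 * J \<le> 120 * E / (b * c) * (22 / \<mu> * T)" .
    have "D = 2 * J * (1 / (exp (2 * pi * d / \<tau>) - 1))" by (simp add: D_def)
    also have "\<dots> \<le> (120 * E / (b * c) * (22 / \<mu> * T)) * ((exp pi * \<epsilon>) / (1 - exp (- (pi * \<mu>))))"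
      using E b c \<mu> T d \<tau> by (intro mult_mono 1 2) auto
    also have "\<dots> = 2640 * exp pi / (c * \<mu> * (1 - exp (- (pi * \<mu>)))) * E * T / b * \<epsilon>" by (simp add: ac_simps)
    finally show ?thesis .
  qed
  define V where "V = D + (1 + 1 / c0) / c2 * E / b * \<epsilon>"
  have limLL: "filterlim LL at_top sequentially"
  proof (rule filterlim_at_top_mono)
    show "filterlim (\<lambda>K. \<tau> * real K) at_top sequentially"
      by (rule filterlim_tendsto_pos_mult_at_top[OF tendsto_const \<tau>(1) filterlim_real_sequentially])
    show "\<forall>\<^sub>F K in sequentially. \<tau> * real K \<le> LL K"
      using \<tau>(1) by (simp add: LL_def algebra_simps)
  qed
  have g0: "((\<lambda>K. g (LL K)) \<longlongrightarrow> 0) sequentially" "((\<lambda>K. g (- LL K)) \<longlongrightarrow> 0) sequentially"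
  proof -
    have *: "((\<lambda>K. g (f K)) \<longlongrightarrow> 0) sequentially" if "filterlim f at_infinity sequentially" for f
      unfolding g_def using tendsto_mult_right_zero[OF filterlim_compose[OF log_majorant_tendsto_0[OF \<delta>] that]] by simp
    show "((\<lambda>K. g (LL K)) \<longlongrightarrow> 0) sequentially"
      using limLL filterlim_at_top_imp_at_infinity by (intro *) blast
    show "((\<lambda>K. g (- LL K)) \<longlongrightarrow> 0) sequentially"
    proof (rule *)
      have "filterlim (\<lambda>K. - LL K) at_bot sequentially" using limLL by (simp add: filterlim_uminus_at_bot)
      then show "filterlim (\<lambda>K. - LL K) at_infinity sequentially"
        by (rule filterlim_mono[OF _ at_bot_le_at_infinity order_refl])
    qed
  qed
  define W where "W K = V + (6 * d * (g (LL K) + g (- LL K)) + cmod (I - integral {- LL K..LL K} (\<lambda>x. G (of_real x))))" for K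
  have "W \<longlonglongrightarrow> V + (6 * d * (0 + 0) + cmod (I - I))"
    unfolding W_def by (intro tendsto_intros g0 filterlim_compose[OF lim limLL])
  then have W: "W \<longlonglongrightarrow> V" by simp
  have "cmod (I - of_real \<tau> * (\<Sum>n\<in>{- int M..int N}. G (of_real (of_int n * \<tau>)))) \<le> V"
  proof (rule tendsto_lowerbound[OF W])
    show "\<forall>\<^sub>F K in sequentially. cmod (I - of_real \<tau> * (\<Sum>n\<in>{- int M..int N}. G (of_real (of_int n * \<tau>)))) \<le> W K"
      using eventually_ge_at_top[of "max M N"]
    proof eventually_elim
      case (elim K)
      define IK where "IK = integral {- LL K..LL K} (\<lambda>x. G (of_real x))"
      define U where "U = of_real \<tau> * (\<Sum>n\<in>{- int M..int N}. G (of_real (of_int n * \<tau>)))"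
      have "I - U = (I - IK) + - (S K - IK) + (S K - U)" by simp
      also have "cmod \<dots> \<le> cmod (I - IK) + cmod (S K - IK) + cmod (S K - U)"
        by (intro norm_triangle_le add_mono) (simp_all add: norm_minus_commute)
      finally show ?case using S[of K] tails[of K] elim by (simp add: W_def V_def U_def IK_def)
    qed
  qed simp
  also have "V \<le> quad_const \<alpha> c0 * E * T / b * \<epsilon>"
  proof -
    have "(1 + 1 / c0) / c2 * E / b * \<epsilon> * 1 \<le> (1 + 1 / c0) / c2 * E / b * \<epsilon> * T"
      using c c0 E b T by (intro mult_left_mono) (auto simp: \<epsilon>_def)
    then have "V \<le> 2640 * exp pi / (c * \<mu> * (1 - exp (- (pi * \<mu>)))) * E * T / b * \<epsilon> + (1 + 1 / c0) / c2 * E / b * \<epsilon> * T"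
      unfolding V_def using D by linarith
    also have "\<dots> = (2640 * exp pi / (c * \<mu> * (1 - exp (- (pi * \<mu>)))) + (1 + 1 / c0) / c2) * (E * T / b * \<epsilon>)"
    proof -
      have "X * E * T / b * \<epsilon> + Y * E / b * \<epsilon> * T = (X + Y) * (E * T / b * \<epsilon>)" for X Y
        by (simp add: algebra_simps add_divide_distrib)
      then show ?thesis .
    qed
    also have "\<dots> = quad_const \<alpha> c0 * E * T / b * \<epsilon>"
      by (simp add: quad_const_def c_def c2_def \<mu>_def Let_def)
    finally show ?thesis .
  qed
  finally show ?thesis by (simp add: T_def)
qed

section \<open>Operators on finite-dimensional spaces of functions\<close>

lemma complex_poly_linear_factors:
  fixes p :: "complex poly"
  assumes "p \<noteq> 0"
  shows "\<exists>c ls. c \<noteq> 0 \<and> p = smult c (\<Prod>l\<leftarrow>ls. [:- l, 1:])"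
proof -
  obtain ls where ls: "mset ls = proots p" using ex_mset by blast
  have "p = smult (lead_coeff p) (\<Prod>l\<leftarrow>ls. [:- l, 1:])"
    using complex_poly_decompose_multiset[of p]
    by (simp add: ls[symmetric] prod_mset_prod_list flip: mset_map)
  then show ?thesis using assms leading_coeff_0_iff by blast
qed

text \<open>Linear algebra relative to a carrier \<open>W\<close>: the finite element space varies
  with the mesh and the discrete operator is specified on that space only.\<close>

locale fun_space_operator =
  fixes W :: "('x \<Rightarrow> complex) set" and T :: "('x \<Rightarrow> complex) \<Rightarrow> 'x \<Rightarrow> complex"
  assumes zero_mem: "(\<lambda>x. 0) \<in> W"
    and add_mem: "\<And>u v. u \<in> W \<Longrightarrow> v \<in> W \<Longrightarrow> (\<lambda>x. u x + v x) \<in> W"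
    and scale_mem: "\<And>c u. u \<in> W \<Longrightarrow> (\<lambda>x. c * u x) \<in> W"
    and op_mem: "\<And>u. u \<in> W \<Longrightarrow> T u \<in> W"
    and op_add: "\<And>u v. u \<in> W \<Longrightarrow> v \<in> W \<Longrightarrow> T (\<lambda>x. u x + v x) = (\<lambda>x. T u x + T v x)"
    and op_scale: "\<And>c u. u \<in> W \<Longrightarrow> T (\<lambda>x. c * u x) = (\<lambda>x. c * T u x)"
begin

section \<open>Products of the shifted operators T - l\<close>

definition linear_functional :: "(('x \<Rightarrow> complex) \<Rightarrow> complex) \<Rightarrow> bool" where
  "linear_functional \<ll> \<longleftrightarrow>
    (\<forall>u\<in>W. \<forall>v\<in>W. \<ll> (\<lambda>x. u x + v x) = \<ll> u + \<ll> v) \<and> (\<forall>c. \<forall>u\<in>W. \<ll> (\<lambda>x. c * u x) = c * \<ll> u)"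

definition shift :: "complex \<Rightarrow> ('x \<Rightarrow> complex) \<Rightarrow> 'x \<Rightarrow> complex" where
  "shift l w = (\<lambda>x. T w x + (- l) * w x)"

primrec shifts :: "complex list \<Rightarrow> ('x \<Rightarrow> complex) \<Rightarrow> 'x \<Rightarrow> complex" where
  "shifts [] w = w"
| "shifts (l # ls) w = shifts ls (shift l w)"

lemma linear_functional_simps:
  assumes "linear_functional \<ll>"
  shows "u \<in> W \<Longrightarrow> v \<in> W \<Longrightarrow> \<ll> (\<lambda>x. u x + v x) = \<ll> u + \<ll> v"
    "u \<in> W \<Longrightarrow> \<ll> (\<lambda>x. c * u x) = c * \<ll> u" "\<ll> (\<lambda>x. 0) = 0"
proof -
  show *: "u \<in> W \<Longrightarrow> \<ll> (\<lambda>x. c * u x) = c * \<ll> u" for c u using assms by (auto simp: linear_functional_def)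
  show "u \<in> W \<Longrightarrow> v \<in> W \<Longrightarrow> \<ll> (\<lambda>x. u x + v x) = \<ll> u + \<ll> v"
    using assms by (auto simp: linear_functional_def)
  show "\<ll> (\<lambda>x. 0) = 0" using *[OF zero_mem, of 0] by simp
qed

lemma linear_functional_eval: "linear_functional (\<lambda>w. w x)"
  by (simp add: linear_functional_def)

lemma shift_mem: "w \<in> W \<Longrightarrow> shift l w \<in> W"
  unfolding shift_def by (intro add_mem op_mem scale_mem)

lemma shift_add: "u \<in> W \<Longrightarrow> v \<in> W \<Longrightarrow> shift l (\<lambda>x. u x + v x) = (\<lambda>x. shift l u x + shift l v x)"
  by (simp add: shift_def op_add algebra_simps)

lemma shift_scale: "u \<in> W \<Longrightarrow> shift l (\<lambda>x. c * u x) = (\<lambda>x. c * shift l u x)"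
  by (simp add: shift_def op_scale algebra_simps)

lemma shift_commute:
  assumes "w \<in> W"
  shows "shift l (shift m w) = shift m (shift l w)"
proof -
  have "T (shift k w) = (\<lambda>x. T (T w) x + (- k) * T w x)" for k
    unfolding shift_def op_add[OF op_mem[OF assms] scale_mem[OF assms]] op_scale[OF assms] ..
  then show ?thesis by (simp add: shift_def fun_eq_iff algebra_simps)
qed

lemma shifts_mem: "w \<in> W \<Longrightarrow> shifts ls w \<in> W"
  by (induction ls arbitrary: w) (auto intro: shift_mem)

lemma shifts_add: "u \<in> W \<Longrightarrow> v \<in> W \<Longrightarrow> shifts ls (\<lambda>x. u x + v x) = (\<lambda>x. shifts ls u x + shifts ls v x)"
  by (induction ls arbitrary: u v) (auto simp: shift_add shift_mem)

lemma shifts_scale: "u \<in> W \<Longrightarrow> shifts ls (\<lambda>x. c * u x) = (\<lambda>x. c * shifts ls u x)"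
  by (induction ls arbitrary: u) (auto simp: shift_scale shift_mem)

lemma shifts_zero: "shifts ls (\<lambda>x. 0) = (\<lambda>x. 0)"
  using shifts_scale[OF zero_mem, of ls 0] by simp

lemma shifts_append: "shifts (xs @ ys) w = shifts ys (shifts xs w)"
  by (induction xs arbitrary: w) auto

lemma shifts_shift: "w \<in> W \<Longrightarrow> shifts ls (shift l w) = shift l (shifts ls w)"
proof (induction ls arbitrary: w)
  case (Cons a ls)
  then show ?case using shift_commute[of w a l] shift_mem[of w a] by (metis shifts.simps(2))
qed simp

text \<open>As the factors commute, any one of them can be applied last. This exhibits an
  eigenvector for each entry of a shortest annihilating list.\<close>

lemma shifts_middle: "w \<in> W \<Longrightarrow> shifts (xs @ l # ys) w = shift l (shifts (xs @ ys) w)"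
  by (simp add: shifts_append shifts_shift shifts_mem)

lemma shifts_eq_0_append:
  assumes "w \<in> W" "shifts xs w = (\<lambda>x. 0)"
  shows "shifts (ys @ xs @ zs) w = (\<lambda>x. 0)"
  using assms
proof (induction ys arbitrary: w)
  case Nil
  then show ?case by (simp add: shifts_append shifts_zero)
next
  case (Cons y ys)
  have "shifts xs (shift y w) = shift y (shifts xs w)" using Cons by (simp add: shifts_shift)
  also have "\<dots> = (\<lambda>x. 0)" using Cons shifts_zero[of "[y]"] by simp
  finally show ?case using Cons shift_mem by simp
qed

section \<open>Polynomials in the operator and annihilating lists\<close>

definition poly_op :: "complex poly \<Rightarrow> ('x \<Rightarrow> complex) \<Rightarrow> 'x \<Rightarrow> complex" where
  "poly_op p = fold_coeffs (\<lambda>a g w x. a * w x + g (T w) x) p (\<lambda>w x. 0)"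

lemma poly_op_0: "poly_op 0 = (\<lambda>w x. 0)"
  by (simp add: poly_op_def)

lemma poly_op_pCons: "poly_op (pCons a p) = (\<lambda>w x. a * w x + poly_op p (T w) x)"
  by (cases "p = 0 \<and> a = 0") (auto simp: poly_op_def)

lemma poly_op_add: "poly_op (p + q) w x = poly_op p w x + poly_op q w x"
  by (induction p q arbitrary: w rule: poly_induct2) (auto simp: poly_op_0 poly_op_pCons algebra_simps)

lemma poly_op_smult: "poly_op (smult c p) w x = c * poly_op p w x"
  by (induction p arbitrary: w) (auto simp: poly_op_0 poly_op_pCons algebra_simps)

lemma poly_op_mem: "w \<in> W \<Longrightarrow> poly_op p w \<in> W"
proof (induction p arbitrary: w)
  case 0
  then show ?case by (simp add: poly_op_0 zero_mem)
next
  case (pCons a p)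
  then show ?case using add_mem[OF scale_mem[of w a] pCons.IH[of "T w"]] op_mem[of w]
    by (simp add: poly_op_pCons)
qed

lemma poly_op_linear:
  "u \<in> W \<Longrightarrow> v \<in> W \<Longrightarrow> poly_op p (\<lambda>x. u x + c * v x) = (\<lambda>x. poly_op p u x + c * poly_op p v x)"
proof (induction p arbitrary: u v)
  case 0
  then show ?case by (simp add: poly_op_0)
next
  case (pCons a p)
  have "T (\<lambda>x. u x + c * v x) = (\<lambda>x. T u x + c * T v x)"
    using pCons by (simp add: op_add op_scale scale_mem)
  then show ?case using pCons by (simp add: poly_op_pCons op_mem algebra_simps)
qed

lemma poly_op_linear_factor:
  assumes "w \<in> W"
  shows "poly_op ([:- l, 1:] * p) w = poly_op p (shift l w)"
proof -
  have "poly_op ([:- l, 1:] * p) w = (\<lambda>x. poly_op p (T w) x + (- l) * poly_op p w x)"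
    by (simp add: fun_eq_iff poly_op_add poly_op_smult poly_op_pCons algebra_simps del: smult_minus_left)
  also have "\<dots> = poly_op p (\<lambda>x. T w x + (- l) * w x)"
    using poly_op_linear[OF op_mem[OF assms] assms, of p "- l"] by simp
  finally show ?thesis by (simp add: shift_def)
qed

lemma poly_op_prod_linear_factors:
  "w \<in> W \<Longrightarrow> poly_op (\<Prod>l\<leftarrow>ls. [:- l, 1:]) w = shifts ls w"
  by (induction ls arbitrary: w)
    (auto simp: poly_op_linear_factor shift_mem poly_op_pCons poly_op_0 one_pCons simp del: mult_pCons_left)

text \<open>A finite number of linear conditions does not bound the degree of the polynomials satisfying
  them.\<close>

lemma poly_op_vanishing:
  assumes "finite X"
  shows "\<exists>p. degree p > d \<and> (\<forall>x\<in>X. poly_op p w x = 0)"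
  using assms
proof (induction X arbitrary: d rule: finite_induct)
  case empty
  have "degree (monom (1 :: complex) (Suc d)) > d" by (simp add: degree_monom_eq)
  then show ?case by blast
next
  case (insert a X)
  obtain p where p: "degree p > d" "\<forall>x\<in>X. poly_op p w x = 0" using insert.IH by blast
  obtain q where q: "degree q > degree p" "\<forall>x\<in>X. poly_op q w x = 0" using insert.IH by blast
  show ?case
  proof (cases "poly_op p w a = 0")
    case True
    then show ?thesis using p by auto
  next
    case False
    \<comment> \<open>Two polynomials of different degrees satisfy the old conditions. The
      combination that cancels the value at the new point retains the larger degree, because the
      coefficient of \<open>q\<close> is the nonzero value of the smaller one.\<close>
    define c e where "c = poly_op p w a" and "e = - poly_op q w a"
    define r where "r = smult e p + smult c q"
    have "degree (smult e p) < degree (smult c q)"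
      using q False degree_smult_le[of e p] by (simp add: c_def)
    then have "degree r = degree q" using False by (simp add: r_def degree_add_eq_right c_def)
    moreover have "poly_op r w x = e * poly_op p w x + c * poly_op q w x" for x
      by (simp add: r_def poly_op_add poly_op_smult)
    then have "\<forall>x\<in>insert a X. poly_op r w x = 0"
      using p q by (auto simp: c_def e_def)
    ultimately show ?thesis using p q by (intro exI[of _ r]) auto
  qed
qed

text \<open>Some nonconstant polynomial in T maps w to a function that vanishes on the determining
  set X, hence to 0; its complex linear factors form the list.\<close>

lemma shifts_annihilate_vector:
  assumes "finite X" and X: "\<And>v. v \<in> W \<Longrightarrow> (\<And>x. x \<in> X \<Longrightarrow> v x = 0) \<Longrightarrow> v = (\<lambda>x. 0)" and w: "w \<in> W"
  shows "\<exists>ls. shifts ls w = (\<lambda>x. 0)"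
proof -
  obtain p where p: "degree p > 0" "\<forall>x\<in>X. poly_op p w x = 0"
    using poly_op_vanishing[OF assms(1)] by blast
  have p0: "poly_op p w = (\<lambda>x. 0)" using p by (intro X poly_op_mem w) auto
  obtain c ls where c: "c \<noteq> 0" and ls: "p = smult c (\<Prod>l\<leftarrow>ls. [:- l, 1:])"
    using complex_poly_linear_factors[of p] p degree_0 less_irrefl by metis
  have "poly_op p w x = c * shifts ls w x" for x
    using ls poly_op_smult poly_op_prod_linear_factors[OF w, of ls] by metis
  then have "shifts ls w = (\<lambda>x. 0)" using p0 c by (simp add: fun_eq_iff)
  then show ?thesis ..
qed

text \<open>The lists of the members of a spanning set are concatenated: since the factors commute,
  a product that kills a vector still kills it after further factors are inserted.\<close>

lemma annihilating_list_exists: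
  assumes "finite X" and X: "\<And>v. v \<in> W \<Longrightarrow> (\<And>x. x \<in> X \<Longrightarrow> v x = 0) \<Longrightarrow> v = (\<lambda>x. 0)"
    and "finite B" "B \<subseteq> W" and span: "\<And>v. v \<in> W \<Longrightarrow> \<exists>c. v = (\<lambda>x. \<Sum>e\<in>B. c e * e x)"
  shows "\<exists>ls. \<forall>w\<in>W. shifts ls w = (\<lambda>x. 0)"
proof -
  have "\<exists>ls. \<forall>e\<in>B'. shifts ls e = (\<lambda>x. 0)" if "B' \<subseteq> B" for B'
    using finite_subset[OF that assms(3)] that
  proof (induction B' rule: finite_induct)
    case (insert e B')
    obtain ls where ls: "\<forall>e\<in>B'. shifts ls e = (\<lambda>x. 0)" using insert by auto
    obtain ms where ms: "shifts ms e = (\<lambda>x. 0)"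
      using shifts_annihilate_vector[OF assms(1) X] insert.prems assms(4) by blast
    have "shifts (ls @ ms) u = (\<lambda>x. 0)" if "u \<in> insert e B'" for u
    proof (cases "u = e")
      case True
      then show ?thesis using shifts_eq_0_append[of e ms ls "[]"] ms insert.prems assms(4) by auto
    next
      case False
      then show ?thesis using that ls by (simp add: shifts_append shifts_zero)
    qed
    then show ?case by blast
  qed simp
  then obtain ls where ls: "\<forall>e\<in>B. shifts ls e = (\<lambda>x. 0)" by blast
  have "shifts ls w = (\<lambda>x. 0)" if w: "w \<in> W" for w
  proof -
    obtain c where c: "w = (\<lambda>x. \<Sum>e\<in>B. c e * e x)" using span[OF w] by blast
    have "(\<lambda>x. \<Sum>e\<in>B'. c e * e x) \<in> W \<and> shifts ls (\<lambda>x. \<Sum>e\<in>B'. c e * e x) = (\<lambda>x. 0)" if "B' \<subseteq> B" for B'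
      using finite_subset[OF that assms(3)] that
    proof (induction B' rule: finite_induct)
      case empty
      then show ?case by (simp add: zero_mem shifts_zero)
    next
      case (insert e B')
      have "e \<in> W" "shifts ls e = (\<lambda>x. 0)" using insert assms(4) ls by auto
      then show ?case using insert by (simp add: add_mem scale_mem shifts_add shifts_scale)
    qed
    then show ?thesis using c by auto
  qed
  then show ?thesis by blast
qed

text \<open>A shortest annihilating list acts as the minimal polynomial: without the entry l the
  product leaves some vector nonzero, and T - l kills that vector.\<close>

lemma spectral_list_exists:
  assumes "\<exists>ls. \<forall>w\<in>W. shifts ls w = (\<lambda>x. 0)"
  obtains ls where "\<forall>w\<in>W. shifts ls w = (\<lambda>x. 0)"
    "\<forall>l\<in>set ls. \<exists>u\<in>W. u \<noteq> (\<lambda>x. 0) \<and> T u = (\<lambda>x. l * u x)"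
proof -
  define P where "P ls \<longleftrightarrow> (\<forall>w\<in>W. shifts ls w = (\<lambda>x. 0))" for ls
  obtain ls where ls: "P ls" "\<And>ms. P ms \<Longrightarrow> length ls \<le> length ms"
    using ex_has_least_nat[of P _ length] assms unfolding P_def by blast
  have "\<exists>u\<in>W. u \<noteq> (\<lambda>x. 0) \<and> T u = (\<lambda>x. l * u x)" if l: "l \<in> set ls" for l
  proof -
    obtain xs ys where xy: "ls = xs @ l # ys" using split_list[OF l] by blast
    have "\<not> P (xs @ ys)" using ls(2)[of "xs @ ys"] xy by auto
    then obtain w where w: "w \<in> W" "shifts (xs @ ys) w \<noteq> (\<lambda>x. 0)" by (auto simp: P_def)
    define u where "u = shifts (xs @ ys) w"
    have "shift l u = (\<lambda>x. 0)" using ls(1) w shifts_middle[of w xs l ys] by (simp add: P_def xy u_def)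
    then have "T u = (\<lambda>x. l * u x)" by (simp add: shift_def fun_eq_iff)
    then show ?thesis using w shifts_mem unfolding u_def by blast
  qed
  then show thesis using ls that by (auto simp: P_def)
qed

end

section \<open>Resolvents and the Dunford--Taylor calculus\<close>

text \<open>Every point of \<open>P\<close> is encircled once, as it is by a large circle, so the
  residue theorem equates the two integrals; on the circle of radius R the integral is of order
  1/R.\<close>

lemma contour_integral_eq_0_of_decay:
  fixes f :: "complex \<Rightarrow> complex"
  assumes P: "finite P" and f: "f holomorphic_on - P"
    and decay: "\<And>z. R0 \<le> cmod z \<Longrightarrow> cmod (f z) \<le> C / (cmod z)\<^sup>2"
    and \<gamma>: "valid_path \<gamma>" "pathfinish \<gamma> = pathstart \<gamma>" "path_image \<gamma> \<inter> P = {}"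
    and wn: "\<And>p. p \<in> P \<Longrightarrow> winding_number \<gamma> p = 1"
  shows "contour_integral \<gamma> f = 0"
proof -
  obtain R1 where R1: "\<And>p. p \<in> P \<Longrightarrow> cmod p < R1" "0 < R1"
  proof -
    obtain B where "\<forall>p\<in>P. cmod p \<le> B" using finite_imp_bounded[OF P] bounded_iff by blast
    then show thesis by (intro that[of "\<bar>B\<bar> + 1"]) fastforce+
  qed
  have le: "cmod (contour_integral \<gamma> f) \<le> 2 * pi * \<bar>C\<bar> / R" if R: "max R0 R1 \<le> R" for R
  proof -
    have Rp: "0 < R" using R R1 by simp
    have holo: "f holomorphic_on UNIV - P" using f by (simp add: Compl_eq_Diff_UNIV)
    have imc: "path_image (circlepath 0 R) \<subseteq> UNIV - P" using R1 R Rp by fastforce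
    have "contour_integral \<gamma> f = 2 * pi * \<i> * (\<Sum>p\<in>P. winding_number \<gamma> p * residue f p)"
      using \<gamma> by (intro Residue_theorem[OF open_UNIV connected_UNIV P holo]) auto
    also have "(\<Sum>p\<in>P. winding_number \<gamma> p * residue f p) = (\<Sum>p\<in>P. winding_number (circlepath 0 R) p * residue f p)"
    proof (rule sum.cong)
      fix p assume p: "p \<in> P"
      have "winding_number (circlepath 0 R) p = 1"
        using R1(1)[OF p] R by (intro winding_number_circlepath) simp
      then show "winding_number \<gamma> p * residue f p = winding_number (circlepath 0 R) p * residue f p"
        using wn[OF p] by simp
    qed simp
    also have "2 * pi * \<i> * \<dots> = contour_integral (circlepath 0 R) f"
      using imc by (intro Residue_theorem[OF open_UNIV connected_UNIV P holo, symmetric]) auto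
    also have "cmod \<dots> \<le> (\<bar>C\<bar> / R\<^sup>2) * (2 * pi * R)"
    proof (rule has_contour_integral_bound_circlepath)
      have "f contour_integrable_on circlepath 0 R"
        using imc finite_imp_closed[OF P] by (intro contour_integrable_holomorphic_simple[OF holo]) auto
      then show "(f has_contour_integral contour_integral (circlepath 0 R) f) (circlepath 0 R)"
        by (rule has_contour_integral_integral)
      fix x assume "cmod (x - 0) = R"
      then have "cmod (f x) \<le> C / R\<^sup>2" using decay[of x] R by simp
      moreover have "C / R\<^sup>2 \<le> \<bar>C\<bar> / R\<^sup>2" by (intro divide_right_mono) auto
      ultimately show "cmod (f x) \<le> \<bar>C\<bar> / R\<^sup>2" by linarith
    qed (use Rp in auto)
    also have "\<dots> = 2 * pi * \<bar>C\<bar> / R" using Rp by (simp add: power2_eq_square)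
    finally show ?thesis .
  qed
  have "((\<lambda>R. 2 * pi * \<bar>C\<bar> / R) \<longlongrightarrow> 0) at_top"
    by (intro real_tendsto_divide_at_top[OF tendsto_const] filterlim_ident)
  then have "cmod (contour_integral \<gamma> f) \<le> 0"
  proof (rule tendsto_lowerbound)
    show "\<forall>\<^sub>F R in at_top. cmod (contour_integral \<gamma> f) \<le> 2 * pi * \<bar>C\<bar> / R"
      using eventually_ge_at_top[of "max R0 R1"] by eventually_elim (rule le)
  qed simp
  then show ?thesis by simp
qed

lemma slit_plane: "open (- \<real>\<^sub>\<le>\<^sub>0 :: complex set)" "starlike (- \<real>\<^sub>\<le>\<^sub>0 :: complex set)"
proof -
  show "open (- \<real>\<^sub>\<le>\<^sub>0 :: complex set)" by (simp add: open_Compl)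
  have "(\<real>\<^sub>\<le>\<^sub>0 :: complex set) = complex_of_real ` {..0}" by (auto simp: nonpos_Reals_def)
  then show "starlike (- \<real>\<^sub>\<le>\<^sub>0 :: complex set)"
    using starlike_slotted_complex_plane_left[of 0] by simp
qed

section \<open>The explicit resolvent and Newton interpolation\<close>

context fun_space_operator
begin

text \<open>Iterates (z - T)^{-1} w = (w + (z - T)^{-1} (T - l) w) / (z - l). Stopping with 0 is
  correct once the product of the shifts has killed w.\<close>

primrec res :: "complex list \<Rightarrow> ('x \<Rightarrow> complex) \<Rightarrow> complex \<Rightarrow> 'x \<Rightarrow> complex" where
  "res [] w z = (\<lambda>x. 0)"
| "res (l # ls) w z = (\<lambda>x. inverse (z - l) * (w x + res ls (shift l w) z x))"

lemma res_mem: "w \<in> W \<Longrightarrow> res ls w z \<in> W"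
  by (induction ls arbitrary: w) (auto intro!: zero_mem scale_mem add_mem shift_mem)

lemma res_eq:
  "w \<in> W \<Longrightarrow> shifts ls w = (\<lambda>x. 0) \<Longrightarrow> z \<notin> set ls \<Longrightarrow> (\<lambda>x. z * res ls w z x - T (res ls w z) x) = w"
proof (induction ls arbitrary: w)
  case Nil
  then show ?case using op_scale[OF zero_mem, of 0] by simp
next
  case (Cons l ls)
  define r where "r = res ls (shift l w) z"
  have r: "r \<in> W" using Cons by (simp add: r_def res_mem shift_mem)
  have "z * r x - T r x = T w x + (- l) * w x" for x
    using Cons shift_mem[of w l] by (simp add: r_def shift_def fun_eq_iff)
  then have Tr: "T r x = z * r x - T w x + l * w x" for x by (simp add: algebra_simps)
  define c where "c = inverse (z - l)"
  have c: "c * (z - l) = 1" using Cons.prems by (simp add: c_def)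
  have "T (\<lambda>x. c * (w x + r x)) = (\<lambda>x. c * (T w x + T r x))"
    using r Cons.prems by (simp add: op_scale op_add add_mem)
  moreover have "z * (c * (w x + r x)) - c * (T w x + T r x) = c * (z - l) * w x" for x
    unfolding Tr by (simp add: algebra_simps)
  ultimately have "z * (c * (w x + r x)) - T (\<lambda>x. c * (w x + r x)) x = w x" for x
    using c by simp
  then show ?case by (simp add: r_def[symmetric] c_def[symmetric])
qed

lemma shifts_eigenvector: "u \<in> W \<Longrightarrow> T u = (\<lambda>x. z * u x) \<Longrightarrow> shifts ls u = (\<lambda>x. (\<Prod>l\<leftarrow>ls. z - l) * u x)"
proof (induction ls)
  case (Cons l ls)
  have "shift l u = (\<lambda>x. (z - l) * u x)" using Cons.prems by (simp add: shift_def left_diff_distrib)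
  then show ?case using Cons by (simp only: shifts.simps shifts_scale list.map prod_list.Cons mult.assoc simp_thms)
qed simp

lemma functional_res:
  assumes "linear_functional \<ll>" "w \<in> W"
  shows "\<ll> (res (l # ls) w z) = inverse (z - l) * (\<ll> w + \<ll> (res ls (shift l w) z))"
proof -
  have "res ls (shift l w) z \<in> W" using assms(2) by (intro res_mem shift_mem)
  then show ?thesis using assms(2)
    by (simp add: linear_functional_simps(1,2)[OF assms(1)] add_mem)
qed

lemma functional_res_holomorphic:
  assumes "linear_functional \<ll>"
  shows "w \<in> W \<Longrightarrow> A \<inter> set ls = {} \<Longrightarrow> (\<lambda>z. \<ll> (res ls w z)) holomorphic_on A"
proof (induction ls arbitrary: w)
  case Nil
  then show ?case by simp
next
  case (Cons l ls)
  then show ?case unfolding functional_res[OF assms Cons.prems(1)]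
    by (intro holomorphic_intros) (auto intro!: shift_mem)
qed

text \<open>The inner term of the recursion is bounded by induction, so the factor 1 / (z - l)
  decides; \<bar>z\<bar> \<ge> 2 \<bar>l\<bar> ensures \<bar>z - l\<bar> \<ge> \<bar>z\<bar> /
  2.\<close>

lemma functional_res_decay:
  assumes "linear_functional \<ll>"
  shows "w \<in> W \<Longrightarrow> \<exists>C\<ge>0. \<exists>R\<ge>1. \<forall>z. R \<le> cmod z \<longrightarrow> cmod (\<ll> (res ls w z)) \<le> C / cmod z"
proof (induction ls arbitrary: w)
  case Nil
  then show ?case using linear_functional_simps(3)[OF assms] by (auto intro!: exI[of _ 0] exI[of _ 1])
next
  case (Cons l ls)
  obtain C R where C: "0 \<le> C" "1 \<le> R" "\<And>z. R \<le> cmod z \<Longrightarrow> cmod (\<ll> (res ls (shift l w) z)) \<le> C / cmod z"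
    using Cons.IH[OF shift_mem[OF Cons.prems]] by blast
  define C' where "C' = 2 * (cmod (\<ll> w) + C)"
  have "cmod (\<ll> (res (l # ls) w z)) \<le> C' / cmod z" if z: "R + 2 * cmod l \<le> cmod z" for z
  proof -
    have z1: "1 \<le> cmod z" "R \<le> cmod z" "2 * cmod l \<le> cmod z" using z C norm_ge_zero[of l] by linarith+
    have "cmod z / 2 \<le> cmod (z - l)" using norm_triangle_ineq2[of z l] z1 by simp
    then have "inverse (cmod (z - l)) \<le> inverse (cmod z / 2)" using z1 by (intro le_imp_inverse_le) auto
    moreover have "cmod (\<ll> w + \<ll> (res ls (shift l w) z)) \<le> cmod (\<ll> w) + C"
    proof -
      have "C / cmod z \<le> C / 1" using C z1 by (intro divide_left_mono) auto
      then show ?thesis using C(3)[OF z1(2)] norm_triangle_ineq[of "\<ll> w" "\<ll> (res ls (shift l w) z)"] by simp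
    qed
    ultimately have "inverse (cmod (z - l)) * cmod (\<ll> w + \<ll> (res ls (shift l w) z)) \<le> inverse (cmod z / 2) * (cmod (\<ll> w) + C)"
      using z1 C by (intro mult_mono) auto
    then show ?thesis unfolding functional_res[OF assms Cons.prems] norm_mult norm_inverse C'_def
      by (simp add: field_simps)
  qed
  moreover have "0 \<le> C'" using C by (simp add: C'_def)
  moreover have "1 \<le> R + 2 * cmod l" using C norm_ge_zero[of l] by linarith
  ultimately show ?case by blast
qed

text \<open>Newton interpolation: \<^term>\<open>divided_difference\<close> is \<^term>\<open>(h z - h l) / (z - l)\<close> with its
  removable singularity removed.\<close>

definition divided_difference :: "(complex \<Rightarrow> complex) \<Rightarrow> complex \<Rightarrow> complex \<Rightarrow> complex" where
  "divided_difference h l z = (if z = l then deriv h l else (h z - h l) / (z - l))"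

text \<open>Newton form of h(T) w, from h(T) = h(l) + k(T) (T - l) with k the divided difference of
  h at l. A repeated entry of the list evaluates k at l itself, where the derivative appears; so
  operators that are not diagonalisable are covered.\<close>

primrec newton_op :: "complex list \<Rightarrow> (complex \<Rightarrow> complex) \<Rightarrow> ('x \<Rightarrow> complex) \<Rightarrow> 'x \<Rightarrow> complex" where
  "newton_op [] h w = (\<lambda>x. 0)"
| "newton_op (l # ls) h w = (\<lambda>x. h l * w x + newton_op ls (divided_difference h l) (shift l w) x)"

lemma newton_op_mem: "w \<in> W \<Longrightarrow> newton_op ls h w \<in> W"
proof (induction ls arbitrary: w h)
  case (Cons l ls)
  then show ?case using add_mem[OF scale_mem[of w "h l"] Cons.IH[OF shift_mem[of w l]]] by simp
qed (simp add: zero_mem)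

lemma divided_difference_holomorphic: "h holomorphic_on S \<Longrightarrow> open S \<Longrightarrow> divided_difference h l holomorphic_on S"
  unfolding divided_difference_def by (rule pole_lemma_open)

lemma divided_difference_mult: "divided_difference h l z * (z - l) = h z - h l"
  by (simp add: divided_difference_def)

end

text \<open>\<open>annihilates\<close> confines the spectrum to \<open>set LS\<close>,
  \<open>eigenvectors\<close> puts every entry into the spectrum. Entries are repeated as often as
  generalised eigenvectors require.\<close>

locale fun_space_spectral = fun_space_operator W T
  for W :: "('x \<Rightarrow> complex) set" and T +
  fixes LS :: "complex list"
  assumes annihilates: "\<And>w. w \<in> W \<Longrightarrow> shifts LS w = (\<lambda>x. 0)"
    and eigenvectors: "\<And>l. l \<in> set LS \<Longrightarrow> \<exists>u\<in>W. u \<noteq> (\<lambda>x. 0) \<and> T u = (\<lambda>x. l * u x)"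
begin

text \<open>An element of the kernel of z - T is an eigenvector. The product of the shifts
  annihilates it and also multiplies it by the nonzero number \<Prod>(z - l).\<close>

lemma resolvent_inj:
  assumes "z \<notin> set LS"
  shows "inj_on (\<lambda>w x. z * w x - T w x) W"
proof (rule inj_onI)
  fix u v assume uv: "u \<in> W" "v \<in> W" "(\<lambda>x. z * u x - T u x) = (\<lambda>x. z * v x - T v x)"
  define d where "d = (\<lambda>x. u x + (- 1) * v x)"
  have d: "d \<in> W" using uv unfolding d_def by (intro add_mem scale_mem)
  have "T d = (\<lambda>x. T u x + (-1) * T v x)"
    unfolding d_def op_add[OF uv(1) scale_mem[OF uv(2)]] op_scale[OF uv(2)] ..
  then have Td: "T d x = T u x - T v x" for x by simp
  have "T d x = z * d x" for x
  proof -
    have "z * u x - T u x = z * v x - T v x" using uv(3) by (rule fun_cong)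
    moreover have "d x = u x - v x" by (simp add: d_def)
    ultimately show ?thesis using Td[of x] by algebra
  qed
  then have "T d = (\<lambda>x. z * d x)" ..
  then have "(\<lambda>x. (\<Prod>l\<leftarrow>LS. z - l) * d x) = (\<lambda>x. 0)"
    using shifts_eigenvector[OF d, of z LS] annihilates[OF d] by simp
  then have "(\<Prod>l\<leftarrow>LS. z - l) * d x = 0" for x by (rule fun_cong)
  moreover have "(\<Prod>l\<leftarrow>LS. z - l) \<noteq> 0" using assms by (auto simp: prod_list_zero_iff)
  ultimately show "u = v" by (auto simp: d_def fun_eq_iff)
qed

lemma spectrum_eq: "op_spectrum W T = set LS"
proof -
  have "bij_betw (\<lambda>w x. z * w x - T w x) W W" if z: "z \<notin> set LS" for z
    unfolding bij_betw_def
  proof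
    show "(\<lambda>w x. z * w x - T w x) ` W = W"
    proof
      have "(\<lambda>x. z * w x - T w x) \<in> W" if "w \<in> W" for w
        using add_mem[OF scale_mem[OF that, of z] scale_mem[OF op_mem[OF that], of "-1"]] by simp
      then show "(\<lambda>w x. z * w x - T w x) ` W \<subseteq> W" by auto
      show "W \<subseteq> (\<lambda>w x. z * w x - T w x) ` W"
      proof
        fix w assume w: "w \<in> W"
        show "w \<in> (\<lambda>w x. z * w x - T w x) ` W"
          by (rule image_eqI[where x = "res LS w z"]) (use w z in \<open>auto simp: res_eq annihilates res_mem\<close>)
      qed
    qed
  qed (rule resolvent_inj[OF z])
  moreover have "\<not> bij_betw (\<lambda>w x. z * w x - T w x) W W" if z: "z \<in> set LS" for z
  proof
    assume "bij_betw (\<lambda>w x. z * w x - T w x) W W"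
    moreover obtain u where u: "u \<in> W" "u \<noteq> (\<lambda>x. 0)" "T u = (\<lambda>x. z * u x)" using eigenvectors[OF z] by blast
    moreover have "T (\<lambda>x. 0) = (\<lambda>x. 0)" using op_scale[OF zero_mem, of 0] by simp
    ultimately show False
      using inj_onD[of "\<lambda>w x. z * w x - T w x" W u "\<lambda>x. 0"] zero_mem by (auto simp: bij_betw_def)
  qed
  ultimately show ?thesis by (auto simp: op_spectrum_def)
qed

abbreviation R :: "complex \<Rightarrow> ('x \<Rightarrow> complex) \<Rightarrow> 'x \<Rightarrow> complex" where "R \<equiv> op_resolvent W T"

lemma resolvent_unique:
  assumes "z \<notin> set LS" "u \<in> W" "(\<lambda>x. z * u x - T u x) = w"
  shows "R z w = u"
  unfolding op_resolvent_def using the_inv_into_f_f[OF resolvent_inj[OF assms(1)] assms(2)] assms(3) by simp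

text \<open>Any list with entries from \<open>LS\<close> that kills the given vector may serve. The
  inductions over contour integrals shorten the list while they shift the vector.\<close>

lemma resolvent_eq_res:
  assumes "z \<notin> set LS" "w \<in> W" "shifts ls w = (\<lambda>x. 0)" "set ls \<subseteq> set LS"
  shows "R z w = res ls w z"
  using assms by (intro resolvent_unique res_mem res_eq) auto

lemma resolvent_mem: "z \<notin> set LS \<Longrightarrow> w \<in> W \<Longrightarrow> R z w \<in> W"
  using resolvent_eq_res[of z w LS] annihilates res_mem by auto

lemma resolvent_inverse: "z \<notin> set LS \<Longrightarrow> w \<in> W \<Longrightarrow> z * R z w x - T (R z w) x = w x"
  using resolvent_eq_res[of z w LS] res_eq[of w LS z] annihilates[of w] by (metis subset_refl)

lemma resolvent_add:
  assumes "z \<notin> set LS" "u \<in> W" "v \<in> W"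
  shows "R z (\<lambda>x. u x + v x) = (\<lambda>x. R z u x + R z v x)"
proof (rule resolvent_unique[OF assms(1)])
  show "(\<lambda>x. R z u x + R z v x) \<in> W" using assms by (intro add_mem resolvent_mem)
  show "(\<lambda>x. z * (R z u x + R z v x) - T (\<lambda>x. R z u x + R z v x) x) = (\<lambda>x. u x + v x)"
    using resolvent_inverse[OF assms(1,2)] resolvent_inverse[OF assms(1,3)] assms
    by (simp add: op_add resolvent_mem fun_eq_iff algebra_simps)
qed

lemma resolvent_scale:
  assumes "z \<notin> set LS" "u \<in> W"
  shows "R z (\<lambda>x. c * u x) = (\<lambda>x. c * R z u x)"
proof (rule resolvent_unique[OF assms(1)])
  show "(\<lambda>x. c * R z u x) \<in> W" using assms by (intro scale_mem resolvent_mem)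
  have "z * (c * R z u x) - c * T (R z u) x = c * u x" for x
    using resolvent_inverse[OF assms, of x] by (metis mult.left_commute right_diff_distrib)
  then show "(\<lambda>x. z * (c * R z u x) - T (\<lambda>x. c * R z u x) x) = (\<lambda>x. c * u x)"
    using assms by (simp add: op_scale resolvent_mem)
qed

lemma resolvent_shift:
  assumes "z \<notin> set LS" "w \<in> W"
  shows "R z (shift l w) = (\<lambda>x. (z - l) * R z w x + (- 1) * w x)"
proof (rule resolvent_unique[OF assms(1)])
  have m: "R z w \<in> W" using assms by (rule resolvent_mem)
  show "(\<lambda>x. (z - l) * R z w x + (- 1) * w x) \<in> W" using assms by (intro add_mem scale_mem resolvent_mem)
  have T: "T (\<lambda>x. (z - l) * R z w x + (- 1) * w x) = (\<lambda>x. (z - l) * T (R z w) x + (- 1) * T w x)"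
    unfolding op_add[OF scale_mem[OF m] scale_mem[OF assms(2)]] op_scale[OF m] op_scale[OF assms(2)] ..
  have "z * ((z - l) * R z w x + (- 1) * w x) - ((z - l) * T (R z w) x + (- 1) * T w x) = T w x + (- l) * w x" for x
  proof -
    have "z * ((z - l) * r + (- 1) * u) - ((z - l) * t + (- 1) * v) = v + (- l) * u" if "z * r - t = u" for r t u v
      unfolding that[symmetric] by (simp add: algebra_simps)
    then show ?thesis using resolvent_inverse[OF assms, of x] by blast
  qed
  then show "(\<lambda>x. z * ((z - l) * R z w x + (- 1) * w x) - T (\<lambda>x. (z - l) * R z w x + (- 1) * w x) x) = shift l w"
    unfolding T shift_def by (rule ext)
qed

lemma functional_resolvent_holomorphic:
  assumes "linear_functional \<ll>" "w \<in> W" "A \<inter> set LS = {}"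
  shows "(\<lambda>z. \<ll> (R z w)) holomorphic_on A"
proof (rule holomorphic_transform[OF functional_res_holomorphic[OF assms]])
  show "\<ll> (res LS w z) = \<ll> (R z w)" if "z \<in> A" for z
  proof -
    have "z \<notin> set LS" using that assms(3) by auto
    then show ?thesis using assms(2) resolvent_eq_res[of z w LS] annihilates by auto
  qed
qed

section \<open>Integrals of the resolvent over a Dunford contour\<close>

context
  fixes \<gamma>
  assumes \<gamma>: "dunford_contour W T \<gamma>"
begin

lemma dunford_contourD:
  shows "valid_path \<gamma>" "pathfinish \<gamma> = pathstart \<gamma>" "path_image \<gamma> \<subseteq> - \<real>\<^sub>\<le>\<^sub>0"
    "path_image \<gamma> \<inter> set LS = {}" "\<And>l. l \<in> set LS \<Longrightarrow> winding_number \<gamma> l = 1"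
  using \<gamma> unfolding dunford_contour_def spectrum_eq by auto

lemma dunford_contour_not_spectrum: "z \<in> path_image \<gamma> \<Longrightarrow> z \<notin> set LS"
  using dunford_contourD(4) by auto

lemma dunford_integrable:
  assumes "f holomorphic_on - \<real>\<^sub>\<le>\<^sub>0 - set LS"
  shows "f contour_integrable_on \<gamma>"
  using dunford_contourD slit_plane
  by (intro contour_integrable_holomorphic_simple[OF assms] open_Diff finite_imp_closed) auto

lemma dunford_holomorphic_zero:
  assumes "f holomorphic_on - \<real>\<^sub>\<le>\<^sub>0"
  shows "contour_integral \<gamma> f = 0"
  using dunford_contourD slit_plane assms
  by (intro contour_integral_unique Cauchy_theorem_starlike_simple[of "- \<real>\<^sub>\<le>\<^sub>0"]) auto

context
  fixes \<ll>
  assumes lin: "linear_functional \<ll>"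
begin

text \<open>One step of the recursion is split off: the term with 1 / (z - l) yields the winding
  number 1, and the remainder, holomorphic off the spectrum and of order 1/\<bar>z\<bar>^2,
  integrates to 0.\<close>

lemma dunford_integral_one:
  assumes "w \<in> W" "shifts ls w = (\<lambda>x. 0)" "set ls \<subseteq> set LS"
  shows "contour_integral \<gamma> (\<lambda>z. \<ll> (R z w)) = 2 * pi * \<i> * \<ll> w"
proof (cases ls)
  case Nil
  then have "w = (\<lambda>x. 0)" using assms by simp
  then have "\<ll> (R z w) = 0" if "z \<in> path_image \<gamma>" for z
    using resolvent_eq_res[of z w "[]"] zero_mem dunford_contour_not_spectrum[OF that] linear_functional_simps(3)[OF lin] by auto
  then have "contour_integral \<gamma> (\<lambda>z. \<ll> (R z w)) = contour_integral \<gamma> (\<lambda>z. 0)"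
    by (intro contour_integral_cong) auto
  then show ?thesis using \<open>w = _\<close> linear_functional_simps(3)[OF lin] by simp
next
  case (Cons l ms)
  have l: "l \<in> set LS" "l \<notin> path_image \<gamma>" using assms Cons dunford_contourD(4) by auto
  define g where "g z = \<ll> (res ms (shift l w) z)" for z
  have eq: "\<ll> (R z w) = \<ll> w / (z - l) + g z / (z - l)" if "z \<in> path_image \<gamma>" for z
    using assms resolvent_eq_res[of z w ls] dunford_contour_not_spectrum[OF that] functional_res[OF lin assms(1), of l ms z]
    by (simp add: Cons g_def distrib_left divide_inverse mult.commute del: res.simps)
  have g: "g holomorphic_on - set LS" unfolding g_def
    using assms Cons by (intro functional_res_holomorphic lin shift_mem) auto
  have g': "(\<lambda>z. g z / (z - l)) holomorphic_on - set LS" using l by (intro holomorphic_intros g) auto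
  have i: "(\<lambda>z. \<ll> w / (z - l)) contour_integrable_on \<gamma>" "(\<lambda>z. g z / (z - l)) contour_integrable_on \<gamma>"
    using l by (auto intro!: dunford_integrable holomorphic_intros holomorphic_on_subset[OF g'])
  have "contour_integral \<gamma> (\<lambda>z. \<ll> (R z w)) = contour_integral \<gamma> (\<lambda>z. \<ll> w / (z - l) + g z / (z - l))"
    by (intro contour_integral_cong) (auto simp: eq)
  also have "\<dots> = contour_integral \<gamma> (\<lambda>z. \<ll> w / (z - l)) + contour_integral \<gamma> (\<lambda>z. g z / (z - l))"
    by (rule contour_integral_add[OF i])
  also have "contour_integral \<gamma> (\<lambda>z. \<ll> w / (z - l)) = 2 * pi * \<i> * \<ll> w"
  proof -
    have "((\<lambda>z. 1 / (z - l)) has_contour_integral 2 * pi * \<i> * winding_number \<gamma> l) \<gamma>"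
      using has_contour_integral_winding_number[of \<gamma> l] dunford_contourD(1) l by blast
    then have "((\<lambda>z. \<ll> w * (1 / (z - l))) has_contour_integral \<ll> w * (2 * pi * \<i> * winding_number \<gamma> l)) \<gamma>"
      by (rule has_contour_integral_lmul)
    then show ?thesis using dunford_contourD(5)[OF l(1)] by (simp add: contour_integral_unique)
  qed
  also have "contour_integral \<gamma> (\<lambda>z. g z / (z - l)) = 0"
  proof -
    obtain C B where C: "0 \<le> C" "1 \<le> B" "\<And>z. B \<le> cmod z \<Longrightarrow> cmod (g z) \<le> C / cmod z"
      using functional_res_decay[OF lin shift_mem[OF assms(1)], of ms l] unfolding g_def by blast
    have "cmod (g z / (z - l)) \<le> (2 * C) / (cmod z)\<^sup>2" if z: "B + 2 * cmod l \<le> cmod z" for z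
    proof -
      have z1: "1 \<le> cmod z" "B \<le> cmod z" "2 * cmod l \<le> cmod z" using z C norm_ge_zero[of l] by linarith+
      have "cmod z / 2 \<le> cmod (z - l)" using norm_triangle_ineq2[of z l] z1 by simp
      then have "cmod (g z) / cmod (z - l) \<le> (C / cmod z) / (cmod z / 2)"
        using C z1 by (intro frac_le) auto
      then show ?thesis by (simp add: norm_divide power2_eq_square ac_simps)
    qed
    then show ?thesis
      using dunford_contourD g' by (intro contour_integral_eq_0_of_decay[of "set LS" _ "B + 2 * cmod l" "2 * C"]) auto
  qed
  finally show ?thesis by simp
qed

text \<open>Substituting h(z) = h(l) + k(z) (z - l) gives h R w = h(l) R w + k R (T - l) w + k w,
  with R the resolvent at z. The last term is holomorphic in the starlike slit plane and drops out.
  The result does not mention the contour.\<close>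

lemma dunford_newton_op:
  "w \<in> W \<Longrightarrow> shifts ls w = (\<lambda>x. 0) \<Longrightarrow> set ls \<subseteq> set LS \<Longrightarrow> h holomorphic_on - \<real>\<^sub>\<le>\<^sub>0 \<Longrightarrow> set LS \<subseteq> - \<real>\<^sub>\<le>\<^sub>0 \<Longrightarrow>
   contour_integral \<gamma> (\<lambda>z. h z * \<ll> (R z w)) = 2 * pi * \<i> * \<ll> (newton_op ls h w)"
proof (induction ls arbitrary: w h)
  case Nil
  then have "\<ll> (R z w) = 0" if "z \<in> path_image \<gamma>" for z
    using resolvent_eq_res[of z w "[]"] zero_mem dunford_contour_not_spectrum[OF that] linear_functional_simps(3)[OF lin] by auto
  then have "contour_integral \<gamma> (\<lambda>z. h z * \<ll> (R z w)) = contour_integral \<gamma> (\<lambda>z. 0)"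
    by (intro contour_integral_cong) auto
  then show ?case using linear_functional_simps(3)[OF lin] by simp
next
  case (Cons l ls)
  define k where "k = divided_difference h l"
  have k: "k holomorphic_on - \<real>\<^sub>\<le>\<^sub>0" unfolding k_def
    by (intro divided_difference_holomorphic Cons.prems slit_plane)
  have w': "shift l w \<in> W" "shifts ls (shift l w) = (\<lambda>x. 0)" using Cons.prems by (auto intro: shift_mem)
  have Rw: "(\<lambda>z. \<ll> (R z u)) holomorphic_on - \<real>\<^sub>\<le>\<^sub>0 - set LS" if "u \<in> W" for u
    by (intro functional_resolvent_holomorphic lin that) auto
  have k': "k holomorphic_on - \<real>\<^sub>\<le>\<^sub>0 - set LS" by (rule holomorphic_on_subset[OF k]) auto
  have eq: "h z * \<ll> (R z w) = h l * \<ll> (R z w) + (k z * \<ll> (R z (shift l w)) + k z * \<ll> w)" if "z \<in> path_image \<gamma>" for z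
  proof -
    have z: "z \<notin> set LS" using that dunford_contourD(4) by auto
    have m: "R z w \<in> W" using z Cons.prems by (intro resolvent_mem)
    have "\<ll> (R z (shift l w)) = (z - l) * \<ll> (R z w) + (- 1) * \<ll> w"
      unfolding resolvent_shift[OF z Cons.prems(1)]
        linear_functional_simps(1)[OF lin scale_mem[OF m] scale_mem[OF Cons.prems(1)]]
        linear_functional_simps(2)[OF lin m] linear_functional_simps(2)[OF lin Cons.prems(1)] ..
    moreover have "k z * (z - l) = h z - h l" by (simp only: k_def divided_difference_mult)
    ultimately show ?thesis by algebra
  qed
  have "contour_integral \<gamma> (\<lambda>z. h z * \<ll> (R z w)) =
      contour_integral \<gamma> (\<lambda>z. h l * \<ll> (R z w) + (k z * \<ll> (R z (shift l w)) + k z * \<ll> w))"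
    by (intro contour_integral_cong) (auto simp: eq)
  also have "\<dots> = contour_integral \<gamma> (\<lambda>z. h l * \<ll> (R z w)) + (contour_integral \<gamma> (\<lambda>z. k z * \<ll> (R z (shift l w))) + contour_integral \<gamma> (\<lambda>z. k z * \<ll> w))"
    using Rw[OF Cons.prems(1)] Rw[OF w'(1)] k'
    by (subst contour_integral_add contour_integral_add; (intro contour_integrable_add dunford_integrable holomorphic_intros)?; simp?)+
  also have "contour_integral \<gamma> (\<lambda>z. h l * \<ll> (R z w)) = h l * (2 * pi * \<i> * \<ll> w)"
    using dunford_integral_one[OF Cons.prems(1-3)] dunford_integrable[OF Rw[OF Cons.prems(1)]]
    by (simp add: contour_integral_lmul)
  also have "contour_integral \<gamma> (\<lambda>z. k z * \<ll> w) = 0"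
    by (intro dunford_holomorphic_zero holomorphic_intros k)
  also have "contour_integral \<gamma> (\<lambda>z. k z * \<ll> (R z (shift l w))) = 2 * pi * \<i> * \<ll> (newton_op ls k (shift l w))"
    using Cons.prems w' k by (intro Cons.IH) auto
  also have "h l * (2 * pi * \<i> * \<ll> w) + (2 * pi * \<i> * \<ll> (newton_op ls k (shift l w)) + 0) =
      2 * pi * \<i> * \<ll> (newton_op (l # ls) h w)"
    using Cons.prems(1) w' newton_op_mem
    by (simp add: linear_functional_simps[OF lin] scale_mem k_def[symmetric] algebra_simps)
  finally show ?case .
qed

text \<open>Multiplicativity of the calculus. The inner function is expanded by Newton's recursion,
  so a single contour takes the place of the customary double integral over two nested ones.\<close>

lemma dunford_product:
  "w \<in> W \<Longrightarrow> shifts ls w = (\<lambda>x. 0) \<Longrightarrow> set ls \<subseteq> set LS \<Longrightarrow> k holomorphic_on - \<real>\<^sub>\<le>\<^sub>0 \<Longrightarrow> h holomorphic_on - \<real>\<^sub>\<le>\<^sub>0 \<Longrightarrow>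
   contour_integral \<gamma> (\<lambda>z. h z * \<ll> (R z (newton_op ls k w))) = contour_integral \<gamma> (\<lambda>z. h z * (k z * \<ll> (R z w)))"
proof (induction ls arbitrary: w k)
  case Nil
  then have "\<ll> (R z w) = 0" if "z \<in> path_image \<gamma>" for z
    using resolvent_eq_res[of z w "[]"] zero_mem dunford_contour_not_spectrum[OF that] linear_functional_simps(3)[OF lin] by auto
  then show ?case using Nil by (intro contour_integral_cong) auto
next
  case (Cons l ls)
  define q where "q = divided_difference k l"
  define u where "u = newton_op ls q (shift l w)"
  have q: "q holomorphic_on - \<real>\<^sub>\<le>\<^sub>0" unfolding q_def
    by (intro divided_difference_holomorphic Cons.prems slit_plane)
  have w': "shift l w \<in> W" "shifts ls (shift l w) = (\<lambda>x. 0)" using Cons.prems by (auto intro: shift_mem)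
  have u: "u \<in> W" unfolding u_def by (intro newton_op_mem w')
  have Rw: "(\<lambda>z. \<ll> (R z v)) holomorphic_on - \<real>\<^sub>\<le>\<^sub>0 - set LS" if "v \<in> W" for v
    by (intro functional_resolvent_holomorphic lin that) auto
  have sub: "f holomorphic_on - \<real>\<^sub>\<le>\<^sub>0 - set LS" if "f holomorphic_on - \<real>\<^sub>\<le>\<^sub>0" for f
    by (rule holomorphic_on_subset[OF that]) auto
  note [holomorphic_intros] = Rw[OF Cons.prems(1)] Rw[OF w'(1)] Rw[OF u] sub[OF q] sub[OF Cons.prems(5)] sub[OF Cons.prems(4)]
  have "contour_integral \<gamma> (\<lambda>z. h z * \<ll> (R z (newton_op (l # ls) k w))) =
      contour_integral \<gamma> (\<lambda>z. h z * (k l * \<ll> (R z w)) + h z * \<ll> (R z u))"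
  proof (intro contour_integral_cong)
    fix z assume "z \<in> path_image \<gamma>"
    then have z: "z \<notin> set LS" using dunford_contourD(4) by auto
    have m: "R z w \<in> W" "R z u \<in> W" using z Cons.prems u by (auto intro: resolvent_mem)
    have "\<ll> (R z (newton_op (l # ls) k w)) = k l * \<ll> (R z w) + \<ll> (R z u)"
      using m z u Cons.prems
      by (simp add: resolvent_add resolvent_scale scale_mem linear_functional_simps[OF lin] flip: q_def u_def)
    then show "h z * \<ll> (R z (newton_op (l # ls) k w)) = h z * (k l * \<ll> (R z w)) + h z * \<ll> (R z u)"
      by (simp add: algebra_simps)
  qed simp
  also have "\<dots> = contour_integral \<gamma> (\<lambda>z. h z * (k l * \<ll> (R z w))) + contour_integral \<gamma> (\<lambda>z. h z * \<ll> (R z u))"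
    by (intro contour_integral_add dunford_integrable holomorphic_intros)
  also have "contour_integral \<gamma> (\<lambda>z. h z * \<ll> (R z u)) = contour_integral \<gamma> (\<lambda>z. h z * (q z * \<ll> (R z (shift l w))))"
    unfolding u_def using Cons.prems w' q by (intro Cons.IH) auto
  also have "\<dots> = contour_integral \<gamma> (\<lambda>z. h z * (k z * \<ll> (R z w)) - h z * (k l * \<ll> (R z w)) - h z * (q z * \<ll> w))"
  proof (intro contour_integral_cong)
    fix z assume "z \<in> path_image \<gamma>"
    then have z: "z \<notin> set LS" using dunford_contourD(4) by auto
    have m: "R z w \<in> W" using z Cons.prems by (auto intro: resolvent_mem)
    have "\<ll> (R z (shift l w)) = (z - l) * \<ll> (R z w) + (- 1) * \<ll> w"
      unfolding resolvent_shift[OF z Cons.prems(1)]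
        linear_functional_simps(1)[OF lin scale_mem[OF m] scale_mem[OF Cons.prems(1)]]
        linear_functional_simps(2)[OF lin m] linear_functional_simps(2)[OF lin Cons.prems(1)] ..
    moreover have "q z * (z - l) = k z - k l" by (simp only: q_def divided_difference_mult)
    ultimately show "h z * (q z * \<ll> (R z (shift l w))) = h z * (k z * \<ll> (R z w)) - h z * (k l * \<ll> (R z w)) - h z * (q z * \<ll> w)"
      by algebra
  qed simp
  also have "\<dots> = contour_integral \<gamma> (\<lambda>z. h z * (k z * \<ll> (R z w))) - contour_integral \<gamma> (\<lambda>z. h z * (k l * \<ll> (R z w))) - contour_integral \<gamma> (\<lambda>z. h z * (q z * \<ll> w))"
    by (subst contour_integral_diff, (intro contour_integrable_diff dunford_integrable holomorphic_intros)+)+ simp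
  also have "contour_integral \<gamma> (\<lambda>z. h z * (q z * \<ll> w)) = 0"
    by (intro dunford_holomorphic_zero holomorphic_intros q Cons.prems)
  finally show ?case by simp
qed

end

end

text \<open>One admissible contour makes the \<open>SOME\<close> in \<open>frac_power\<close> pick
  an admissible one, and for every admissible contour the integral is the same Newton form.\<close>

lemma frac_power_eq_newton_op:
  assumes "dunford_contour W T \<gamma>" "set LS \<subseteq> - \<real>\<^sub>\<le>\<^sub>0" "w \<in> W"
  shows "frac_power W T \<alpha> w = newton_op LS (\<lambda>z. z powr of_real \<alpha>) w"
proof
  fix x
  define \<gamma>' where "\<gamma>' = (SOME \<gamma>. dunford_contour W T \<gamma>)"
  have \<gamma>': "dunford_contour W T \<gamma>'" unfolding \<gamma>'_def by (rule someI[of "dunford_contour W T", OF assms(1)])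
  have "contour_integral \<gamma>' (\<lambda>z. z powr of_real \<alpha> * R z w x) = 2 * pi * \<i> * newton_op LS (\<lambda>z. z powr of_real \<alpha>) w x"
    using assms annihilates
    by (intro dunford_newton_op[OF \<gamma>' linear_functional_eval]) (auto intro!: holomorphic_intros)
  then show "frac_power W T \<alpha> w x = newton_op LS (\<lambda>z. z powr of_real \<alpha>) w x"
    by (simp add: frac_power_def \<gamma>'_def)
qed

text \<open>Off the slit the argument of z^\<alpha> is smaller than \<alpha> pi < pi in modulus, so
  z^\<alpha> is never the negative number -b.\<close>

lemma powr_plus_nonzero:
  fixes \<alpha> b :: real and z :: complex
  assumes "0 < \<alpha>" "\<alpha> < 1" "0 < b" "z \<notin> \<real>\<^sub>\<le>\<^sub>0"
  shows "z powr of_real \<alpha> + of_real b \<noteq> 0"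
proof
  assume eq: "z powr of_real \<alpha> + of_real b = 0"
  have z: "z \<noteq> 0" using assms(4) by auto
  define w where "w = of_real \<alpha> * Ln z"
  have ew: "exp w = - of_real b" using eq z by (simp add: powr_def w_def add_eq_0_iff2)
  have "\<bar>Im (Ln z)\<bar> < pi"
    using z assms(4) Im_Ln_less_pi[of z] mpi_less_Im_Ln[OF z] Im_Ln_le_pi[OF z] Im_Ln_eq_pi[OF z]
    by (auto simp: abs_less_iff complex_nonpos_Reals_iff order_le_less)
  moreover have "\<bar>Im w\<bar> = \<alpha> * \<bar>Im (Ln z)\<bar>" using assms by (simp add: w_def abs_mult)
  moreover have "\<alpha> * \<bar>Im (Ln z)\<bar> \<le> 1 * \<bar>Im (Ln z)\<bar>" using assms by (intro mult_right_mono) auto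
  ultimately have Imw: "\<bar>Im w\<bar> < pi" by simp
  have "exp (Re w) * sin (Im w) = 0" "exp (Re w) * cos (Im w) = - b"
    using arg_cong[OF ew, of Im] arg_cong[OF ew, of Re] by (simp_all add: Im_exp Re_exp)
  then have "sin (Im w) = 0" by simp
  then have "Im w = 0" using Imw sin_gt_zero[of "Im w"] sin_gt_zero[of "- Im w"] by (cases "Im w" "0::real" rule: linorder_cases) auto
  then show False using \<open>exp (Re w) * cos (Im w) = - b\<close> assms(3) exp_gt_zero[of "Re w"] by simp
qed

text \<open>The inverse is h(T) with h(z) = 1 / (z^\<alpha> + b), which is holomorphic in the slit
  plane. Multiplicativity shows that it inverts from both sides; the functionals used for this are
  the point evaluations.\<close>

theorem frac_power_plus_inverse:
  assumes \<alpha>: "0 < \<alpha>" "\<alpha> < 1" and b: "0 < b" and LS: "set LS \<subseteq> - \<real>\<^sub>\<le>\<^sub>0"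
    and \<gamma>: "dunford_contour W T \<gamma>"
  shows "bij_betw (\<lambda>w x. frac_power W T \<alpha> w x + of_real b * w x) W W"
    and "linear_functional \<ll> \<Longrightarrow> f \<in> W \<Longrightarrow>
      contour_integral \<gamma> (\<lambda>z. inverse (z powr of_real \<alpha> + of_real b) * \<ll> (R z f)) =
        2 * pi * \<i> * \<ll> (discrete_solution W T \<alpha> b f)"
    and "f \<in> W \<Longrightarrow> discrete_solution W T \<alpha> b f \<in> W"
proof -
  define k where "k z = z powr complex_of_real \<alpha>" for z
  define h where "h z = inverse (k z + of_real b)" for z
  define B where "B = newton_op LS h"
  define K where "K w = (\<lambda>x. newton_op LS k w x + of_real b * w x)" for w
  have K: "K w = (\<lambda>x. frac_power W T \<alpha> w x + of_real b * w x)" if "w \<in> W" for w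
    using frac_power_eq_newton_op[OF \<gamma> LS that] by (simp add: K_def k_def[abs_def])
  have kh: "k holomorphic_on - \<real>\<^sub>\<le>\<^sub>0" "h holomorphic_on - \<real>\<^sub>\<le>\<^sub>0" "\<And>z. z \<notin> \<real>\<^sub>\<le>\<^sub>0 \<Longrightarrow> h z * (k z + of_real b) = 1"
    unfolding h_def k_def using powr_plus_nonzero[OF \<alpha> b] by (auto intro!: holomorphic_intros)
  have mem: "K w \<in> W" "B w \<in> W" if "w \<in> W" for w
    using that unfolding K_def B_def by (auto intro!: add_mem scale_mem newton_op_mem)
  have nt: "contour_integral \<gamma> (\<lambda>z. g z * \<ll> (R z w)) = 2 * pi * \<i> * \<ll> (newton_op LS g w)"
    if "w \<in> W" "linear_functional \<ll>" "g holomorphic_on - \<real>\<^sub>\<le>\<^sub>0" for g w \<ll>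
    using that annihilates LS by (intro dunford_newton_op[OF \<gamma>]) auto
  have prod: "contour_integral \<gamma> (\<lambda>z. g z * \<ll> (R z (newton_op LS g' w))) = contour_integral \<gamma> (\<lambda>z. g z * (g' z * \<ll> (R z w)))"
    if "w \<in> W" "linear_functional \<ll>" "g holomorphic_on - \<real>\<^sub>\<le>\<^sub>0" "g' holomorphic_on - \<real>\<^sub>\<le>\<^sub>0" for g g' w \<ll>
    using that annihilates by (intro dunford_product[OF \<gamma>]) auto
  have int: "(\<lambda>z. g z * (g' z * \<ll> (R z w))) contour_integrable_on \<gamma>" "(\<lambda>z. g z * \<ll> (R z w)) contour_integrable_on \<gamma>"
    if "w \<in> W" "linear_functional \<ll>" "g holomorphic_on - \<real>\<^sub>\<le>\<^sub>0" "g' holomorphic_on - \<real>\<^sub>\<le>\<^sub>0" for g g' w \<ll>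
    using that by (auto intro!: dunford_integrable[OF \<gamma>] holomorphic_intros functional_resolvent_holomorphic elim: holomorphic_on_subset)
  \<comment> \<open>On the contour h (k + b) = 1, so the two pieces add up to the bare resolvent,
    whose integral returns w.\<close>
  have one: "contour_integral \<gamma> (\<lambda>z. h z * (k z * \<ll> (R z w)) + h z * (of_real b * \<ll> (R z w))) = 2 * pi * \<i> * \<ll> w"
    if "w \<in> W" "linear_functional \<ll>" for w \<ll>
  proof -
    have "contour_integral \<gamma> (\<lambda>z. h z * (k z * \<ll> (R z w)) + h z * (of_real b * \<ll> (R z w))) = contour_integral \<gamma> (\<lambda>z. \<ll> (R z w))"
    proof (intro contour_integral_cong)
      fix z assume "z \<in> path_image \<gamma>"
      then have "h z * (k z + of_real b) = 1" using dunford_contourD(3)[OF \<gamma>] by (intro kh) auto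
      then show "h z * (k z * \<ll> (R z w)) + h z * (of_real b * \<ll> (R z w)) = \<ll> (R z w)"
        by algebra
    qed simp
    also have "\<dots> = 2 * pi * \<i> * \<ll> w"
      using that annihilates by (intro dunford_integral_one[OF \<gamma>, of _ _ LS]) auto
    finally show ?thesis .
  qed
  have BK: "B (K w) = w" if w: "w \<in> W" for w
  proof
    fix x
    define \<ll> :: "('x \<Rightarrow> complex) \<Rightarrow> complex" where "\<ll> u = u x" for u
    have lin: "linear_functional \<ll>" using linear_functional_eval by (simp add: \<ll>_def[abs_def])
    have "2 * pi * \<i> * \<ll> (B (K w)) = contour_integral \<gamma> (\<lambda>z. h z * \<ll> (R z (K w)))"
      unfolding B_def by (rule nt[symmetric]) (use mem w lin kh in auto)
    also have "\<dots> = contour_integral \<gamma> (\<lambda>z. h z * \<ll> (R z (newton_op LS k w)) + h z * (of_real b * \<ll> (R z w)))"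
    proof (intro contour_integral_cong)
      fix z assume "z \<in> path_image \<gamma>"
      then have z: "z \<notin> set LS" by (rule dunford_contour_not_spectrum[OF \<gamma>])
      show "h z * \<ll> (R z (K w)) = h z * \<ll> (R z (newton_op LS k w)) + h z * (of_real b * \<ll> (R z w))"
        unfolding K_def \<ll>_def using z w
        by (simp add: resolvent_add resolvent_scale newton_op_mem scale_mem algebra_simps)
    qed simp
    also have "\<dots> = contour_integral \<gamma> (\<lambda>z. h z * \<ll> (R z (newton_op LS k w))) + contour_integral \<gamma> (\<lambda>z. h z * (of_real b * \<ll> (R z w)))"
      using w lin kh by (intro contour_integral_add int newton_op_mem) (auto intro!: holomorphic_intros)
    also have "\<dots> = contour_integral \<gamma> (\<lambda>z. h z * (k z * \<ll> (R z w))) + contour_integral \<gamma> (\<lambda>z. h z * (of_real b * \<ll> (R z w)))"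
      using prod[OF w lin kh(2,1)] by simp
    also have "\<dots> = contour_integral \<gamma> (\<lambda>z. h z * (k z * \<ll> (R z w)) + h z * (of_real b * \<ll> (R z w)))"
      using w lin kh by (intro contour_integral_add[symmetric] int) (auto intro!: holomorphic_intros)
    also have "\<dots> = 2 * pi * \<i> * \<ll> w" by (rule one[OF w lin])
    finally show "B (K w) x = w x" by (simp add: \<ll>_def)
  qed
  have KB: "K (B w) = w" if w: "w \<in> W" for w
  proof
    fix x
    define \<ll> :: "('x \<Rightarrow> complex) \<Rightarrow> complex" where "\<ll> u = u x" for u
    have lin: "linear_functional \<ll>" using linear_functional_eval by (simp add: \<ll>_def[abs_def])
    have "2 * pi * \<i> * \<ll> (K (B w)) = 2 * pi * \<i> * \<ll> (newton_op LS k (B w)) + of_real b * (2 * pi * \<i> * \<ll> (B w))"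
      by (simp add: K_def \<ll>_def algebra_simps)
    also have "2 * pi * \<i> * \<ll> (newton_op LS k (B w)) = contour_integral \<gamma> (\<lambda>z. k z * \<ll> (R z (newton_op LS h w)))"
      using nt[OF mem(2)[OF w] lin kh(1)] by (simp add: B_def)
    also have "\<dots> = contour_integral \<gamma> (\<lambda>z. k z * (h z * \<ll> (R z w)))" by (rule prod[OF w lin kh(1,2)])
    also have "\<dots> = contour_integral \<gamma> (\<lambda>z. h z * (k z * \<ll> (R z w)))"
      by (intro contour_integral_cong) (simp_all add: mult.left_commute)
    also have "of_real b * (2 * pi * \<i> * \<ll> (B w)) = contour_integral \<gamma> (\<lambda>z. of_real b * (h z * \<ll> (R z w)))"
      using nt[OF w lin kh(2)] int(2)[OF w lin kh(2,2)] by (simp add: B_def contour_integral_lmul)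
    also have "\<dots> = contour_integral \<gamma> (\<lambda>z. h z * (of_real b * \<ll> (R z w)))"
      by (intro contour_integral_cong) (simp_all add: mult.left_commute)
    also have "contour_integral \<gamma> (\<lambda>z. h z * (k z * \<ll> (R z w))) + \<dots> =
        contour_integral \<gamma> (\<lambda>z. h z * (k z * \<ll> (R z w)) + h z * (of_real b * \<ll> (R z w)))"
      using w lin kh by (intro contour_integral_add[symmetric] int) (auto intro!: holomorphic_intros)
    also have "\<dots> = 2 * pi * \<i> * \<ll> w" by (rule one[OF w lin])
    finally show "K (B w) x = w x" by (simp add: \<ll>_def)
  qed
  have "bij_betw K W W" by (rule bij_betw_byWitness[where f' = B]) (use BK KB mem in auto)
  then show bij: "bij_betw (\<lambda>w x. frac_power W T \<alpha> w x + of_real b * w x) W W"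
    using K by (simp cong: bij_betw_cong)
  have sol: "discrete_solution W T \<alpha> b f = B f" if f: "f \<in> W" for f
    unfolding discrete_solution_def
    using bij KB[OF f] mem(2)[OF f] K[OF mem(2)[OF f]] by (intro the_inv_into_f_eq) (auto simp: bij_betw_def)
  show "f \<in> W \<Longrightarrow> discrete_solution W T \<alpha> b f \<in> W" using sol mem by simp
  show "linear_functional \<ll> \<Longrightarrow> f \<in> W \<Longrightarrow>
      contour_integral \<gamma> (\<lambda>z. inverse (z powr of_real \<alpha> + of_real b) * \<ll> (R z f)) =
        2 * pi * \<i> * \<ll> (discrete_solution W T \<alpha> b f)"
    using nt[OF _ _ kh(2), of f \<ll>] by (simp add: sol B_def h_def k_def)
qed

end

section \<open>The Balakrishnan formula\<close>

lemma exp_not_nonpos: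
  assumes "\<bar>Im w\<bar> < pi"
  shows "exp w \<notin> \<real>\<^sub>\<le>\<^sub>0"
proof
  assume "exp w \<in> \<real>\<^sub>\<le>\<^sub>0"
  then have "exp (Re w) * sin (Im w) = 0" "exp (Re w) * cos (Im w) \<le> 0"
    by (auto simp: complex_nonpos_Reals_iff Im_exp Re_exp)
  then have "sin (Im w) = 0" "cos (Im w) \<le> 0" by (auto simp: mult_le_0_iff)
  then have "Im w = 0" using assms sin_gt_zero[of "Im w"] sin_gt_zero[of "- Im w"]
    by (cases "Im w" "0::real" rule: linorder_cases) auto
  then show False using \<open>cos (Im w) \<le> 0\<close> by simp
qed

text \<open>exp is not injective on a strip this wide, but in it the cosine is positive only for
  \<bar>Im w\<bar> < pi/2. The extra room admits the lines Im w = \<plusminus> pi, which exp maps to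
  the two banks of the slit.\<close>

lemma exp_eq_right_half_plane:
  assumes "exp w = l" "0 < Re l" "\<bar>Im w\<bar> < 3 / 2 * pi"
  shows "w = Ln l" "\<bar>Im w\<bar> < pi / 2"
proof -
  have cos: "0 < cos (Im w)" using assms by (auto simp: Re_exp zero_less_mult_iff)
  show half: "\<bar>Im w\<bar> < pi / 2"
  proof (rule ccontr)
    assume "\<not> \<bar>Im w\<bar> < pi / 2"
    then have "0 \<le> sin (\<bar>Im w\<bar> - pi / 2)" using assms(3) by (intro sin_ge_zero) auto
    then show False using cos by (simp add: sin_diff)
  qed
  then show "w = Ln l" using assms(1) pi_gt_zero Ln_exp[of w] by auto
qed

context fun_space_spectral
begin

context
  fixes \<alpha> b :: real
  assumes \<alpha>: "0 < \<alpha>" "\<alpha> < 1" and b: "1 \<le> b" and pos: "\<And>l. l \<in> set LS \<Longrightarrow> 0 < Re l"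
begin

section \<open>The Dunford contour as the image of a rectangle\<close>

definition "rect \<eta> L = rectpath (Complex (- L) (- \<eta>)) (Complex L \<eta>)"

text \<open>A rectangle with at least this half-length has all points \<alpha> Ln l strictly between
  its vertical sides; the added 1 makes this strict.\<close>

definition "log_bound = (\<Sum>l\<in>set LS. \<bar>\<alpha> * ln (cmod l)\<bar>) + 1"

lemma log_bound: "l \<in> set LS \<Longrightarrow> \<bar>Re (of_real \<alpha> * Ln l)\<bar> < log_bound"
proof -
  assume l: "l \<in> set LS"
  then have "l \<noteq> 0" using pos by force
  then have "\<bar>Re (of_real \<alpha> * Ln l)\<bar> = \<bar>\<alpha> * ln (cmod l)\<bar>" by simp
  also have "\<dots> \<le> (\<Sum>l\<in>set LS. \<bar>\<alpha> * ln (cmod l)\<bar>)" using l by (intro member_le_sum) auto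
  finally show ?thesis by (simp add: log_bound_def)
qed

lemma pole_in_rect:
  assumes "l \<in> set LS" "\<alpha> * pi / 2 \<le> \<eta>" "log_bound \<le> L"
  shows "of_real \<alpha> * Ln l \<in> box (Complex (- L) (- \<eta>)) (Complex L \<eta>)"
proof -
  have "l \<noteq> 0" using pos assms by force
  then have "\<bar>Im (Ln l)\<bar> < pi / 2" using pos[OF assms(1)] Re_Ln_pos_lt by blast
  then have "\<alpha> * \<bar>Im (Ln l)\<bar> < \<alpha> * (pi / 2)" using \<alpha> by (intro mult_strict_left_mono)
  moreover have "\<bar>Im (of_real \<alpha> * Ln l)\<bar> = \<alpha> * \<bar>Im (Ln l)\<bar>" "\<alpha> * (pi / 2) = \<alpha> * pi / 2"
    using \<alpha> by (simp_all add: abs_mult)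
  ultimately have "\<bar>Im (of_real \<alpha> * Ln l)\<bar> < \<eta>" using assms(2) by linarith
  then show ?thesis using log_bound[OF assms(1)] assms(3) by (auto simp: in_box_complex_iff)
qed

lemma log_bound_pos: "0 < log_bound"
  unfolding log_bound_def by (intro add_nonneg_pos sum_nonneg) auto

lemma path_image_rect:
  assumes "0 \<le> \<eta>" "0 \<le> L"
  shows "path_image (rect \<eta> L) = {z. \<bar>Re z\<bar> = L \<and> \<bar>Im z\<bar> \<le> \<eta>} \<union> {z. \<bar>Im z\<bar> = \<eta> \<and> \<bar>Re z\<bar> \<le> L}"
  unfolding rect_def using assms by (subst path_image_rectpath) (auto simp: abs_le_iff abs_if split: if_splits)

lemma rect_simps: "valid_path (rect \<eta> L)" "pathfinish (rect \<eta> L) = pathstart (rect \<eta> L)"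
  by (simp_all add: rect_def)

lemma winding_number_rect_outside:
  assumes "0 \<le> \<eta>" "0 \<le> L" "\<eta> < \<bar>Im z\<bar>"
  shows "winding_number (rect \<eta> L) z = 0"
  unfolding rect_def using assms by (intro winding_number_rectpath_outside) (auto simp: in_cbox_complex_iff)

text \<open>The exponential map unrolls the slit plane into a strip.\<close>

lemma dunford_contour_exp_rect:
  assumes L: "log_bound \<le> L"
  shows "dunford_contour W T ((\<lambda>s. exp (s / of_real \<alpha>)) \<circ> rect (3 / 4 * pi * \<alpha>) L)"
proof -
  define g where "g s = exp (s / complex_of_real \<alpha>)" for s
  \<comment> \<open>Chosen between \<alpha> pi / 2, below which all points \<alpha> Ln l lie, and
    \<alpha> pi, where the image would meet the slit.\<close>
  define \<eta> where "\<eta> = 3 / 4 * pi * \<alpha>"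
  define Q where "Q = rect \<eta> L"
  have \<eta>: "0 < \<eta>" "\<eta> < pi * \<alpha>" "\<alpha> * pi / 2 \<le> \<eta>" "\<eta> / \<alpha> = 3 / 4 * pi" using \<alpha> by (auto simp: \<eta>_def)
  have L0: "0 < L" using log_bound_pos L by simp
  have imQ: "path_image Q = {z. \<bar>Re z\<bar> = L \<and> \<bar>Im z\<bar> \<le> \<eta>} \<union> {z. \<bar>Im z\<bar> = \<eta> \<and> \<bar>Re z\<bar> \<le> L}"
    unfolding Q_def using \<eta> L0 by (intro path_image_rect) auto
  have Imd: "\<bar>Im (s / of_real \<alpha>)\<bar> = \<bar>Im s\<bar> / \<alpha>" for s using \<alpha> by (simp add: abs_divide)
  have Qstrip: "path_image Q \<subseteq> {s. \<bar>Im s\<bar> < pi * \<alpha>}" using \<eta> by (auto simp: imQ)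
  have gh: "g holomorphic_on A" for A unfolding g_def using \<alpha> by (intro holomorphic_intros) auto
  have dg: "deriv g s = g s / of_real \<alpha>" for s
    unfolding g_def using \<alpha> by (intro DERIV_imp_deriv) (auto intro!: derivative_eq_intros)
  have g_nonpos: "g s \<notin> \<real>\<^sub>\<le>\<^sub>0" if "s \<in> {s. \<bar>Im s\<bar> < pi * \<alpha>}" for s
    unfolding g_def using that \<alpha> by (intro exp_not_nonpos) (simp add: Imd field_simps)
  have g_eq: "s = of_real \<alpha> * Ln l" "\<bar>Im s\<bar> < \<alpha> * pi / 2" if "g s = l" "l \<in> set LS" "\<bar>Im s\<bar> < pi * \<alpha>" for s l
  proof -
    have "\<bar>Im (s / of_real \<alpha>)\<bar> < pi" unfolding Imd using that \<alpha> by (simp add: field_simps)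
    then have i: "\<bar>Im (s / of_real \<alpha>)\<bar> < 3 / 2 * pi" using pi_gt_zero by linarith
    note Ln = exp_eq_right_half_plane[OF that(1)[unfolded g_def] pos[OF that(2)] i]
    show "s = of_real \<alpha> * Ln l" using Ln(1) \<alpha> by (simp add: field_simps)
    show "\<bar>Im s\<bar> < \<alpha> * pi / 2" using Ln(2) \<alpha> unfolding Imd by (simp add: field_simps)
  qed
  have g_spec: "g s \<notin> set LS" if s: "s \<in> path_image Q" for s
  proof
    assume "g s \<in> set LS"
    then have "s = of_real \<alpha> * Ln (g s)" using g_eq[of s "g s"] s Qstrip by auto
    then have "s \<in> box (Complex (- L) (- \<eta>)) (Complex L \<eta>)"
      using pole_in_rect[OF \<open>g s \<in> set LS\<close> \<eta>(3) L] by simp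
    then show False using s by (auto simp: imQ in_box_complex_iff)
  qed
  have vp: "valid_path (g \<circ> Q)"
    using rect_simps(1) by (intro valid_path_compose_holomorphic[of _ _ UNIV] gh) (auto simp: Q_def)
  have im: "path_image (g \<circ> Q) = g ` path_image Q" by (rule path_image_compose)
  have "winding_number (g \<circ> Q) l = 1" if l: "l \<in> set LS" for l
  proof -
    define s0 where "s0 = of_real \<alpha> * Ln l"
    have l0: "l \<noteq> 0" using pos[OF l] by auto
    have gs0: "g s0 = l" using \<alpha> l0 by (simp add: g_def s0_def)
    define S where "S = {s. \<bar>Im s\<bar> < pi * \<alpha>}"
    have S: "open S" "convex S" unfolding S_def by (rule open_strip, rule convex_strip)
    have box: "s0 \<in> box (Complex (- L) (- \<eta>)) (Complex L \<eta>)"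
      unfolding s0_def by (rule pole_in_rect[OF l \<eta>(3) L])
    then have s0S: "s0 \<in> S" using \<eta> by (auto simp: S_def in_box_complex_iff)
    have "winding_number (g \<circ> Q) l = 1 / (2 * pi * \<i>) * contour_integral (g \<circ> Q) (\<lambda>w. 1 / (w - l))"
      using vp l g_spec by (intro winding_number_valid_path) (auto simp: im)
    also have "contour_integral (g \<circ> Q) (\<lambda>w. 1 / (w - l)) = contour_integral Q (\<lambda>s. deriv g s * (1 / (g s - l)))"
      using rect_simps(1) gh[of UNIV] by (intro contour_integral_comp_analyticW[of _ UNIV]) (auto simp: analytic_on_open Q_def)
    also have "\<dots> = contour_integral Q (\<lambda>s. deriv g s / (g s - l))" by simp
    \<comment> \<open>Argument principle: the logarithmic derivative of g - l has exactly one pole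
      in the strip, and its residue is 1.\<close>
    also have "\<dots> = 2 * pi * \<i> * (\<Sum>p\<in>{s0}. winding_number Q p * residue (\<lambda>s. deriv g s / (g s - l)) p)"
    proof (rule Residue_theorem[OF S(1) convex_connected[OF S(2)]])
      show "(\<lambda>s. deriv g s / (g s - l)) holomorphic_on S - {s0}"
        unfolding dg using g_eq l \<alpha> by (intro holomorphic_intros gh) (auto simp: S_def s0_def)
      show "path_image Q \<subseteq> S - {s0}" using Qstrip g_spec l gs0 by (auto simp: S_def)
      show "\<forall>z. z \<notin> S \<longrightarrow> winding_number Q z = 0"
        unfolding Q_def S_def using \<eta> L0 by (auto intro!: winding_number_rect_outside)
    qed (use rect_simps in \<open>auto simp: Q_def\<close>)
    also have "(\<Sum>p\<in>{s0}. winding_number Q p * residue (\<lambda>s. deriv g s / (g s - l)) p) =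
        winding_number Q s0 * residue (\<lambda>s. deriv g s / (g s - l)) s0" by simp
    also have "winding_number Q s0 = 1" using box unfolding Q_def rect_def by (rule winding_number_rectpath)
    also have "residue (\<lambda>s. deriv g s / (g s - l)) s0 = deriv g s0 / deriv g s0"
    proof (rule residue_simple_pole_deriv[of _ S])
      show "((\<lambda>s. g s - l) has_field_derivative deriv g s0) (at s0)"
        using holomorphic_derivI[OF gh open_UNIV] by (auto intro!: derivative_eq_intros)
      show "deriv g holomorphic_on S" "(\<lambda>s. g s - l) holomorphic_on S"
        unfolding dg[abs_def] using \<alpha> by (auto intro!: holomorphic_intros gh)
    qed (use S s0S gs0 l0 \<alpha> in \<open>auto simp: dg convex_connected\<close>)
    finally show ?thesis using l0 \<alpha> by (simp add: dg gs0 o_def)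
  qed
  moreover have "pathfinish (g \<circ> Q) = pathstart (g \<circ> Q)"
    using rect_simps(2) by (simp add: Q_def pathfinish_compose pathstart_compose)
  moreover have "path_image (g \<circ> Q) \<subseteq> - (\<real>\<^sub>\<le>\<^sub>0 \<union> set LS)"
    using g_spec g_nonpos Qstrip by (auto simp: im)
  ultimately have "dunford_contour W T (g \<circ> Q)"
    using vp unfolding dunford_contour_def spectrum_eq by blast
  then show ?thesis by (simp only: Q_def \<eta>_def g_def[abs_def])
qed

lemma exists_dunford_contour: "\<exists>\<gamma>. dunford_contour W T \<gamma>"
  using dunford_contour_exp_rect by blast

lemma spectrum_slit: "set LS \<subseteq> - \<real>\<^sub>\<le>\<^sub>0"
  using pos by (force simp: complex_nonpos_Reals_iff)

lemmas solution_mem = frac_power_plus_inverse(3)[OF \<alpha> order_less_le_trans[OF zero_less_one b] spectrum_slit]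

section \<open>The integrand on the strip and its jump across the slit\<close>

context
  fixes \<ll> f
  assumes lin: "linear_functional \<ll>" and f: "f \<in> W"
begin

text \<open>The Dunford-Taylor integrand after z = e^{s/\<alpha>}, dz = z ds / \<alpha>, with
  z^\<alpha> written as e^s. In this form it continues analytically across \<bar>Im s\<bar> = pi
  \<alpha>, where the principal power jumps.\<close>

definition "Hint s = \<ll> (R (exp (s / of_real \<alpha>)) f) * exp (s / of_real \<alpha>) / (of_real \<alpha> * (exp s + of_real b))"

text \<open>With t = e^{s/\<alpha>} the functional is applied to t (t + T)^{-1} f = (1 + t^{-1}
  T)^{-1} f, the vector that the sinc sum uses at its nodes.\<close>

definition "resolvent_symbol s = - exp (s / of_real \<alpha>) * \<ll> (R (- exp (s / of_real \<alpha>)) f)"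

text \<open>Below height pi the function e^s + b has no zero; below 3/2 pi \<alpha> the points
  \<alpha> Ln l are the only preimages of the spectrum, which lies in the right half-plane. Both
  heights exceed pi \<alpha>.\<close>

lemma Hint_holomorphic:
  "Hint holomorphic_on {s. \<bar>Im s\<bar> < min pi (3 / 2 * pi * \<alpha>)} - (\<lambda>l. of_real \<alpha> * Ln l) ` set LS"
proof -
  let ?S = "{s. \<bar>Im s\<bar> < min pi (3 / 2 * pi * \<alpha>)} - (\<lambda>l. of_real \<alpha> * Ln l) ` set LS"
  have spec: "exp (s / of_real \<alpha>) \<notin> set LS" if "s \<in> ?S" for s
  proof
    assume l: "exp (s / of_real \<alpha>) \<in> set LS"
    have "\<bar>Im (s / of_real \<alpha>)\<bar> < 3 / 2 * pi" using that \<alpha> by (simp add: abs_divide field_simps)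
    then have "s / of_real \<alpha> = Ln (exp (s / of_real \<alpha>))"
      using exp_eq_right_half_plane(1)[OF refl pos[OF l]] by blast
    then have "s = of_real \<alpha> * Ln (exp (s / of_real \<alpha>))" using \<alpha> by (simp add: field_simps)
    then show False using that l by blast
  qed
  have den: "exp s + of_real b \<noteq> 0" if "s \<in> ?S" for s
  proof
    assume "exp s + of_real b = 0"
    then have "exp s = of_real (- b)" by (simp add: add_eq_0_iff2)
    then have "exp s \<in> \<real>\<^sub>\<le>\<^sub>0" using b by simp
    then show False using exp_not_nonpos[of s] that by simp
  qed
  have "(\<lambda>z. \<ll> (R z f)) holomorphic_on - set LS"
    by (intro functional_resolvent_holomorphic lin f) auto
  then have "((\<lambda>z. \<ll> (R z f)) \<circ> (\<lambda>s. exp (s / of_real \<alpha>))) holomorphic_on ?S"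
    using spec \<alpha> by (intro holomorphic_on_compose_gen[of _ _ _ "- set LS"] holomorphic_intros) auto
  then have "(\<lambda>s. \<ll> (R (exp (s / of_real \<alpha>)) f)) holomorphic_on ?S" by (simp add: o_def)
  then show ?thesis unfolding Hint_def[abs_def] using den \<alpha> by (intro holomorphic_intros) auto
qed

text \<open>Raising the horizontal edges from 3/4 pi \<alpha> to pi \<alpha> crosses no pole, so the
  residue sum stays the same. At the lower height e^s is the principal power and the integral is the
  Dunford-Taylor one.\<close>

lemma contour_integral_Hint:
  assumes L: "log_bound \<le> L"
  shows "contour_integral (rect (pi * \<alpha>) L) Hint = 2 * pi * \<i> * \<ll> (discrete_solution W T \<alpha> b f)"
proof -
  define g where "g s = exp (s / complex_of_real \<alpha>)" for s
  define \<eta> where "\<eta> = 3 / 4 * pi * \<alpha>"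
  have \<eta>: "0 < \<eta>" "\<eta> < pi * \<alpha>" "\<alpha> * pi / 2 \<le> \<eta>" "\<eta> < pi" using \<alpha> pi_gt_zero
    by (auto simp: \<eta>_def intro: order_less_trans[of _ "3/4 * pi"])
  have L0: "0 < L" using log_bound_pos L by simp
  define S where "S = {s. \<bar>Im s\<bar> < min pi (3 / 2 * pi * \<alpha>)}"
  define pts where "pts = (\<lambda>l. of_real \<alpha> * Ln l) ` set LS"
  have S: "open S" "convex S" unfolding S_def by (rule open_strip, rule convex_strip)
  have res: "contour_integral (rect \<zeta> L) Hint = 2 * pi * \<i> * (\<Sum>p\<in>pts. residue Hint p)"
    if \<zeta>: "\<alpha> * pi / 2 \<le> \<zeta>" "\<zeta> < min pi (3 / 2 * pi * \<alpha>)" for \<zeta>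
  proof -
    have \<zeta>0: "0 < \<zeta>" using \<zeta> \<alpha> by (intro less_le_trans[OF _ \<zeta>(1)]) auto
    have in_box: "p \<in> box (Complex (- L) (- \<zeta>)) (Complex L \<zeta>)" if "p \<in> pts" for p
      using that pole_in_rect[OF _ \<zeta>(1) L] by (auto simp: pts_def)
    have "contour_integral (rect \<zeta> L) Hint = 2 * pi * \<i> * (\<Sum>p\<in>pts. winding_number (rect \<zeta> L) p * residue Hint p)"
    proof (rule Residue_theorem[OF S(1) convex_connected[OF S(2)]])
      show "Hint holomorphic_on S - pts" unfolding S_def pts_def by (rule Hint_holomorphic)
      show "path_image (rect \<zeta> L) \<subseteq> S - pts"
        using in_box \<zeta> \<zeta>0 L0 by (subst path_image_rect) (fastforce simp: S_def in_box_complex_iff)+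
      show "\<forall>z. z \<notin> S \<longrightarrow> winding_number (rect \<zeta> L) z = 0"
        unfolding S_def using \<zeta> \<zeta>0 L0 by (auto intro!: winding_number_rect_outside)
    qed (use rect_simps in \<open>auto simp: pts_def\<close>)
    also have "(\<Sum>p\<in>pts. winding_number (rect \<zeta> L) p * residue Hint p) = (\<Sum>p\<in>pts. residue Hint p)"
      using in_box by (intro sum.cong) (auto simp: rect_def winding_number_rectpath)
    finally show ?thesis .
  qed
  have "contour_integral (rect (pi * \<alpha>) L) Hint = contour_integral (rect \<eta> L) Hint"
  proof -
    have "\<alpha> * pi / 2 \<le> pi * \<alpha>" "pi * \<alpha> < pi" "pi * \<alpha> < 3 / 2 * pi * \<alpha>" using \<alpha> by auto
    then show ?thesis using res[of "pi * \<alpha>"] res[of \<eta>] \<eta> by simp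
  qed
  also have "\<dots> = contour_integral (rect \<eta> L) (\<lambda>s. deriv g s * (inverse (g s powr of_real \<alpha> + of_real b) * \<ll> (R (g s) f)))"
  proof (intro contour_integral_cong)
    fix s assume "s \<in> path_image (rect \<eta> L)"
    then have "\<bar>Im s\<bar> \<le> \<eta>" using \<eta> L0 by (subst (asm) path_image_rect) auto
    then have "\<bar>Im (s / of_real \<alpha>)\<bar> < pi" using \<eta> \<alpha> by (simp add: abs_divide field_simps)
    then have "Ln (g s) = s / of_real \<alpha>" unfolding g_def by (intro Ln_exp) linarith+
    then have "g s powr of_real \<alpha> = exp s" using \<alpha> by (simp add: powr_def g_def)
    moreover have "deriv g s = g s / of_real \<alpha>"
      unfolding g_def using \<alpha> by (intro DERIV_imp_deriv) (auto intro!: derivative_eq_intros)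
    ultimately show "Hint s = deriv g s * (inverse (g s powr of_real \<alpha> + of_real b) * \<ll> (R (g s) f))"
      by (simp add: Hint_def g_def divide_inverse ac_simps)
  qed simp
  also have "\<dots> = contour_integral (g \<circ> rect \<eta> L) (\<lambda>z. inverse (z powr of_real \<alpha> + of_real b) * \<ll> (R z f))"
  proof (rule contour_integral_comp_analyticW[symmetric])
    show "g analytic_on UNIV" unfolding g_def using \<alpha> by (subst analytic_on_open) (auto intro!: holomorphic_intros)
  qed (use rect_simps in auto)
  also have "\<dots> = 2 * pi * \<i> * \<ll> (discrete_solution W T \<alpha> b f)"
    unfolding \<eta>_def g_def
    by (rule frac_power_plus_inverse(2)[OF \<alpha> _ spectrum_slit dunford_contour_exp_rect[OF L] lin f]) (use b in simp)
  finally show ?thesis .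
qed

text \<open>On both edges e^{s/\<alpha>} has the same value -t, so the resolvents agree and only 1 /
  (e^s + b) jumps; the product of its two denominators is e^x times
  \<open>kernel_den\<close>.\<close>

lemma Hint_jump:
  "Hint (Complex x (- (pi * \<alpha>))) - Hint (Complex x (pi * \<alpha>)) =
    2 * \<i> * of_real (sin (pi * \<alpha>)) / of_real \<alpha> * (resolvent_symbol (of_real x) / kernel_den \<alpha> b (of_real x))"
proof -
  define e where "e = exp (\<i> * of_real (pi * \<alpha>))"
  define E where "E = exp (complex_of_real x)"
  have e0: "e \<noteq> 0" "E \<noteq> 0" by (simp_all add: e_def E_def)
  have c: "Complex x (- (pi * \<alpha>)) = of_real x - \<i> * of_real (pi * \<alpha>)"
     "Complex x (pi * \<alpha>) = of_real x + \<i> * of_real (pi * \<alpha>)" by (simp_all add: complex_eq_iff)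
  have ex: "exp (Complex x (- (pi * \<alpha>))) = E / e" "exp (Complex x (pi * \<alpha>)) = E * e"
    unfolding c by (simp_all add: exp_diff exp_add e_def E_def)
  define t where "t = exp (complex_of_real x / of_real \<alpha>)"
  have "(of_real x - \<i> * of_real (pi * \<alpha>)) / of_real \<alpha> = of_real x / of_real \<alpha> - \<i> * of_real pi"
    "(of_real x + \<i> * of_real (pi * \<alpha>)) / of_real \<alpha> = of_real x / of_real \<alpha> + \<i> * of_real pi"
    using \<alpha> by (simp_all add: diff_divide_distrib add_divide_distrib)
  then have exa: "exp (Complex x (- (pi * \<alpha>)) / of_real \<alpha>) = - t" "exp (Complex x (pi * \<alpha>) / of_real \<alpha>) = - t"
    unfolding c by (simp_all add: exp_diff exp_add t_def exp_pi_i')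
  have nz: "E / e + of_real b \<noteq> 0" "E * e + of_real b \<noteq> 0"
  proof -
    have pa: "\<bar>pi * \<alpha>\<bar> < pi" using \<alpha> by (simp add: abs_mult)
    have "exp s + of_real b \<noteq> 0" if "\<bar>Im s\<bar> < pi" for s
    proof
      assume "exp s + of_real b = 0"
      then have "exp s = of_real (- b)" by (simp add: add_eq_0_iff2)
      then have "exp s \<in> \<real>\<^sub>\<le>\<^sub>0" using b by simp
      then show False using exp_not_nonpos[of s] that by simp
    qed
    from this[of "Complex x (- (pi * \<alpha>))"] this[of "Complex x (pi * \<alpha>)"]
    show "E / e + of_real b \<noteq> 0" "E * e + of_real b \<noteq> 0" using pa unfolding ex by simp_all
  qed
  have cs: "2 * complex_of_real (cos (pi * \<alpha>)) = e + 1 / e" "2 * \<i> * complex_of_real (sin (pi * \<alpha>)) = e - 1 / e"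
    by (simp_all add: e_def cos_exp_eq sin_exp_eq exp_minus inverse_eq_divide flip: cos_of_real sin_of_real)
  have kd: "kernel_den \<alpha> b (of_real x) = E + of_real b * (e + 1 / e) + (of_real b)\<^sup>2 / E"
    unfolding kernel_den_def cs(1)[symmetric] by (simp add: E_def exp_minus divide_inverse)
  have fac: "E * kernel_den \<alpha> b (of_real x) = (E / e + of_real b) * (E * e + of_real b)"
    unfolding kd using e0 by (simp add: field_simps power2_eq_square)
  then have kd0: "kernel_den \<alpha> b (of_real x) \<noteq> 0" using nz by auto
  have "1 / (E / e + of_real b) - 1 / (E * e + of_real b) = (E * e - E / e) / ((E / e + of_real b) * (E * e + of_real b))"
    using nz by (simp add: diff_frac_eq)
  also have "\<dots> = (E * (e - 1 / e)) / (E * kernel_den \<alpha> b (of_real x))" unfolding fac by (simp add: right_diff_distrib)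
  also have "\<dots> = (e - 1 / e) / kernel_den \<alpha> b (of_real x)" using e0 by simp
  finally have diff: "1 / (E / e + of_real b) - 1 / (E * e + of_real b) = (e - 1 / e) / kernel_den \<alpha> b (of_real x)" .
  define \<rho> where "\<rho> = \<ll> (R (- t) f)"
  have "Hint (Complex x (- (pi * \<alpha>))) - Hint (Complex x (pi * \<alpha>)) =
      (- t * \<rho>) / of_real \<alpha> * (1 / (E / e + of_real b) - 1 / (E * e + of_real b))"
    unfolding Hint_def exa ex \<rho>_def[symmetric] right_diff_distrib by (simp add: ac_simps)
  also have "\<dots> = (e - 1 / e) / of_real \<alpha> * ((- t * \<rho>) / kernel_den \<alpha> b (of_real x))"
    unfolding diff by (simp add: ac_simps)
  finally show ?thesis
    unfolding cs(2) by (simp add: resolvent_symbol_def t_def \<rho>_def)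
qed

text \<open>With z = e^{s/\<alpha>}: on the right z times the resolvent is bounded and the
  denominator grows like e^L; on the left the resolvent is bounded, as 0 is not in the spectrum, and
  z decays like e^{-L/\<alpha>}.\<close>

lemma Hint_sides_tendsto_0:
  "\<exists>\<epsilon>. (\<epsilon> \<longlongrightarrow> 0) at_top \<and> (\<forall>\<^sub>F L in at_top. \<forall>y. cmod (Hint (Complex L y)) \<le> \<epsilon> L \<and> cmod (Hint (Complex (- L) y)) \<le> \<epsilon> L)"
proof -
  obtain C B where C: "0 \<le> C" "1 \<le> B" "\<And>z. B \<le> cmod z \<Longrightarrow> cmod (\<ll> (res LS f z)) \<le> C / cmod z"
    using functional_res_decay[OF lin f, of LS] by blast
  have Rres: "\<ll> (R z f) = \<ll> (res LS f z)" if "z \<notin> set LS" for z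
    using resolvent_eq_res[OF that f, of LS] annihilates f by auto
  have 0: "0 \<notin> set LS" using pos by force
  have "(\<lambda>z. \<ll> (R z f)) holomorphic_on - set LS"
    by (intro functional_resolvent_holomorphic lin f) auto
  moreover have op: "open (- set LS)" by (simp add: open_Compl finite_imp_closed)
  ultimately have "isCont (\<lambda>z. \<ll> (R z f)) 0"
    using 0 by (meson ComplI continuous_on_eq_continuous_at holomorphic_on_imp_continuous_on)
  then obtain r where r: "0 < r" "\<And>z. cmod z < r \<Longrightarrow> cmod (\<ll> (R z f) - \<ll> (R 0 f)) < 1"
    unfolding continuous_at_eps_delta dist_norm by (metis diff_zero zero_less_one)
  define M where "M = cmod (\<ll> (R 0 f)) + 1"
  have M: "cmod (\<ll> (R z f)) \<le> M" if "cmod z < r" for z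
    using r(2)[OF that] norm_triangle_ineq3[of "\<ll> (R z f)" "\<ll> (R 0 f)"] by (simp add: M_def)
  define \<epsilon> where "\<epsilon> L = C / \<alpha> / (exp L - b) + 2 * M / \<alpha> * exp (- L / \<alpha>)" for L
  have M0: "0 \<le> M" by (simp add: M_def)
  obtain Z where Z: "\<And>l. l \<in> set LS \<Longrightarrow> cmod l < Z"
  proof -
    obtain B where "\<forall>p\<in>set LS. cmod p \<le> B" using finite_imp_bounded[of "set LS"] bounded_iff by blast
    then show thesis by (intro that[of "B + 1"]) fastforce
  qed
  have top: "filterlim (\<lambda>L::real. exp (L / \<alpha>)) at_top at_top"
    using \<alpha> by (intro filterlim_compose[OF exp_at_top] filterlim_tendsto_pos_mult_at_top[OF tendsto_const, of "1 / \<alpha>", simplified] filterlim_ident) auto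
  have lim0: "((\<lambda>L. exp (- L / \<alpha>)) \<longlongrightarrow> 0) at_top"
    using tendsto_inverse_0_at_top[OF top] by (simp add: exp_minus)
  have "((\<lambda>L. C / \<alpha> / (exp L - b)) \<longlongrightarrow> 0) at_top"
  proof (rule real_tendsto_divide_at_top[OF tendsto_const])
    show "filterlim (\<lambda>L. exp L - b) at_top at_top"
      using filterlim_tendsto_add_at_top[OF tendsto_const[of "- b"] exp_at_top] by simp
  qed
  then have "(\<epsilon> \<longlongrightarrow> 0 + 2 * M / \<alpha> * 0) at_top"
    unfolding \<epsilon>_def by (intro tendsto_intros lim0)
  moreover have "\<forall>\<^sub>F L in at_top. \<forall>y. cmod (Hint (Complex L y)) \<le> \<epsilon> L \<and> cmod (Hint (Complex (- L) y)) \<le> \<epsilon> L"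
  proof -
    have e1: "\<forall>\<^sub>F L in at_top. max B Z \<le> exp (L / \<alpha>)" using top unfolding filterlim_at_top by blast
    have e2: "\<forall>\<^sub>F L in at_top. b < exp L" using exp_at_top by (simp add: filterlim_at_top_dense)
    have e3: "\<forall>\<^sub>F L in at_top. exp (- L / \<alpha>) < r" using lim0 r(1) by (rule order_tendstoD)
    \<comment> \<open>For L \<ge> ln 2 the term e^{-L} is at most 1/2, so on the left side the
      denominator e^s + b is at least b - 1/2 \<ge> 1/2 in modulus.\<close>
    have e4: "\<forall>\<^sub>F L :: real in at_top. ln 2 \<le> L" by (rule eventually_ge_at_top)
    show ?thesis using e1 e2 e3 e4
    proof eventually_elim
      case (elim L)
      have pos\<epsilon>: "0 \<le> C / \<alpha> / (exp L - b)" "0 \<le> 2 * M / \<alpha> * exp (- L / \<alpha>)"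
        using C elim \<alpha> M0 by auto
      show ?case
      proof (intro allI conjI)
        fix y
        have na: "cmod (exp (Complex x y / of_real \<alpha>)) = exp (x / \<alpha>)" for x by (simp add: norm_exp_eq_Re)
        define z where "z = exp (Complex L y / of_real \<alpha>)"
        have z: "cmod z = exp (L / \<alpha>)" unfolding z_def by (rule na)
        have "z \<notin> set LS" using Z[of z] elim z by auto
        then have "cmod (\<ll> (R z f)) \<le> C / cmod z" using Rres C(3)[of z] elim z by auto
        then have "cmod (\<ll> (R z f)) * cmod z \<le> C" using z by (simp add: pos_le_divide_eq)
        moreover have "exp L - b \<le> cmod (exp (Complex L y) + of_real b)"
          using norm_diff_ineq[of "exp (Complex L y)" "of_real b"] b by (simp add: norm_exp_eq_Re)
        ultimately have "cmod (\<ll> (R z f)) * cmod z / (\<alpha> * cmod (exp (Complex L y) + of_real b)) \<le> C / (\<alpha> * (exp L - b))"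
          using \<alpha> elim C by (intro frac_le mult_left_mono) auto
        then have "cmod (Hint (Complex L y)) \<le> C / (\<alpha> * (exp L - b))"
          using \<alpha> by (simp add: Hint_def norm_mult norm_divide flip: z_def)
        then show "cmod (Hint (Complex L y)) \<le> \<epsilon> L"
          using pos\<epsilon> by (simp add: \<epsilon>_def)
        define w where "w = exp (Complex (- L) y / of_real \<alpha>)"
        have w: "cmod w = exp (- L / \<alpha>)" unfolding w_def by (rule na)
        have "cmod (\<ll> (R w f)) \<le> M" using elim w by (intro M) simp
        moreover have "1 / 2 \<le> cmod (exp (Complex (- L) y) + of_real b)"
        proof -
          have "exp (- L) \<le> exp (- ln 2)" using elim by simp
          then have "exp (- L) \<le> 1 / 2" by (simp add: exp_minus)
          then show ?thesis
            using norm_diff_ineq[of "complex_of_real b" "exp (Complex (- L) y)"] b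
            by (simp add: norm_exp_eq_Re add.commute)
        qed
        ultimately have "cmod (\<ll> (R w f)) * cmod w / (\<alpha> * cmod (exp (Complex (- L) y) + of_real b)) \<le>
            (M * exp (- L / \<alpha>)) / (\<alpha> * (1 / 2))"
          using \<alpha> M0 w by (intro frac_le mult_left_mono mult_mono) auto
        then have "cmod (Hint (Complex (- L) y)) \<le> 2 * M / \<alpha> * exp (- L / \<alpha>)"
        proof -
          have "cmod (Hint (Complex (- L) y)) = cmod (\<ll> (R w f)) * cmod w / (\<alpha> * cmod (exp (Complex (- L) y) + of_real b))"
            using \<alpha> by (simp add: Hint_def norm_mult norm_divide flip: w_def)
          moreover have "(M * exp (- L / \<alpha>)) / (\<alpha> * (1 / 2)) = 2 * M / \<alpha> * exp (- L / \<alpha>)" by simp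
          moreover note \<open>cmod (\<ll> (R w f)) * cmod w / _ \<le> _\<close>
          ultimately show ?thesis by linarith
        qed
        then show "cmod (Hint (Complex (- L) y)) \<le> \<epsilon> L"
          using pos\<epsilon> by (simp add: \<epsilon>_def)
      qed
    qed
  qed
  ultimately show ?thesis by auto
qed

text \<open>The long edges of the rectangle combine through \<open>Hint_jump\<close> and the short
  ones vanish. Dividing 2 pi i by the jump constant 2 i sin (pi \<alpha>) / \<alpha> leaves pi
  \<alpha> / sin (pi \<alpha>).\<close>

theorem balakrishnan_integral:
  "((\<lambda>L. integral {- L..L} (\<lambda>x. resolvent_symbol (of_real x) / kernel_den \<alpha> b (of_real x)))
     \<longlongrightarrow> of_real (pi * \<alpha> / sin (pi * \<alpha>)) * \<ll> (discrete_solution W T \<alpha> b f)) at_top"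
proof -
  define u where "u = \<ll> (discrete_solution W T \<alpha> b f)"
  define c where "c = 2 * \<i> * complex_of_real (sin (pi * \<alpha>)) / of_real \<alpha>"
  define I where "I L = integral {- L..L} (\<lambda>x. resolvent_symbol (of_real x) / kernel_den \<alpha> b (of_real x))" for L
  define side where "side x = contour_integral (linepath (Complex x (- (pi * \<alpha>))) (Complex x (pi * \<alpha>))) Hint" for x
  have sin0: "0 < sin (pi * \<alpha>)" using \<alpha> by (intro sin_gt_zero) auto
  then have c0: "c \<noteq> 0" using \<alpha> by (simp add: c_def)
  obtain \<epsilon> where \<epsilon>: "(\<epsilon> \<longlongrightarrow> 0) at_top" and
    sides: "\<forall>\<^sub>F L in at_top. \<forall>y. cmod (Hint (Complex L y)) \<le> \<epsilon> L \<and> cmod (Hint (Complex (- L) y)) \<le> \<epsilon> L"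
    using Hint_sides_tendsto_0 by blast
  have pa: "0 < pi * \<alpha>" "pi * \<alpha> < pi" "pi * \<alpha> < 3 / 2 * pi * \<alpha>" using \<alpha> by auto
  have eq: "\<forall>\<^sub>F L in at_top. I L = (2 * pi * \<i> * u - side L + side (- L)) / c \<and>
      cmod (side L) \<le> \<epsilon> L * (2 * pi * \<alpha>) \<and> cmod (side (- L)) \<le> \<epsilon> L * (2 * pi * \<alpha>)"
    using sides eventually_ge_at_top[of log_bound]
  proof eventually_elim
    case (elim L)
    have L0: "0 < L" using elim log_bound_pos by simp
    have im: "path_image (rect (pi * \<alpha>) L) \<subseteq> {s. \<bar>Im s\<bar> < min pi (3 / 2 * pi * \<alpha>)} - (\<lambda>l. of_real \<alpha> * Ln l) ` set LS"
    proof -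
      have "p \<notin> path_image (rect (pi * \<alpha>) L)" if "p \<in> box (Complex (- L) (- (pi * \<alpha>))) (Complex L (pi * \<alpha>))" for p
        using that pa L0 by (subst path_image_rect) (auto simp: in_box_complex_iff)
      moreover have "of_real \<alpha> * Ln l \<in> box (Complex (- L) (- (pi * \<alpha>))) (Complex L (pi * \<alpha>))" if "l \<in> set LS" for l
        using that elim(2) \<alpha> by (intro pole_in_rect) auto
      moreover have "\<bar>Im s\<bar> < min pi (3 / 2 * pi * \<alpha>)" if "s \<in> path_image (rect (pi * \<alpha>) L)" for s
      proof -
        have "\<bar>Im s\<bar> \<le> pi * \<alpha>" using that pa L0 by (subst (asm) path_image_rect) auto
        then show ?thesis using pa by linarith
      qed
      ultimately show ?thesis by blast
    qed
    then have cont: "continuous_on (path_image (rect (pi * \<alpha>) L)) Hint"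
      using Hint_holomorphic holomorphic_on_imp_continuous_on continuous_on_subset by blast
    have seg: "closed_segment (Complex (-L) y) (Complex L y) \<subseteq> path_image (rect (pi * \<alpha>) L)" if "\<bar>y\<bar> = pi * \<alpha>" for y
      using that L0 pa by (auto simp: path_image_rect closed_segment_same_Im closed_segment_eq_real_ivl)
    have seg': "closed_segment (Complex x (- (pi * \<alpha>))) (Complex x (pi * \<alpha>)) \<subseteq> path_image (rect (pi * \<alpha>) L)" if "\<bar>x\<bar> = L" for x
      using that L0 pa by (auto simp: path_image_rect closed_segment_same_Re closed_segment_eq_real_ivl)
    define low where "low = contour_integral (linepath (Complex (- L) (- (pi * \<alpha>))) (Complex L (- (pi * \<alpha>)))) Hint"
    define up where "up = contour_integral (linepath (Complex (- L) (pi * \<alpha>)) (Complex L (pi * \<alpha>))) Hint"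
    have "2 * pi * \<i> * u = low + side L - up - side (- L)"
      using contour_integral_rectpath[OF cont[unfolded rect_def]] contour_integral_Hint[OF elim(2)]
      by (simp add: u_def low_def up_def side_def rect_def)
    moreover have "low - up = c * I L"
    proof -
      have "((\<lambda>x. Hint (Complex x (- (pi * \<alpha>)))) has_integral low) {- L..L}"
        "((\<lambda>x. Hint (Complex x (pi * \<alpha>))) has_integral up) {- L..L}"
        unfolding low_def up_def using L0 seg[of "- (pi * \<alpha>)"] seg[of "pi * \<alpha>"] pa cont
        by (auto intro!: contour_integral_linepath_horizontal elim: continuous_on_subset)
      then have "((\<lambda>x. Hint (Complex x (- (pi * \<alpha>))) - Hint (Complex x (pi * \<alpha>))) has_integral low - up) {- L..L}"
        by (rule has_integral_diff)
      then have "((\<lambda>x. c * (resolvent_symbol (of_real x) / kernel_den \<alpha> b (of_real x))) has_integral low - up) {- L..L}"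
        unfolding Hint_jump c_def .
      then have "((\<lambda>x. inverse c * (c * (resolvent_symbol (of_real x) / kernel_den \<alpha> b (of_real x)))) has_integral inverse c * (low - up)) {- L..L}"
        by (rule has_integral_mult_right)
      then have "I L = inverse c * (low - up)" unfolding I_def using c0 by (simp add: integral_unique flip: mult.assoc)
      then show ?thesis using c0 by simp
    qed
    ultimately have "I L = (2 * pi * \<i> * u - side L + side (- L)) / c" using c0 by (simp add: field_simps)
    moreover have "cmod (side x) \<le> \<epsilon> L * (pi * \<alpha> - - (pi * \<alpha>))" if "x = L \<or> x = - L" for x
      unfolding side_def using that elim(1) pa L0 seg'[of x] cont
      by (intro contour_integral_vertical_bound) (auto elim: continuous_on_subset)
    ultimately show ?case by (auto simp: algebra_simps)
  qed
  have lim_side: "(side \<longlongrightarrow> 0) at_top" "((\<lambda>L. side (- L)) \<longlongrightarrow> 0) at_top"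
  proof -
    have "((\<lambda>L. \<epsilon> L * (2 * pi * \<alpha>)) \<longlongrightarrow> 0) at_top" using tendsto_mult_left_zero[OF \<epsilon>] .
    then show "(side \<longlongrightarrow> 0) at_top" "((\<lambda>L. side (- L)) \<longlongrightarrow> 0) at_top"
      using eq by (auto intro: Lim_null_comparison elim: eventually_mono)
  qed
  have "((\<lambda>L. (2 * pi * \<i> * u - side L + side (- L)) / c) \<longlongrightarrow> (2 * pi * \<i> * u - 0 + 0) / c) at_top"
    using c0 by (intro tendsto_intros lim_side)
  then have "(I \<longlongrightarrow> (2 * pi * \<i> * u - 0 + 0) / c) at_top"
    by (rule Lim_transform_eventually) (use eq in \<open>auto elim: eventually_mono\<close>)
  moreover have "(2 * pi * \<i> * u - 0 + 0) / c = of_real (pi * \<alpha> / sin (pi * \<alpha>)) * u"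
    using sin0 \<alpha> by (simp add: c_def field_simps)
  ultimately show ?thesis by (simp add: I_def[abs_def] u_def)
qed

end

end

end

section \<open>Sectorial operators\<close>

text \<open>Rotate by the largest angle \<phi> \<le> Im \<sigma> that keeps the sector in the right
  half-plane. Then \<zeta> can only increase the real part, to which e^\<sigma> contributes e^{Re
  \<sigma>} cos (Im \<sigma> - \<phi>).\<close>

lemma sector_distance_aux:
  fixes \<beta> :: real
  assumes \<beta>: "0 \<le> \<beta>" and \<zeta>: "\<bar>Im \<zeta>\<bar> \<le> \<beta> * Re \<zeta>" "0 \<le> Re \<zeta>" and \<theta>: "0 \<le> Im \<sigma>" "Im \<sigma> < pi - arctan \<beta>"
  shows "exp (Re \<sigma>) * sin (min (pi - arctan \<beta> - Im \<sigma>) (pi / 2)) \<le> cmod (exp \<sigma> + \<zeta>)"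
proof -
  define \<omega> where "\<omega> = arctan \<beta>"
  define \<phi> where "\<phi> = min (Im \<sigma>) (pi / 2 - \<omega>)"
  have \<omega>: "0 \<le> \<omega>" "\<omega> < pi / 2" using \<beta> arctan_ubound[of \<beta>] by (auto simp: \<omega>_def)
  have \<phi>: "0 \<le> \<phi>" "\<phi> + \<omega> \<le> pi / 2" using \<omega> \<theta> unfolding \<phi>_def by linarith+
  have cos\<omega>: "0 < cos \<omega>" using \<omega> by (intro cos_gt_zero_pi) auto
  have sin\<omega>: "sin \<omega> = \<beta> * cos \<omega>" using cos\<omega> tan_arctan[of \<beta>] by (simp add: \<omega>_def tan_def field_simps)
  have "0 \<le> cos (\<phi> + \<omega>)" using \<phi> \<omega> by (intro cos_ge_zero) linarith+
  then have "0 \<le> (cos \<phi> - \<beta> * sin \<phi>) * cos \<omega>" by (simp add: cos_add sin\<omega> algebra_simps)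
  then have c: "0 \<le> cos \<phi> - \<beta> * sin \<phi>" using cos\<omega> by (simp add: zero_le_mult_iff)
  have s: "0 \<le> sin \<phi>" using \<phi> \<omega> by (intro sin_ge_zero) linarith+
  have "- (sin \<phi> * (\<beta> * Re \<zeta>)) \<le> sin \<phi> * Im \<zeta>"
    using mult_left_mono[of "- (\<beta> * Re \<zeta>)" "Im \<zeta>" "sin \<phi>"] \<zeta>(1) s by (simp add: abs_le_iff)
  moreover have "0 \<le> (cos \<phi> - \<beta> * sin \<phi>) * Re \<zeta>" using c \<zeta> by simp
  ultimately have r: "0 \<le> cos \<phi> * Re \<zeta> + sin \<phi> * Im \<zeta>" by (simp add: algebra_simps)
  have "cos (Im \<sigma> - \<phi>) = cos \<phi> * cos (Im \<sigma>) + sin \<phi> * sin (Im \<sigma>)" by (simp add: cos_diff)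
  then have "exp (Re \<sigma>) * cos (Im \<sigma> - \<phi>) \<le> Re (exp (- (\<i> * of_real \<phi>)) * (exp \<sigma> + \<zeta>))"
    using r by (simp add: Re_exp Im_exp algebra_simps)
  also have "\<dots> \<le> cmod (exp (- (\<i> * of_real \<phi>)) * (exp \<sigma> + \<zeta>))" by (rule complex_Re_le_cmod)
  also have "\<dots> = cmod (exp \<sigma> + \<zeta>)" by (simp add: norm_mult norm_exp_eq_Re)
  finally have le: "exp (Re \<sigma>) * cos (Im \<sigma> - \<phi>) \<le> cmod (exp \<sigma> + \<zeta>)" .
  \<comment> \<open>Beyond pi/2 - \<omega> the admissible rotation is exhausted, and the cosine
    becomes sin (pi - \<omega> - Im \<sigma>).\<close>
  have "sin (min (pi - \<omega> - Im \<sigma>) (pi / 2)) \<le> cos (Im \<sigma> - \<phi>)"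
  proof (cases "Im \<sigma> \<le> pi / 2 - \<omega>")
    case True
    then show ?thesis by (simp add: \<phi>_def)
  next
    case False
    then have "min (pi - \<omega> - Im \<sigma>) (pi / 2) = pi / 2 - (Im \<sigma> - \<phi>)" by (simp add: \<phi>_def min_def)
    then show ?thesis by (simp only: sin_cos_eq) simp
  qed
  then show ?thesis using le mult_left_mono[of _ _ "exp (Re \<sigma>)"] unfolding \<omega>_def[symmetric]
    by (meson exp_ge_zero order_trans)
qed

lemma sector_distance:
  fixes \<beta> :: real
  assumes \<beta>: "0 \<le> \<beta>" and \<zeta>: "\<bar>Im \<zeta>\<bar> \<le> \<beta> * Re \<zeta>" "0 \<le> Re \<zeta>" and \<theta>: "\<bar>Im \<sigma>\<bar> < pi - arctan \<beta>"
  shows "exp (Re \<sigma>) * sin (min (pi - arctan \<beta> - \<bar>Im \<sigma>\<bar>) (pi / 2)) \<le> cmod (exp \<sigma> + \<zeta>)"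
proof (cases "0 \<le> Im \<sigma>")
  case True
  then show ?thesis using sector_distance_aux[OF assms(1-3)] \<theta> by simp
next
  case False
  have "exp (Re (cnj \<sigma>)) * sin (min (pi - arctan \<beta> - Im (cnj \<sigma>)) (pi / 2)) \<le> cmod (exp (cnj \<sigma>) + cnj \<zeta>)"
    using assms False by (intro sector_distance_aux) auto
  also have "exp (cnj \<sigma>) + cnj \<zeta> = cnj (exp \<sigma> + \<zeta>)" by (simp add: exp_cnj)
  also have "cmod (cnj (exp \<sigma> + \<zeta>)) = cmod (exp \<sigma> + \<zeta>)" by (rule complex_mod_cnj)
  finally show ?thesis using False by simp
qed

text \<open>All that the estimate may know of the mesh: a coercivity constant and a sector. Finite
  dimension enters qualitatively, as the existence of an annihilating list.\<close>

locale sectorial_operator = fun_space_operator W T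
  for W :: "('x \<Rightarrow> complex) set" and T +
  fixes ip :: "('x \<Rightarrow> complex) \<Rightarrow> ('x \<Rightarrow> complex) \<Rightarrow> complex" and c0 \<beta> :: real
  assumes ip_add: "\<And>u v w. u \<in> W \<Longrightarrow> v \<in> W \<Longrightarrow> w \<in> W \<Longrightarrow> ip (\<lambda>x. u x + v x) w = ip u w + ip v w"
    and ip_scale: "\<And>c u w. u \<in> W \<Longrightarrow> w \<in> W \<Longrightarrow> ip (\<lambda>x. c * u x) w = c * ip u w"
    and ip_cnj: "\<And>u w. u \<in> W \<Longrightarrow> w \<in> W \<Longrightarrow> ip u w = cnj (ip w u)"
    and ip_nonneg: "\<And>u. u \<in> W \<Longrightarrow> 0 \<le> Re (ip u u)"
    and ip_definite: "\<And>u. u \<in> W \<Longrightarrow> ip u u = 0 \<Longrightarrow> u = (\<lambda>x. 0)"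
    and c0: "0 < c0" and \<beta>: "0 \<le> \<beta>"
    and coercive: "\<And>u. u \<in> W \<Longrightarrow> c0 * Re (ip u u) \<le> Re (ip (T u) u)"
    and sector: "\<And>u. u \<in> W \<Longrightarrow> \<bar>Im (ip (T u) u)\<bar> \<le> \<beta> * Re (ip (T u) u)"
    and finite_dim: "\<exists>ls. \<forall>w\<in>W. shifts ls w = (\<lambda>x. 0)"
begin

definition "nrm u = sqrt (Re (ip u u))"

lemma ip_self: "u \<in> W \<Longrightarrow> ip u u = of_real ((nrm u)\<^sup>2)"
  using ip_cnj[of u u] ip_nonneg[of u] by (simp add: nrm_def complex_eq_iff)

lemma nrm_nonneg: "u \<in> W \<Longrightarrow> 0 \<le> nrm u" using ip_nonneg by (simp add: nrm_def)

lemma ip_add_right: "u \<in> W \<Longrightarrow> v \<in> W \<Longrightarrow> w \<in> W \<Longrightarrow> ip w (\<lambda>x. u x + v x) = ip w u + ip w v"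
  using ip_cnj[of w "\<lambda>x. u x + v x"] ip_cnj[of w u] ip_cnj[of w v] by (simp add: ip_add add_mem)

lemma ip_scale_right: "u \<in> W \<Longrightarrow> w \<in> W \<Longrightarrow> ip w (\<lambda>x. c * u x) = cnj c * ip w u"
  using ip_cnj[of w "\<lambda>x. c * u x"] ip_cnj[of w u] by (simp add: ip_scale scale_mem)

lemma cauchy_schwarz:
  assumes u: "u \<in> W" and v: "v \<in> W"
  shows "cmod (ip u v) \<le> nrm u * nrm v"
proof (cases "nrm v = 0")
  case True
  then have "v = (\<lambda>x. 0)" using v ip_self ip_definite by simp
  then have "ip u v = 0" using ip_scale_right[OF zero_mem u, of 0] by simp
  then show ?thesis using True by simp
next
  case False
  then have nv: "0 < nrm v" using nrm_nonneg[OF v] by simp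
  \<comment> \<open>The coefficient that minimises the norm of u + c v.\<close>
  define c where "c = - ip u v / of_real ((nrm v)\<^sup>2)"
  define w where "w = (\<lambda>x. u x + c * v x)"
  have cv: "(\<lambda>x. c * v x) \<in> W" using v by (rule scale_mem)
  have w: "w \<in> W" unfolding w_def using u cv by (rule add_mem)
  have vu: "ip v u = cnj (ip u v)" using v u by (rule ip_cnj)
  have "ip w w = ip u u + cnj c * ip u v + c * (ip v u + cnj c * ip v v)"
    unfolding w_def using u v cv w[unfolded w_def]
    by (simp add: ip_add ip_add_right ip_scale ip_scale_right add_mem algebra_simps)
  also have "ip v u + cnj c * ip v v = 0"
    using nv unfolding vu ip_self[OF v] c_def by (simp add: field_simps)
  finally have "ip w w = of_real ((nrm u)\<^sup>2) - cnj (ip u v) * ip u v / of_real ((nrm v)\<^sup>2)"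
    unfolding ip_self[OF u] c_def by simp
  also have "cnj (ip u v) * ip u v = of_real ((cmod (ip u v))\<^sup>2)"
    by (metis complex_norm_square mult.commute)
  finally have "Re (ip w w) = (nrm u)\<^sup>2 - (cmod (ip u v))\<^sup>2 / (nrm v)\<^sup>2"
    by (simp flip: of_real_divide of_real_diff of_real_power)
  then have "Re (ip w w) * (nrm v)\<^sup>2 = (nrm u)\<^sup>2 * (nrm v)\<^sup>2 - (cmod (ip u v))\<^sup>2"
    using nv by (simp add: field_simps)
  moreover have "0 \<le> Re (ip w w) * (nrm v)\<^sup>2" using ip_nonneg[OF w] by simp
  ultimately have "(cmod (ip u v))\<^sup>2 \<le> (nrm u * nrm v)\<^sup>2"
    by (simp add: power_mult_distrib)
  then show ?thesis using nrm_nonneg u v by (meson mult_nonneg_nonneg power2_le_imp_le)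
qed

text \<open>The Rayleigh quotient \<zeta> of w lies in the truncated sector, and pairing z w - T w
  with w gives (z - \<zeta>) ||w||^2. For a T that need not be normal, the distance to the sector
  thus takes the place of the distance to the spectrum.\<close>

lemma numerical_range_bound:
  assumes w: "w \<in> W" and \<delta>: "0 < \<delta>"
    and dist: "\<And>\<zeta>. c0 \<le> Re \<zeta> \<Longrightarrow> \<bar>Im \<zeta>\<bar> \<le> \<beta> * Re \<zeta> \<Longrightarrow> \<delta> \<le> cmod (z - \<zeta>)"
  shows "nrm w \<le> nrm (\<lambda>x. z * w x - T w x) / \<delta>"
proof (cases "nrm w = 0")
  case True
  have "(\<lambda>x. z * w x - T w x) \<in> W"
    using add_mem[OF scale_mem[OF w, of z] scale_mem[OF op_mem[OF w], of "-1"]] by simp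
  then show ?thesis using True nrm_nonneg \<delta> by simp
next
  case False
  then have nw: "0 < nrm w" using nrm_nonneg[OF w] by simp
  define g where "g = (\<lambda>x. z * w x + (- 1) * T w x)"
  have g: "g \<in> W" unfolding g_def using w by (intro add_mem scale_mem op_mem)
  define \<zeta> where "\<zeta> = ip (T w) w / of_real ((nrm w)\<^sup>2)"
  have \<zeta>: "ip (T w) w = \<zeta> * of_real ((nrm w)\<^sup>2)" using nw by (simp add: \<zeta>_def)
  have n2: "Re (ip w w) = (nrm w)\<^sup>2" using ip_self[OF w] by simp
  have "c0 * (nrm w)\<^sup>2 \<le> Re \<zeta> * (nrm w)\<^sup>2" using coercive[OF w] unfolding \<zeta> n2 by simp
  then have "c0 \<le> Re \<zeta>" using nw by simp
  moreover have "\<bar>Im \<zeta>\<bar> * (nrm w)\<^sup>2 \<le> (\<beta> * Re \<zeta>) * (nrm w)\<^sup>2" using sector[OF w] unfolding \<zeta> by (simp add: abs_mult)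
  then have "\<bar>Im \<zeta>\<bar> \<le> \<beta> * Re \<zeta>" using nw by simp
  ultimately have \<delta>: "\<delta> \<le> cmod (z - \<zeta>)" by (rule dist)
  have "ip g w = z * ip w w + (- 1) * ip (T w) w"
    unfolding g_def ip_add[OF scale_mem[OF w] scale_mem[OF op_mem[OF w]] w] ip_scale[OF w w] ip_scale[OF op_mem[OF w] w] ..
  also have "\<dots> = (z - \<zeta>) * of_real ((nrm w)\<^sup>2)" unfolding \<zeta> ip_self[OF w] by (simp add: algebra_simps)
  finally have "cmod (z - \<zeta>) * (nrm w)\<^sup>2 = cmod (ip g w)" by (simp add: norm_mult norm_power)
  also have "\<dots> \<le> nrm g * nrm w" using g w by (rule cauchy_schwarz)
  finally have "cmod (z - \<zeta>) * nrm w \<le> nrm g" using nw by (simp add: power2_eq_square)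
  then have "\<delta> * nrm w \<le> nrm g" using \<delta> nw by (meson mult_right_mono nrm_nonneg order_trans w)
  then show ?thesis using \<open>0 < \<delta>\<close> by (simp add: field_simps g_def)
qed

text \<open>M and N are such that both truncation errors match the discretisation error \<epsilon>
  up to the common factor 1/b; the square root in the exponent is then exactly 2 pi min(\<kappa>1,
  \<kappa>2) / \<tau>.\<close>

theorem sinc_approx_error:
  fixes \<alpha> b \<tau> :: real and M N :: nat
  defines "\<kappa>1 \<equiv> \<alpha> * (pi - arctan \<beta>)" and "\<kappa>2 \<equiv> (1 - \<alpha>) * pi"
  assumes \<alpha>: "0 < \<alpha>" "\<alpha> < 1" and b: "1 \<le> b" and f: "f \<in> W"
    and \<tau>: "0 < \<tau>" "\<tau> < pi - arctan \<beta>"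
    and M: "real M = max (\<alpha> / (\<alpha> + 1) * (2 * pi * min \<kappa>1 \<kappa>2 / \<tau>\<^sup>2 - ln b / \<tau>)) 0" "M > 0"
    and N: "real N = 2 * pi * min \<kappa>1 \<kappa>2 / \<tau>\<^sup>2 + ln b / \<tau>"
  shows "(\<lambda>x. discrete_solution W T \<alpha> b f x - sinc_approx W T \<alpha> b \<tau> M N f x) \<in> W"
    and "nrm (\<lambda>x. discrete_solution W T \<alpha> b f x - sinc_approx W T \<alpha> b \<tau> M N f x) \<le>
      sin (pi * \<alpha>) / (pi * \<alpha>) * quad_const \<alpha> c0 * tau_factor \<alpha> \<kappa>1 \<kappa>2 \<tau> / b *
      exp (- sqrt (pi * min \<kappa>1 \<kappa>2 * ((1 + 1 / \<alpha>) * real M + real N))) * nrm f"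
proof -
  define \<omega> where "\<omega> = arctan \<beta>"
  have \<omega>: "0 \<le> \<omega>" "\<omega> < pi / 2" using \<beta> arctan_ubound[of \<beta>] by (auto simp: \<omega>_def)
  obtain LS where LS: "\<forall>w\<in>W. shifts LS w = (\<lambda>x. 0)"
    "\<forall>l\<in>set LS. \<exists>u\<in>W. u \<noteq> (\<lambda>x. 0) \<and> T u = (\<lambda>x. l * u x)"
    using spectral_list_exists[OF finite_dim] by blast
  interpret fun_space_spectral W T LS
    using LS by unfold_locales auto
  \<comment> \<open>Eigenvalues are the Rayleigh quotients of their eigenvectors, so they inherit
    the truncated sector.\<close>
  have eig: "c0 \<le> Re l" "\<bar>Im l\<bar> \<le> \<beta> * Re l" if l: "l \<in> set LS" for l
  proof -
    obtain u where u: "u \<in> W" "u \<noteq> (\<lambda>x. 0)" "T u = (\<lambda>x. l * u x)" using LS(2) l by blast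
    have "nrm u \<noteq> 0" using ip_definite[OF u(1)] ip_self[OF u(1)] u(2) by auto
    then have nu: "0 < (nrm u)\<^sup>2" by simp
    have T: "ip (T u) u = l * of_real ((nrm u)\<^sup>2)" using u by (simp add: ip_scale ip_self)
    have n2: "Re (ip u u) = (nrm u)\<^sup>2" using ip_self[OF u(1)] by simp
    have "c0 * (nrm u)\<^sup>2 \<le> Re l * (nrm u)\<^sup>2" using coercive[OF u(1)] unfolding T n2 by simp
    then show "c0 \<le> Re l" using nu by (simp only: mult_le_cancel_right_pos)
    have "\<bar>Im l\<bar> * (nrm u)\<^sup>2 \<le> (\<beta> * Re l) * (nrm u)\<^sup>2" using sector[OF u(1)] unfolding T by (simp add: abs_mult)
    then show "\<bar>Im l\<bar> \<le> \<beta> * Re l" using nu by (simp only: mult_le_cancel_right_pos)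
  qed
  have pos: "0 < Re l" if "l \<in> set LS" for l using eig(1)[OF that] c0 by linarith
  define \<sigma> where "\<sigma> s = s / complex_of_real \<alpha>" for s
  define \<epsilon> where "\<epsilon> = exp (- (2 * pi * min \<kappa>1 \<kappa>2 / \<tau>))"
  define sn where "sn s = sin (min ((\<kappa>1 - \<bar>Im s\<bar>) / \<alpha>) (pi / 2))" for s
  \<comment> \<open>Division by \<alpha> maps the strip of half-width \<open>\<kappa>1\<close> to
    \<bar>Im \<sigma>\<bar> < pi - arctan \<beta>, where -e^\<sigma> stays outside the
    sector.\<close>
  have dist: "exp (Re (\<sigma> s)) * sn s \<le> cmod (- exp (\<sigma> s) - \<zeta>)" "0 < sn s"
    if "\<bar>Im s\<bar> < \<kappa>1" "0 \<le> Re \<zeta>" "\<bar>Im \<zeta>\<bar> \<le> \<beta> * Re \<zeta>" for s \<zeta>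
  proof -
    have im: "\<bar>Im (\<sigma> s)\<bar> = \<bar>Im s\<bar> / \<alpha>" using \<alpha> by (simp add: \<sigma>_def abs_divide)
    have k: "(\<kappa>1 - \<bar>Im s\<bar>) / \<alpha> = pi - arctan \<beta> - \<bar>Im (\<sigma> s)\<bar>"
      using \<alpha> by (simp add: im \<kappa>1_def diff_divide_distrib)
    have lt: "\<bar>Im (\<sigma> s)\<bar> < pi - arctan \<beta>" using that(1) \<alpha> by (simp add: im \<kappa>1_def field_simps)
    have "cmod (- exp (\<sigma> s) - \<zeta>) = cmod (exp (\<sigma> s) + \<zeta>)"
      by (metis minus_add_distrib norm_minus_cancel uminus_add_conv_diff add.commute)
    then show "exp (Re (\<sigma> s)) * sn s \<le> cmod (- exp (\<sigma> s) - \<zeta>)"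
      unfolding sn_def k using sector_distance[OF \<beta> that(3,2) lt] by simp
    have "0 < (\<kappa>1 - \<bar>Im s\<bar>) / \<alpha>" using that(1) \<alpha> by simp
    then show "0 < sn s" unfolding sn_def by (rule sin_min_half_le(2))
  qed
  have sn_pos: "0 < sn s" if "\<bar>Im s\<bar> < \<kappa>1" for s using dist(2)[OF that, of 0] by simp
  have spec: "- exp (\<sigma> s) \<notin> set LS" if s: "\<bar>Im s\<bar> < \<kappa>1" for s
  proof
    assume l: "- exp (\<sigma> s) \<in> set LS"
    then have "exp (Re (\<sigma> s)) * sn s \<le> 0"
      using dist(1)[OF s less_imp_le[OF pos[OF l]] eig(2)[OF l]] by simp
    moreover have "0 < exp (Re (\<sigma> s)) * sn s" using sn_pos[OF s] by simp
    ultimately show False by linarith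
  qed
  have \<kappa>1: "0 < \<kappa>1" using \<alpha> \<omega> by (simp add: \<kappa>1_def flip: \<omega>_def)
  have bound: "nrm (R (- exp (\<sigma> s)) f) \<le> nrm f / (exp (Re (\<sigma> s)) * sn s)" if s: "\<bar>Im s\<bar> < \<kappa>1" for s
  proof -
    have "nrm (R (- exp (\<sigma> s)) f) \<le>
        nrm (\<lambda>x. - exp (\<sigma> s) * R (- exp (\<sigma> s)) f x - T (R (- exp (\<sigma> s)) f) x) / (exp (Re (\<sigma> s)) * sn s)"
      using dist(1)[OF s] sn_pos[OF s] c0
      by (intro numerical_range_bound resolvent_mem spec[OF s] f) auto
    then show ?thesis using resolvent_inverse[OF spec[OF s] f] by simp
  qed
  \<comment> \<open>For real y the point -t is negative, so coercivity alone keeps it at distance at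
    least \<open>c0\<close> from the numerical range. This bound survives t tending to 0 and
    produces the faster decay of the left tail.\<close>
  have bound_real: "nrm (R (- exp (\<sigma> (of_real y))) f) \<le> nrm f / c0" for y
  proof -
    have s: "\<bar>Im (complex_of_real y)\<bar> < \<kappa>1" using \<kappa>1 by simp
    define t where "t = exp (\<sigma> (of_real y))"
    have t: "t = of_real (exp (y / \<alpha>))" by (simp add: t_def \<sigma>_def exp_of_real flip: of_real_divide)
    have "c0 \<le> cmod (- t - \<zeta>)" if "c0 \<le> Re \<zeta>" for \<zeta>
    proof -
      have "Re (- t - \<zeta>) = - exp (y / \<alpha>) - Re \<zeta>" by (simp add: t)
      then have "c0 \<le> \<bar>Re (- t - \<zeta>)\<bar>" using that c0 exp_gt_zero[of "y / \<alpha>"] by linarith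
      then show ?thesis using abs_Re_le_cmod order_trans by blast
    qed
    then have "nrm (R (- t) f) \<le> nrm (\<lambda>x. - t * R (- t) f x - T (R (- t) f) x) / c0"
      using c0 spec[OF s] by (intro numerical_range_bound resolvent_mem f) (auto simp: t_def)
    then show ?thesis using resolvent_inverse[OF spec[OF s] f] by (simp add: t_def)
  qed
  define w where "w n = (\<lambda>x. - exp (\<sigma> (of_real (of_int n * \<tau>))) * R (- exp (\<sigma> (of_real (of_int n * \<tau>)))) f x)" for n :: int
  have w_mem: "w n \<in> W" for n
    unfolding w_def using \<kappa>1 by (intro scale_mem resolvent_mem spec f) simp
  \<comment> \<open>With q = 1/t, (1 + q T)^{-1} = -t (-t - T)^{-1}: the terms of the sinc sum are
    values of the resolvent symbol.\<close>
  have w_eq: "the_inv_into W (\<lambda>w y. w y + of_real (exp (- of_int n * \<tau> / \<alpha>)) * T w y) f = w n" for n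
  proof -
    define t where "t = exp (\<sigma> (of_real (of_int n * \<tau>)))"
    define q where "q = complex_of_real (exp (- of_int n * \<tau> / \<alpha>))"
    have tq: "t * q = 1"
    proof -
      have "t = of_real (exp (of_int n * \<tau> / \<alpha>))" by (simp add: t_def \<sigma>_def exp_of_real flip: of_real_divide of_real_mult)
      then have "t * q = of_real (exp (of_int n * \<tau> / \<alpha>) * exp (- of_int n * \<tau> / \<alpha>))" by (simp add: q_def)
      also have "\<dots> = 1" unfolding mult_exp_exp by simp
      finally show ?thesis .
    qed
    have ts: "- t \<notin> set LS" unfolding t_def using \<kappa>1 by (intro spec) simp
    have "inj_on (\<lambda>w y. w y + q * T w y) W"
    proof (rule inj_onI)
      fix u v assume uv: "u \<in> W" "v \<in> W" "(\<lambda>y. u y + q * T u y) = (\<lambda>y. v y + q * T v y)"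
      have "- t * u x - T u x = - t * v x - T v x" for x
      proof -
        have "t * (u x + q * T u x) = t * (v x + q * T v x)" using fun_cong[OF uv(3), of x] by simp
        then have "t * u x + (t * q) * T u x = t * v x + (t * q) * T v x" by (simp add: algebra_simps)
        then show ?thesis unfolding tq by (simp add: algebra_simps)
      qed
      then show "u = v" using inj_onD[OF resolvent_inj[OF ts] _ uv(1,2)] by presburger
    qed
    moreover have "(\<lambda>y. w n y + q * T (w n) y) = f"
    proof
      fix y
      have "T (w n) y = - t * T (R (- t) f) y"
        unfolding w_def t_def[symmetric] op_scale[OF resolvent_mem[OF ts f]] ..
      then have "w n y + q * T (w n) y = - t * R (- t) f y - (t * q) * T (R (- t) f) y"
        by (simp add: w_def t_def)
      then show "w n y + q * T (w n) y = f y" unfolding tq using resolvent_inverse[OF ts f, of y] by simp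
    qed
    ultimately show ?thesis unfolding q_def[symmetric] by (intro the_inv_into_f_eq w_mem)
  qed
  define D where "D n = kernel_den \<alpha> b (of_real (of_int n * \<tau>))" for n :: int
  have D: "D n = of_real (exp (of_int n * \<tau>) + 2 * b * cos (pi * \<alpha>) + b\<^sup>2 * exp (- of_int n * \<tau>))" for n
    using exp_of_real[of "of_int n * \<tau>", where ?'a = complex] exp_of_real[of "- (of_int n * \<tau>)", where ?'a = complex]
    by (simp add: D_def kernel_den_def)
  define S where "S = sin (pi * \<alpha>) / (pi * \<alpha>)"
  define U where "U = sinc_approx W T \<alpha> b \<tau> M N f"
  have U: "U = (\<lambda>x. of_real (S * \<tau>) * (\<Sum>n\<in>{- int M..int N}. inverse (D n) * w n x))"
  proof
    fix x
    have "U x = of_real (sin (pi * \<alpha>) / (\<alpha> * pi) * \<tau>) * (\<Sum>n\<in>{- int M..int N}. w n x / D n)"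
      by (simp only: U_def sinc_approx_def w_eq D)
    then show "U x = of_real (S * \<tau>) * (\<Sum>n\<in>{- int M..int N}. inverse (D n) * w n x)"
      by (simp add: S_def divide_inverse mult.commute)
  qed
  have sumW: "(\<lambda>x. \<Sum>n\<in>A. inverse (D n) * w n x) \<in> W \<and>
      (\<forall>\<ll>. linear_functional \<ll> \<longrightarrow> \<ll> (\<lambda>x. \<Sum>n\<in>A. inverse (D n) * w n x) = (\<Sum>n\<in>A. inverse (D n) * \<ll> (w n)))"
    if "finite A" for A using that
  proof (induction A rule: finite_induct)
    case empty
    then show ?case using zero_mem linear_functional_simps(3) by simp
  next
    case (insert a A)
    then have IH: "(\<lambda>x. \<Sum>n\<in>A. inverse (D n) * w n x) \<in> W" by simp
    have "\<ll> (\<lambda>x. inverse (D a) * w a x + (\<Sum>n\<in>A. inverse (D n) * w n x)) =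
        inverse (D a) * \<ll> (w a) + \<ll> (\<lambda>x. \<Sum>n\<in>A. inverse (D n) * w n x)" if "linear_functional \<ll>" for \<ll>
      unfolding linear_functional_simps(1)[OF that scale_mem[OF w_mem] IH] linear_functional_simps(2)[OF that w_mem] ..
    then show ?case using insert IH by (simp add: add_mem scale_mem w_mem)
  qed
  have U_mem: "U \<in> W" unfolding U by (intro scale_mem) (use sumW in simp)
  define u where "u = discrete_solution W T \<alpha> b f"
  have u_mem: "u \<in> W" unfolding u_def
    using exists_dunford_contour[OF \<alpha> b pos] solution_mem[OF \<alpha> b pos _ f] by blast
  define e where "e = (\<lambda>x. u x + (- 1) * U x)"
  have e_mem: "e \<in> W" unfolding e_def using u_mem U_mem by (intro add_mem scale_mem)
  have e_eq: "e = (\<lambda>x. discrete_solution W T \<alpha> b f x - sinc_approx W T \<alpha> b \<tau> M N f x)"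
    by (simp add: e_def u_def U_def)
  then show "(\<lambda>x. discrete_solution W T \<alpha> b f x - sinc_approx W T \<alpha> b \<tau> M N f x) \<in> W" using e_mem by simp
  \<comment> \<open>Pairing with the error itself turns ||e||^2 into the value of a linear
    functional at the error.\<close>
  define \<ll> where "\<ll> v = ip v e" for v
  have lin: "linear_functional \<ll>" unfolding linear_functional_def \<ll>_def using e_mem ip_add ip_scale by simp
  define \<psi> where "\<psi> = resolvent_symbol \<alpha> \<ll> f"
  have \<psi>: "\<psi> s = - exp (\<sigma> s) * \<ll> (R (- exp (\<sigma> s)) f)" for s
    unfolding \<psi>_def \<sigma>_def by (rule resolvent_symbol_def[OF \<alpha> b pos lin f])
  have \<psi>w: "\<ll> (w n) = \<psi> (of_real (of_int n * \<tau>))" for n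
    unfolding w_def \<psi> using \<kappa>1 by (intro linear_functional_simps(2)[OF lin] resolvent_mem spec f) simp
  define E where "E = nrm f * nrm e"
  have E: "0 \<le> E" unfolding E_def using f e_mem by (intro mult_nonneg_nonneg nrm_nonneg)
  have \<psi>_le: "cmod (\<psi> s) \<le> exp (Re (\<sigma> s)) * (q * nrm e)"
    if "nrm (R (- exp (\<sigma> s)) f) \<le> q" "\<bar>Im s\<bar> < \<kappa>1" for s q
  proof -
    have "cmod (\<ll> (R (- exp (\<sigma> s)) f)) \<le> nrm (R (- exp (\<sigma> s)) f) * nrm e"
      unfolding \<ll>_def using that by (intro cauchy_schwarz resolvent_mem spec f e_mem)
    also have "\<dots> \<le> q * nrm e" using that e_mem by (intro mult_right_mono nrm_nonneg)
    finally show ?thesis by (simp add: \<psi> norm_mult norm_exp_eq_Re)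
  qed
  have \<psi>_bound: "cmod (\<psi> s) \<le> E / sin (min ((\<kappa>1 - \<bar>Im s\<bar>) / \<alpha>) (pi / 2))" if s: "\<bar>Im s\<bar> < \<kappa>1" for s
    using \<psi>_le[OF bound[OF s] s] sn_pos[OF s] by (simp add: E_def sn_def)
  have \<psi>_real: "cmod (\<psi> (of_real y)) \<le> E * exp (y / \<alpha>) / c0" for y
    using \<psi>_le[OF bound_real] \<kappa>1 \<alpha> by (simp add: E_def \<sigma>_def ac_simps)
  have \<psi>_holo: "\<psi> holomorphic_on {s. \<bar>Im s\<bar> < \<kappa>1}"
  proof -
    have "(\<lambda>z. \<ll> (R z f)) holomorphic_on - set LS"
      by (intro functional_resolvent_holomorphic lin f) auto
    then have "((\<lambda>z. \<ll> (R z f)) \<circ> (\<lambda>s. - exp (\<sigma> s))) holomorphic_on {s. \<bar>Im s\<bar> < \<kappa>1}"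
      using spec \<alpha> unfolding \<sigma>_def
      by (intro holomorphic_on_compose_gen[of _ _ _ "- set LS"] holomorphic_intros) auto
    then have "(\<lambda>s. \<ll> (R (- exp (\<sigma> s)) f)) holomorphic_on {s. \<bar>Im s\<bar> < \<kappa>1}" by (simp add: o_def)
    then show ?thesis unfolding \<psi>[abs_def] using \<alpha> unfolding \<sigma>_def by (intro holomorphic_intros) auto
  qed
  define I where "I = of_real (pi * \<alpha> / sin (pi * \<alpha>)) * \<ll> u"
  have lim: "((\<lambda>L. integral {- L..L} (\<lambda>x. \<psi> (of_real x) / kernel_den \<alpha> b (of_real x))) \<longlongrightarrow> I) at_top"
    unfolding \<psi>_def I_def u_def by (rule balakrishnan_integral[OF \<alpha> b pos lin f])
  define m where "m = 2 * pi * min \<kappa>1 \<kappa>2"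
  \<comment> \<open>M > 0 excludes the second argument of the maximum; only then does (1 +
    1/\<alpha>) M \<tau> = m/\<tau> - ln b hold exactly.\<close>
  have Meq: "real M = \<alpha> / (\<alpha> + 1) * (m / \<tau>\<^sup>2 - ln b / \<tau>)"
    using M by (auto simp: m_def max_def split: if_splits)
  have a1: "(1 + 1 / \<alpha>) * (\<alpha> / (\<alpha> + 1)) = 1"
  proof -
    have "1 + 1 / \<alpha> = (\<alpha> + 1) / \<alpha>" using \<alpha> by (simp add: field_simps)
    then show ?thesis using \<alpha> by simp
  qed
  have Meq': "(1 + 1 / \<alpha>) * real M = m / \<tau>\<^sup>2 - ln b / \<tau>"
    unfolding Meq mult.assoc[symmetric] a1 by simp
  have "(1 + 1 / \<alpha>) * (real M * \<tau>) = (m / \<tau>\<^sup>2 - ln b / \<tau>) * \<tau>"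
    unfolding Meq'[symmetric] by simp
  also have "\<dots> = m / \<tau> - ln b" using \<tau> by (simp add: field_simps power2_eq_square)
  finally have M1: "exp (- ((1 + 1 / \<alpha>) * (real M * \<tau>))) \<le> b * \<epsilon>"
    using b by (simp add: \<epsilon>_def m_def exp_diff exp_minus divide_inverse)
  have "real N * \<tau> = m / \<tau> + ln b" unfolding N using \<tau> by (simp add: m_def field_simps power2_eq_square)
  then have N1: "exp (- (real N * \<tau>)) \<le> \<epsilon> / b"
    using b by (simp add: \<epsilon>_def m_def exp_diff)
  \<comment> \<open>The terms ln b / \<tau> cancel, which leaves 2 m / \<tau>^2, and pi
    min(\<kappa>1, \<kappa>2) is m/2; the product is a perfect square.\<close>
  have "pi * min \<kappa>1 \<kappa>2 * ((1 + 1 / \<alpha>) * real M + real N) = (m / \<tau>)\<^sup>2"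
    unfolding Meq' N using \<tau> by (simp add: m_def field_simps power2_eq_square)
  moreover have "0 \<le> m / \<tau>" using \<kappa>1 \<alpha> \<tau> by (simp add: m_def \<kappa>2_def)
  ultimately have "sqrt (pi * min \<kappa>1 \<kappa>2 * ((1 + 1 / \<alpha>) * real M + real N)) = m / \<tau>"
    by (simp only: real_sqrt_abs abs_of_nonneg)
  then have eps: "exp (- sqrt (pi * min \<kappa>1 \<kappa>2 * ((1 + 1 / \<alpha>) * real M + real N))) = \<epsilon>"
    by (simp only: \<epsilon>_def m_def)
  have quad: "cmod (I - of_real \<tau> * (\<Sum>n\<in>{- int M..int N}. \<psi> (of_real (of_int n * \<tau>)) / kernel_den \<alpha> b (of_real (of_int n * \<tau>))))
    \<le> quad_const \<alpha> c0 * E * tau_factor \<alpha> \<kappa>1 \<kappa>2 \<tau> / b * \<epsilon>"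
    unfolding \<kappa>1_def \<kappa>2_def \<epsilon>_def \<omega>_def[symmetric]
    using \<alpha> \<omega> c0 b E \<tau> \<psi>_holo \<psi>_bound \<psi>_real M1 N1 lim
    by (intro sinc_quadrature_error) (auto simp: \<omega>_def \<kappa>1_def \<kappa>2_def \<epsilon>_def)
  have S: "0 < S" using \<alpha> sin_gt_zero[of "pi * \<alpha>"] by (simp add: S_def)
  have "\<ll> U = of_real (S * \<tau>) * (\<Sum>n\<in>{- int M..int N}. inverse (D n) * \<ll> (w n))"
  proof -
    note s = sumW[of "{- int M..int N}", simplified]
    have "\<ll> (\<lambda>x. \<Sum>n\<in>{- int M..int N}. inverse (D n) * w n x) = (\<Sum>n\<in>{- int M..int N}. inverse (D n) * \<ll> (w n))"
      using s lin by blast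
    then show ?thesis unfolding U linear_functional_simps(2)[OF lin conjunct1[OF s]] by (rule arg_cong)
  qed
  also have "\<dots> = of_real S * (of_real \<tau> * (\<Sum>n\<in>{- int M..int N}. \<psi> (of_real (of_int n * \<tau>)) / kernel_den \<alpha> b (of_real (of_int n * \<tau>))))"
    unfolding \<psi>w D_def by (simp add: divide_inverse mult.commute)
  finally have lU: "\<ll> U = of_real S * (of_real \<tau> * (\<Sum>n\<in>{- int M..int N}. \<psi> (of_real (of_int n * \<tau>)) / kernel_den \<alpha> b (of_real (of_int n * \<tau>))))" .
  have lu: "\<ll> u = of_real S * I" using \<alpha> sin_gt_zero[of "pi * \<alpha>"] by (simp add: I_def S_def)
  have "of_real ((nrm e)\<^sup>2) = \<ll> e" using ip_self[OF e_mem] by (simp add: \<ll>_def)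
  also have "\<dots> = \<ll> u - \<ll> U"
  proof -
    have "\<ll> e = \<ll> u + (- 1) * \<ll> U"
      unfolding e_def linear_functional_simps(1)[OF lin u_mem scale_mem[OF U_mem]] linear_functional_simps(2)[OF lin U_mem] ..
    then show ?thesis by simp
  qed
  also have "\<dots> = of_real S * (I - of_real \<tau> * (\<Sum>n\<in>{- int M..int N}. \<psi> (of_real (of_int n * \<tau>)) / kernel_den \<alpha> b (of_real (of_int n * \<tau>))))"
    unfolding lu lU right_diff_distrib ..
  finally have "cmod (of_real ((nrm e)\<^sup>2)) = S * cmod (I - of_real \<tau> * (\<Sum>n\<in>{- int M..int N}. \<psi> (of_real (of_int n * \<tau>)) / kernel_den \<alpha> b (of_real (of_int n * \<tau>))))"
    using S by (simp add: norm_mult)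
  then have "(nrm e)\<^sup>2 \<le> S * (quad_const \<alpha> c0 * E * tau_factor \<alpha> \<kappa>1 \<kappa>2 \<tau> / b * \<epsilon>)"
    using mult_left_mono[OF quad less_imp_le[OF S]] by (simp add: norm_power)
  also have "\<dots> = (S * quad_const \<alpha> c0 * tau_factor \<alpha> \<kappa>1 \<kappa>2 \<tau> / b * \<epsilon> * nrm f) * nrm e"
    by (simp add: E_def ac_simps)
  finally have sq: "nrm e * nrm e \<le> (S * quad_const \<alpha> c0 * tau_factor \<alpha> \<kappa>1 \<kappa>2 \<tau> / b * \<epsilon> * nrm f) * nrm e"
    by (simp add: power2_eq_square)
  \<comment> \<open>A vanishing error leaves no factor to cancel; then nonnegativity of the
    right-hand side settles the claim.\<close>
  have "nrm e \<le> S * quad_const \<alpha> c0 * tau_factor \<alpha> \<kappa>1 \<kappa>2 \<tau> / b * \<epsilon> * nrm f"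
  proof (cases "nrm e = 0")
    case True
    have "0 \<le> quad_const \<alpha> c0"
      using cos_pi_mult_bounds[OF \<alpha>] \<alpha> c0 by (auto simp: quad_const_def Let_def intro!: add_nonneg_nonneg divide_nonneg_nonneg mult_nonneg_nonneg)
    moreover have "0 \<le> tau_factor \<alpha> \<kappa>1 \<kappa>2 \<tau>" using tau_factor_ge_1[OF \<alpha> \<tau>(1), of \<kappa>1 \<kappa>2] by linarith
    ultimately show ?thesis using True S b nrm_nonneg[OF f] by (simp add: \<epsilon>_def)
  next
    case False
    then have "0 < nrm e" using nrm_nonneg[OF e_mem] by simp
    then show ?thesis by (rule mult_right_le_imp_le[OF sq])
  qed
  then show "nrm (\<lambda>x. discrete_solution W T \<alpha> b f x - sinc_approx W T \<alpha> b \<tau> M N f x) \<le>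
      sin (pi * \<alpha>) / (pi * \<alpha>) * quad_const \<alpha> c0 * tau_factor \<alpha> \<kappa>1 \<kappa>2 \<tau> / b *
      exp (- sqrt (pi * min \<kappa>1 \<kappa>2 * ((1 + 1 / \<alpha>) * real M + real N))) * nrm f"
    unfolding eps e_eq S_def .
qed

end

section \<open>Square-integrable functions and test functions\<close>

lemma L2_iff: "u \<in> L2 \<Omega> \<longleftrightarrow> u \<in> borel_measurable (lebesgue_on \<Omega>) \<and> integrable (lebesgue_on \<Omega>) (\<lambda>x. (cmod (u x))\<^sup>2)"
  by (simp add: L2_def)

lemma L2_scale: "u \<in> L2 \<Omega> \<Longrightarrow> (\<lambda>x. c * u x) \<in> L2 \<Omega>"
  by (auto simp: L2_iff norm_mult power_mult_distrib)

lemma L2_add: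
  assumes "u \<in> L2 \<Omega>" "v \<in> L2 \<Omega>"
  shows "(\<lambda>x. u x + v x) \<in> L2 \<Omega>"
proof -
  have m [measurable]: "u \<in> borel_measurable (lebesgue_on \<Omega>)" "v \<in> borel_measurable (lebesgue_on \<Omega>)"
    using assms by (auto simp: L2_iff)
  have "integrable (lebesgue_on \<Omega>) (\<lambda>x. (cmod (u x + v x))\<^sup>2)"
  proof (rule Bochner_Integration.integrable_bound)
    show "integrable (lebesgue_on \<Omega>) (\<lambda>x. 2 * (cmod (u x))\<^sup>2 + 2 * (cmod (v x))\<^sup>2)"
      using assms by (auto simp: L2_iff)
    show "AE x in lebesgue_on \<Omega>. norm ((cmod (u x + v x))\<^sup>2) \<le> norm (2 * (cmod (u x))\<^sup>2 + 2 * (cmod (v x))\<^sup>2)"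
    proof (intro AE_I2)
      fix x
      have "(cmod (u x + v x))\<^sup>2 \<le> (cmod (u x) + cmod (v x))\<^sup>2" by (intro power_mono norm_triangle_ineq) auto
      also have "\<dots> \<le> 2 * (cmod (u x))\<^sup>2 + 2 * (cmod (v x))\<^sup>2"
        using zero_le_power2[of "cmod (u x) - cmod (v x)"] by (simp add: power2_eq_square algebra_simps)
      finally show "norm ((cmod (u x + v x))\<^sup>2) \<le> norm (2 * (cmod (u x))\<^sup>2 + 2 * (cmod (v x))\<^sup>2)" by simp
    qed
  qed measurable
  then show ?thesis using m by (simp add: L2_iff)
qed

lemma L2_mult_integrable:
  assumes "u \<in> L2 \<Omega>" "v \<in> L2 \<Omega>"
  shows "integrable (lebesgue_on \<Omega>) (\<lambda>x. u x * v x)"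
proof (rule Bochner_Integration.integrable_bound)
  show "integrable (lebesgue_on \<Omega>) (\<lambda>x. (cmod (u x))\<^sup>2 + (cmod (v x))\<^sup>2)" using assms by (simp add: L2_iff)
  show "(\<lambda>x. u x * v x) \<in> borel_measurable (lebesgue_on \<Omega>)" using assms by (auto simp: L2_iff)
  show "AE x in lebesgue_on \<Omega>. norm (u x * v x) \<le> norm ((cmod (u x))\<^sup>2 + (cmod (v x))\<^sup>2)"
  proof (intro AE_I2)
    fix x
    have "2 * (cmod (u x) * cmod (v x)) \<le> (cmod (u x))\<^sup>2 + (cmod (v x))\<^sup>2"
      using zero_le_power2[of "cmod (u x) - cmod (v x)"] by (simp add: power2_eq_square algebra_simps)
    moreover have "0 \<le> cmod (u x) * cmod (v x)" by simp
    ultimately have "cmod (u x) * cmod (v x) \<le> (cmod (u x))\<^sup>2 + (cmod (v x))\<^sup>2" by linarith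
    then show "norm (u x * v x) \<le> norm ((cmod (u x))\<^sup>2 + (cmod (v x))\<^sup>2)" by (simp add: norm_mult)
  qed
qed

lemma L2_cnj: "u \<in> L2 \<Omega> \<Longrightarrow> (\<lambda>x. cnj (u x)) \<in> L2 \<Omega>"
  by (auto simp: L2_iff intro: borel_measurable_continuous_on[OF continuous_on_cnj[OF continuous_on_id], simplified])

lemma bounded_open_lmeasurable: "open \<Omega> \<Longrightarrow> bounded \<Omega> \<Longrightarrow> (\<Omega> :: (real^'d) set) \<in> lmeasurable"
  by (rule lmeasurable_open[rotated])

lemma L2_continuous:
  fixes \<Omega> :: "(real^'d) set"
  assumes "open \<Omega>" "bounded \<Omega>" "continuous_on (closure \<Omega>) v"
  shows "v \<in> L2 \<Omega>"
proof -
  have lm: "\<Omega> \<in> lmeasurable" using assms by (intro bounded_open_lmeasurable)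
  then have s: "\<Omega> \<in> sets lebesgue" by (simp add: fmeasurableD)
  interpret finite_measure "lebesgue_on \<Omega>" using lm by (rule finite_measure_lebesgue_on)
  have m: "v \<in> borel_measurable (lebesgue_on \<Omega>)"
    by (intro continuous_imp_measurable_on_sets_lebesgue s continuous_on_subset[OF assms(3) closure_subset])
  have "compact (v ` closure \<Omega>)" using assms by (intro compact_continuous_image) auto
  then obtain B where B: "\<And>x. x \<in> closure \<Omega> \<Longrightarrow> cmod (v x) \<le> B"
    using compact_imp_bounded bounded_iff by (metis imageI)
  have "integrable (lebesgue_on \<Omega>) (\<lambda>x. (cmod (v x))\<^sup>2)"
  proof (rule integrable_const_bound)
    show "AE x in lebesgue_on \<Omega>. norm ((cmod (v x))\<^sup>2) \<le> B\<^sup>2"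
      using B closure_subset by (intro AE_I2) (auto simp: space_restrict_space intro!: power_mono)
  qed (use m in measurable)
  then show ?thesis using m by (simp add: L2_iff)
qed

lemma L2_one:
  fixes \<Omega> :: "(real^'d) set"
  assumes "open \<Omega>" "bounded \<Omega>"
  shows "(\<lambda>x. 1) \<in> L2 \<Omega>"
  using assms by (intro L2_continuous) auto

lemma L2_integrable:
  fixes \<Omega> :: "(real^'d) set"
  assumes "open \<Omega>" "bounded \<Omega>" "u \<in> L2 \<Omega>"
  shows "integrable (lebesgue_on \<Omega>) u"
  using L2_mult_integrable[OF assms(3) L2_one[OF assms(1,2)]] by simp

section \<open>Continuously differentiable bumps and the fundamental lemma\<close>

definition ramp :: "real \<Rightarrow> real" where "ramp t = (max 0 t)\<^sup>2"

lemma ramp_deriv: "(ramp has_real_derivative 2 * max 0 t) (at t)"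
proof -
  consider "t > 0" | "t < 0" | "t = 0" by linarith
  then show ?thesis
  proof cases
    case 1
    have "((\<lambda>t. t\<^sup>2) has_real_derivative 2 * max 0 t) (at t)" using 1 by (auto intro!: derivative_eq_intros)
    then show ?thesis
      by (rule has_field_derivative_transform_within_open[where S = "{0<..}"]) (use 1 in \<open>auto simp: ramp_def\<close>)
  next
    case 2
    have "((\<lambda>t. 0) has_real_derivative 2 * max 0 t) (at t)" using 2 by (auto intro!: derivative_eq_intros)
    then show ?thesis
      by (rule has_field_derivative_transform_within_open[where S = "{..<0}"]) (use 2 in \<open>auto simp: ramp_def\<close>)
  next
    case 3
    have "((\<lambda>y. ramp y / y) \<longlongrightarrow> 0) (at 0)"
    proof (rule Lim_null_comparison)
      show "\<forall>\<^sub>F y in at 0. norm (ramp y / y) \<le> \<bar>y\<bar>"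
        by (auto simp: ramp_def max_def power2_eq_square abs_mult intro!: always_eventually)
      show "((\<lambda>y::real. \<bar>y\<bar>) \<longlongrightarrow> 0) (at 0)" by (intro tendsto_rabs_zero tendsto_ident_at)
    qed
    then show ?thesis using 3 by (simp add: has_field_derivative_iff ramp_def)
  qed
qed

lemma ramp_simps: "0 \<le> ramp t" "ramp t = 0 \<longleftrightarrow> t \<le> 0" "0 < ramp t \<longleftrightarrow> 0 < t"
  by (auto simp: ramp_def max_def)

lemma ramp_le: "t \<le> c \<Longrightarrow> 0 < c \<Longrightarrow> ramp t \<le> c\<^sup>2"
  unfolding ramp_def by (intro power_mono) auto

text \<open>The squared positive part is just C^1, the smoothness asked of test functions. The
  fourth power is the product of the two squares' maxima on the interval and keeps the values below
  1.\<close>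

definition bump1 :: "real \<Rightarrow> real \<Rightarrow> real \<Rightarrow> real" where
  "bump1 a b t = ramp (t - a) * ramp (b - t) / (b - a)^4"

definition bump1' :: "real \<Rightarrow> real \<Rightarrow> real \<Rightarrow> real" where
  "bump1' a b t = (2 * max 0 (t - a) * ramp (b - t) - ramp (t - a) * (2 * max 0 (b - t))) / (b - a)^4"

lemma bump1_deriv: "(bump1 a b has_real_derivative bump1' a b t) (at t)"
proof -
  have 1: "((\<lambda>t. ramp (t - a)) has_real_derivative 2 * max 0 (t - a) * 1) (at t)"
    by (rule DERIV_chain2[OF ramp_deriv]) (auto intro!: derivative_eq_intros)
  have 2: "((\<lambda>t. ramp (b - t)) has_real_derivative 2 * max 0 (b - t) * (-1)) (at t)"
    by (rule DERIV_chain2[OF ramp_deriv]) (auto intro!: derivative_eq_intros)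
  show ?thesis unfolding bump1_def[abs_def] bump1'_def
    using DERIV_cdivide[OF DERIV_mult[OF 1 2], of "(b - a)^4"] by (simp add: algebra_simps)
qed

lemma bump1_bounds:
  assumes "a < b"
  shows "0 \<le> bump1 a b t" "bump1 a b t \<le> 1" "bump1 a b t \<noteq> 0 \<longleftrightarrow> a < t \<and> t < b"
proof -
  show "0 \<le> bump1 a b t" using ramp_simps assms by (simp add: bump1_def)
  show ne: "bump1 a b t \<noteq> 0 \<longleftrightarrow> a < t \<and> t < b" using ramp_simps assms by (auto simp: bump1_def)
  show "bump1 a b t \<le> 1"
  proof (cases "a < t \<and> t < b")
    case True
    have "ramp (t - a) * ramp (b - t) \<le> (b - a)\<^sup>2 * (b - a)\<^sup>2"
      using True ramp_simps by (intro mult_mono ramp_le) auto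
    also have "\<dots> = (b - a)^4" by (simp flip: power_add)
    finally show ?thesis using assms by (simp add: bump1_def)
  next
    case False
    then show ?thesis using ne by auto
  qed
qed

lemma continuous_bump1: "continuous_on A (bump1 a b)" "continuous_on A (bump1' a b)"
  unfolding bump1_def[abs_def] bump1'_def[abs_def] ramp_def by (auto intro!: continuous_intros simp: divide_inverse)

definition box_bump :: "real^'d \<Rightarrow> real^'d \<Rightarrow> real^'d \<Rightarrow> real" where
  "box_bump a b x = (\<Prod>i\<in>UNIV. bump1 (a $ i) (b $ i) (x $ i))"

lemma box_bump_bounds:
  fixes a b :: "real^'d"
  assumes "\<And>i. a $ i < b $ i"
  shows "0 \<le> box_bump a b x" "box_bump a b x \<le> 1" "box_bump a b x \<noteq> 0 \<longleftrightarrow> x \<in> box a b"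
proof -
  show "0 \<le> box_bump a b x" "box_bump a b x \<le> 1"
    using bump1_bounds(1,2)[OF assms] by (auto simp: box_bump_def intro!: prod_nonneg prod_le_1)
  show "box_bump a b x \<noteq> 0 \<longleftrightarrow> x \<in> box a b"
    using bump1_bounds(3)[OF assms] by (auto simp: box_bump_def mem_box_cart)
qed

text \<open>As \<open>n\<close> tends to infinity the test function \<open>1 - (1 - box_bump)\<^sup>n\<close> increases to the indicator of the box.\<close>

lemma test_function_box:
  fixes a b :: "real^'d"
  assumes ab: "\<And>i. a $ i < b $ i" and sub: "cbox a b \<subseteq> \<Omega>"
  shows "\<exists>D. test_function \<Omega> (\<lambda>x. 1 - (1 - box_bump a b x) ^ n) D"
proof -
  define q where "q = box_bump a b"
  define dq where "dq x i = bump1' (a $ i) (b $ i) (x $ i) * (\<Prod>j\<in>UNIV - {i}. bump1 (a $ j) (b $ j) (x $ j))" for x :: "real^'d" and i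
  define D where "D x = (\<chi> i. n * (1 - q x) ^ (n - 1) * dq x i)" for x
  have q_deriv: "(q has_derivative (\<lambda>h. \<Sum>i\<in>UNIV. dq x i * h $ i)) (at x)" for x
  proof -
    have 1: "((\<lambda>x. bump1 (a $ i) (b $ i) (x $ i)) has_derivative (\<lambda>h. bump1' (a $ i) (b $ i) (x $ i) * h $ i)) (at x)" for i
    proof -
      have "((\<lambda>x. x $ i) has_derivative (\<lambda>h. h $ i)) (at x)"
        by (rule bounded_linear_imp_has_derivative[OF bounded_linear_vec_nth])
      from has_derivative_compose[OF this bump1_deriv[of "a $ i" "b $ i" "x $ i", unfolded has_field_derivative_def]]
      show ?thesis .
    qed
    have "((\<lambda>x. \<Prod>i\<in>UNIV. bump1 (a $ i) (b $ i) (x $ i)) has_derivative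
        (\<lambda>h. \<Sum>i\<in>UNIV. (bump1' (a $ i) (b $ i) (x $ i) * h $ i) * (\<Prod>j\<in>UNIV - {i}. bump1 (a $ j) (b $ j) (x $ j)))) (at x)"
      by (rule has_derivative_prod[OF 1])
    then show ?thesis by (simp add: q_def box_bump_def[abs_def] dq_def ac_simps)
  qed
  have "GDERIV (\<lambda>x. 1 - (1 - q x) ^ n) x :> D x" for x
  proof -
    have "((\<lambda>x. 1 - (1 - q x) ^ n) has_derivative (\<lambda>h. 0 - of_nat n * (0 - (\<Sum>i\<in>UNIV. dq x i * h $ i)) * (1 - q x) ^ (n - 1))) (at x)"
      by (intro has_derivative_diff has_derivative_const has_derivative_power q_deriv)
    moreover have "0 - of_nat n * (0 - (\<Sum>i\<in>UNIV. dq x i * h $ i)) * (1 - q x) ^ (n - 1) = h \<bullet> D x" for h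
      by (simp add: inner_vec_def D_def sum_distrib_left sum_distrib_right ac_simps)
    ultimately show ?thesis by (simp add: gderiv_def)
  qed
  moreover have "continuous_on UNIV D"
    unfolding D_def dq_def q_def box_bump_def
    by (intro continuous_intros continuous_on_compose2[OF continuous_bump1(1)] continuous_on_compose2[OF continuous_bump1(2)]) auto
  moreover have "closure {x. 1 - (1 - q x) ^ n \<noteq> 0} \<subseteq> cbox a b"
  proof (rule closure_minimal)
    show "{x. 1 - (1 - q x) ^ n \<noteq> 0} \<subseteq> cbox a b"
    proof
      fix x assume "x \<in> {x. 1 - (1 - q x) ^ n \<noteq> 0}"
      then have "q x \<noteq> 0" by auto
      then have "x \<in> box a b" using box_bump_bounds(3)[OF ab] by (simp add: q_def)
      then show "x \<in> cbox a b" using box_subset_cbox by blast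
    qed
  qed (rule closed_cbox)
  moreover from this have "compact (closure {x. 1 - (1 - q x) ^ n \<noteq> 0})"
    using compact_Int_closed[OF compact_cbox closed_closure, of a b "{x. 1 - (1 - q x) ^ n \<noteq> 0}"]
    by (simp only: inf.absorb2)
  ultimately show ?thesis using sub unfolding test_function_def q_def by blast
qed

text \<open>Test functions increasing to the indicator of a box make the integral of g over every
  box inside \<Omega> vanish, by dominated convergence. Lebesgue differentiation along shrinking
  cubes then recovers g almost everywhere.\<close>

lemma fundamental_lemma:
  fixes \<Omega> :: "(real^'d) set"
  assumes \<Omega>: "open \<Omega>" "bounded \<Omega>" and g: "g \<in> L2 \<Omega>"
    and zero: "\<And>\<phi> D\<phi>. test_function \<Omega> \<phi> D\<phi> \<Longrightarrow> (LINT x|lebesgue_on \<Omega>. g x * of_real (\<phi> x)) = 0"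
  shows "AE x in lebesgue_on \<Omega>. g x = 0"
proof -
  have lm: "\<Omega> \<in> lmeasurable" using \<Omega> by (intro bounded_open_lmeasurable)
  then have s: "\<Omega> \<in> sets lebesgue" by (simp add: fmeasurableD)
  have gi: "integrable (lebesgue_on \<Omega>) g" using \<Omega> g by (rule L2_integrable)
  have gm [measurable]: "g \<in> borel_measurable (lebesgue_on \<Omega>)" using g by (simp add: L2_iff)
  \<comment> \<open>Extension by zero makes the function integrable on every box, also on those that
    leave \<Omega>.\<close>
  define G where "G x = (if x \<in> \<Omega> then g x else 0)" for x
  have Gai: "G absolutely_integrable_on UNIV"
  proof -
    have "g absolutely_integrable_on \<Omega>" using gi s by (simp add: integrable_restrict_space set_integrable_def)
    then show ?thesis by (simp add: absolutely_integrable_restrict_UNIV G_def[abs_def])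
  qed
  have box0: "integral (cbox a b) G = 0" if ab: "\<And>i. a $ i < b $ i" and sub: "cbox a b \<subseteq> \<Omega>" for a b :: "real^'d"
  proof -
    define \<phi> where "\<phi> n x = 1 - (1 - box_bump a b x) ^ n" for n x
    have bb: "0 \<le> 1 - box_bump a b x" "1 - box_bump a b x \<le> 1" for x using box_bump_bounds[OF ab] by auto
    have \<phi>01: "0 \<le> \<phi> n x" "\<phi> n x \<le> 1" for n x
      using bb power_le_one[OF bb] zero_le_power[OF bb(1)] by (auto simp: \<phi>_def)
    have eq: "\<Omega> \<inter> box a b = box a b" using sub box_subset_cbox by blast
    then have "box a b \<in> sets (lebesgue_on \<Omega>)" using s by (auto simp: sets_restrict_space_iff)
    from borel_measurable_indicator[OF this, where ?'b = complex]
    have im: "(\<lambda>x. complex_of_real (indicator (box a b) x)) \<in> borel_measurable (lebesgue_on \<Omega>)"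
      by (rule back_subst[where P = "\<lambda>f. f \<in> _"]) (auto simp: indicator_def)
    have cont: "continuous_on UNIV (\<phi> n)" for n
      unfolding \<phi>_def box_bump_def
      by (intro continuous_intros continuous_on_compose2[OF continuous_bump1(1)]) auto
    have \<phi>m [measurable]: "\<phi> n \<in> borel_measurable (lebesgue_on \<Omega>)" for n
      by (intro continuous_imp_measurable_on_sets_lebesgue s continuous_on_subset[OF cont]) simp
    have lim: "(\<lambda>n. \<phi> n x) \<longlonglongrightarrow> indicator (box a b) x" for x
    proof (cases "x \<in> box a b")
      case True
      then have "box_bump a b x \<noteq> 0" using box_bump_bounds(3)[OF ab] by simp
      then have "0 < box_bump a b x" using box_bump_bounds(1)[OF ab, of x] by simp
      then have "norm (1 - box_bump a b x) < 1" using bb[of x] unfolding real_norm_def by linarith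
      then have "(\<lambda>n. (1 - box_bump a b x) ^ n) \<longlonglongrightarrow> 0" by (rule LIMSEQ_power_zero)
      then have "(\<lambda>n. 1 - (1 - box_bump a b x) ^ n) \<longlonglongrightarrow> 1 - 0" by (rule tendsto_diff[OF tendsto_const])
      then show ?thesis using True by (simp add: \<phi>_def)
    next
      case False
      then have "box_bump a b x = 0" using box_bump_bounds(3)[OF ab] by blast
      then show ?thesis using False by (simp add: \<phi>_def)
    qed
    have "(\<lambda>n. LINT x|lebesgue_on \<Omega>. g x * of_real (\<phi> n x)) \<longlonglongrightarrow> (LINT x|lebesgue_on \<Omega>. g x * of_real (indicator (box a b) x))"
    proof (rule integral_dominated_convergence[where w = "\<lambda>x. cmod (g x)"])
      show "integrable (lebesgue_on \<Omega>) (\<lambda>x. cmod (g x))" using gi by (rule integrable_norm)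
      show "AE x in lebesgue_on \<Omega>. (\<lambda>n. g x * of_real (\<phi> n x)) \<longlonglongrightarrow> g x * of_real (indicator (box a b) x)"
        by (intro AE_I2 tendsto_intros lim)
      show "AE x in lebesgue_on \<Omega>. norm (g x * of_real (\<phi> n x)) \<le> cmod (g x)" for n
        using \<phi>01 by (intro AE_I2) (simp add: norm_mult mult_left_le)
      show "(\<lambda>x. g x * of_real (indicator (box a b) x)) \<in> borel_measurable (lebesgue_on \<Omega>)"
        by (intro borel_measurable_times gm im)
    qed measurable
    moreover have "(LINT x|lebesgue_on \<Omega>. g x * of_real (\<phi> n x)) = 0" for n
      using test_function_box[OF ab sub, of n] zero unfolding \<phi>_def by blast
    ultimately have I0: "(LINT x|lebesgue_on \<Omega>. g x * of_real (indicator (box a b) x)) = 0"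
      by (simp add: LIMSEQ_const_iff)
    have ii: "integrable (lebesgue_on \<Omega>) (\<lambda>x. g x * of_real (indicator (box a b) x))"
    proof (rule Bochner_Integration.integrable_bound[OF gi])
      show "(\<lambda>x. g x * of_real (indicator (box a b) x)) \<in> borel_measurable (lebesgue_on \<Omega>)"
        by (intro borel_measurable_times gm im)
      show "AE x in lebesgue_on \<Omega>. norm (g x * of_real (indicator (box a b) x)) \<le> norm (g x)"
        by (intro AE_I2) (simp add: norm_mult indicator_def)
    qed
    have "integral (cbox a b) G = integral (box a b) G" by (simp add: integral_open_interval)
    also have "\<dots> = integral (box a b) g"
      using sub box_subset_cbox by (intro Henstock_Kurzweil_Integration.integral_cong) (auto simp: G_def)
    also have "\<dots> = integral \<Omega> (\<lambda>x. if x \<in> box a b then g x else 0)"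
      by (subst integral_restrict_Int) (simp only: eq eq[unfolded Int_commute[of \<Omega>]])
    also have "(\<lambda>x. if x \<in> box a b then g x else 0) = (\<lambda>x. g x * of_real (indicator (box a b) x))"
      by (auto simp: indicator_def)
    also have "integral \<Omega> \<dots> = 0" using lebesgue_integral_eq_integral[OF ii s] I0 by simp
    finally show ?thesis .
  qed
  have "G integrable_on cbox a b" for a b
    using Gai by (meson absolutely_integrable_on_subcbox set_lebesgue_integral_eq_integral(1) subset_UNIV)
  then obtain N where N: "negligible N"
    "\<And>x e. x \<notin> N \<Longrightarrow> 0 < e \<Longrightarrow> \<exists>d>0. \<forall>h. 0 < h \<and> h < d \<longrightarrow>
        norm (integral (cbox x (x + h *\<^sub>R One)) G /\<^sub>R h ^ DIM(real^'d) - G x) < e"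
    using integrable_ccontinuous_explicit[of G] by blast
  have One: "(\<Sum>b\<in>Basis. b $ i) = (1::real)" for i :: 'd
  proof -
    have "(\<Sum>b\<in>(Basis :: (real^'d) set). b $ i) = (\<Sum>b\<in>(Basis :: (real^'d) set). if b = axis i 1 then 1 else (0 :: real))"
      by (intro sum.cong) (auto simp: cart_eq_inner_axis inner_Basis)
    then show ?thesis by simp
  qed
  have G0: "g x = 0" if x: "x \<in> \<Omega>" "x \<notin> N" for x
  proof (rule ccontr)
    assume nz: "g x \<noteq> 0"
    then obtain d where d: "d > 0" "\<And>h. 0 < h \<Longrightarrow> h < d \<Longrightarrow> norm (integral (cbox x (x + h *\<^sub>R One)) G /\<^sub>R h ^ DIM(real^'d) - G x) < cmod (g x)"
      using N(2)[OF x(2), of "cmod (g x)"] by auto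
    obtain e where e: "e > 0" "ball x e \<subseteq> \<Omega>" using \<Omega>(1) x(1) openE by blast
    \<comment> \<open>A cube of side h with corner x lies within l1-distance \<open>CARD('d)\<close>
      h of x; this h makes that at most e/2.\<close>
    define h where "h = min (d / 2) (e / (2 * real CARD('d)))"
    have h: "0 < h" "h < d" "h \<le> e / (2 * real CARD('d))" using d e by (auto simp: h_def)
    have sub: "cbox x (x + h *\<^sub>R One) \<subseteq> \<Omega>"
    proof
      fix y assume y: "y \<in> cbox x (x + h *\<^sub>R One)"
      have "x $ i \<le> y $ i \<and> y $ i \<le> x $ i + h" for i using y One by (simp add: mem_box_cart)
      then have comp: "\<bar>(y - x) $ i\<bar> \<le> h" for i using h unfolding vector_minus_component
      proof -
        assume "\<And>i. x $ i \<le> y $ i \<and> y $ i \<le> x $ i + h"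
        from this[of i] h(1) show "\<bar>y $ i - x $ i\<bar> \<le> h" by linarith
      qed
      have "norm (y - x) \<le> (\<Sum>i\<in>UNIV. \<bar>(y - x) $ i\<bar>)" by (rule norm_le_l1_cart)
      also have "\<dots> \<le> (\<Sum>i\<in>(UNIV::'d set). h)" by (intro sum_mono comp)
      also have "\<dots> \<le> e / 2" using h by (simp add: field_simps)
      also have "\<dots> < e" using e by simp
      finally show "y \<in> \<Omega>" using e by (auto simp: dist_norm norm_minus_commute)
    qed
    have "integral (cbox x (x + h *\<^sub>R One)) G = 0"
      using h sub by (intro box0) (auto simp: One)
    then have "cmod (G x) < cmod (g x)" using d(2)[OF h(1,2)] by simp
    then show False using x by (simp add: G_def)
  qed
  have "N \<in> null_sets lebesgue" using N(1) negligible_iff_null_sets by blast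
  then have "AE x in lebesgue. x \<notin> N" by (rule AE_not_in)
  then have "AE x in lebesgue. x \<in> \<Omega> \<longrightarrow> g x = 0" using G0 by (auto elim: eventually_mono)
  then show ?thesis using s by (simp add: AE_restrict_space_iff)
qed

section \<open>Sobolev and finite element spaces\<close>

locale bounded_open =
  fixes \<Omega> :: "(real^'d) set"
  assumes open_dom: "open \<Omega>" and bounded_dom: "bounded \<Omega>"
begin

lemma test_function_L2:
  fixes D\<phi> :: "real^'d \<Rightarrow> real^'d"
  assumes "test_function \<Omega> \<phi> D\<phi>"
  shows "(\<lambda>x. complex_of_real (\<phi> x)) \<in> L2 \<Omega>" "(\<lambda>x. complex_of_real (D\<phi> x $ i)) \<in> L2 \<Omega>"
proof -
  have "isCont \<phi> x" for x
    using assms has_derivative_continuous unfolding test_function_def gderiv_def by blast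
  then have "continuous_on (closure \<Omega>) \<phi>" by (simp add: continuous_at_imp_continuous_on)
  then show "(\<lambda>x. complex_of_real (\<phi> x)) \<in> L2 \<Omega>"
    by (intro L2_continuous open_dom bounded_dom continuous_intros)
  have "continuous_on (closure \<Omega>) D\<phi>" using assms continuous_on_subset unfolding test_function_def by blast
  then show "(\<lambda>x. complex_of_real (D\<phi> x $ i)) \<in> L2 \<Omega>"
    by (intro L2_continuous open_dom bounded_dom continuous_intros)
qed

lemma integral_comb_mult:
  assumes "p \<in> L2 \<Omega>" "q \<in> L2 \<Omega>" "t \<in> L2 \<Omega>"
  shows "(LINT x|lebesgue_on \<Omega>. (p x + c * q x) * t x) =
      (LINT x|lebesgue_on \<Omega>. p x * t x) + c * (LINT x|lebesgue_on \<Omega>. q x * t x)"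
  using L2_mult_integrable[OF assms(1,3)] L2_mult_integrable[OF assms(2,3)]
  by (simp add: distrib_right mult.assoc)

text \<open>The shape u + c v covers sums, differences and, with u = 0, multiples; closure and
  linearity are proved in this shape for all the spaces that follow.\<close>

lemma is_weak_gradient_comb:
  assumes "is_weak_gradient \<Omega> u gu" "is_weak_gradient \<Omega> v gv" "u \<in> L2 \<Omega>" "v \<in> L2 \<Omega>"
  shows "is_weak_gradient \<Omega> (\<lambda>x. u x + c * v x) (\<lambda>x. \<chi> i. gu x $ i + c * gv x $ i)"
  unfolding is_weak_gradient_def
proof (intro conjI allI impI)
  fix i
  have g: "(\<lambda>x. gu x $ i) \<in> L2 \<Omega>" "(\<lambda>x. gv x $ i) \<in> L2 \<Omega>"
    using assms by (auto simp: is_weak_gradient_def)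
  then show "(\<lambda>x. (\<chi> i. gu x $ i + c * gv x $ i) $ i) \<in> L2 \<Omega>"
    by (simp add: L2_add L2_scale)
  fix \<phi> :: "real^'d \<Rightarrow> real" and D\<phi> assume t: "test_function \<Omega> \<phi> D\<phi>"
  note tL = test_function_L2[OF t]
  show "(LINT x|lebesgue_on \<Omega>. (u x + c * v x) * of_real (D\<phi> x $ i)) =
      - (LINT x|lebesgue_on \<Omega>. (\<chi> i. gu x $ i + c * gv x $ i) $ i * of_real (\<phi> x))"
    using assms(1,2) t unfolding is_weak_gradient_def
    by (simp add: integral_comb_mult[OF assms(3,4) tL(2)] integral_comb_mult[OF g tL(1)])
qed

text \<open>The difference of two weak gradients is orthogonal to every test function. As
  \<open>weak_gradient\<close> is a \<open>SOME\<close> choice, its linearity has to be derived from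
  this and holds almost everywhere.\<close>

lemma is_weak_gradient_unique:
  assumes "is_weak_gradient \<Omega> u g" "is_weak_gradient \<Omega> u g'"
  shows "AE x in lebesgue_on \<Omega>. g x = g' x"
proof -
  have "AE x in lebesgue_on \<Omega>. g x $ i + (- 1) * g' x $ i = 0" for i
  proof (rule fundamental_lemma[OF open_dom bounded_dom])
    have g: "(\<lambda>x. g x $ i) \<in> L2 \<Omega>" "(\<lambda>x. g' x $ i) \<in> L2 \<Omega>"
      using assms by (auto simp: is_weak_gradient_def)
    then show "(\<lambda>x. g x $ i + (- 1) * g' x $ i) \<in> L2 \<Omega>" by (intro L2_add L2_scale)
    fix \<phi> :: "real^'d \<Rightarrow> real" and D\<phi> assume t: "test_function \<Omega> \<phi> D\<phi>"
    note tL = test_function_L2(1)[OF t]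
    have "(LINT x|lebesgue_on \<Omega>. u x * of_real (D\<phi> x $ i)) = - (LINT x|lebesgue_on \<Omega>. g x $ i * of_real (\<phi> x))"
      "(LINT x|lebesgue_on \<Omega>. u x * of_real (D\<phi> x $ i)) = - (LINT x|lebesgue_on \<Omega>. g' x $ i * of_real (\<phi> x))"
      using assms t unfolding is_weak_gradient_def by blast+
    then have "- (LINT x|lebesgue_on \<Omega>. g x $ i * of_real (\<phi> x)) = - (LINT x|lebesgue_on \<Omega>. g' x $ i * of_real (\<phi> x))"
      by (rule trans[OF sym])
    then have "(LINT x|lebesgue_on \<Omega>. g x $ i * of_real (\<phi> x)) = (LINT x|lebesgue_on \<Omega>. g' x $ i * of_real (\<phi> x))"
      by (simp only: neg_equal_iff_equal)
    then show "(LINT x|lebesgue_on \<Omega>. (g x $ i + (- 1) * g' x $ i) * of_real (\<phi> x)) = 0"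
      unfolding integral_comb_mult[OF g tL] by (simp only: mult_minus1 add.right_inverse)
  qed
  then have "AE x in lebesgue_on \<Omega>. \<forall>i. g x $ i + (- 1) * g' x $ i = 0"
    by (rule eventually_all_finite)
  then show ?thesis
  proof eventually_elim
    case (elim x)
    then have "g x $ i = g' x $ i" for i using spec[OF elim, of i] by simp
    then show ?case by (simp add: vec_eq_iff)
  qed
qed

lemma H1_weak_gradient:
  assumes "u \<in> H1 \<Omega>"
  shows "u \<in> L2 \<Omega>" "is_weak_gradient \<Omega> u (weak_gradient \<Omega> u)" "(\<lambda>x. weak_gradient \<Omega> u x $ i) \<in> L2 \<Omega>"
proof -
  show "u \<in> L2 \<Omega>" using assms by (simp add: H1_def)
  show *: "is_weak_gradient \<Omega> u (weak_gradient \<Omega> u)"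
    using assms someI_ex[of "is_weak_gradient \<Omega> u"] by (simp add: H1_def weak_gradient_def)
  then show "(\<lambda>x. weak_gradient \<Omega> u x $ i) \<in> L2 \<Omega>" by (simp add: is_weak_gradient_def)
qed

lemma H1_comb:
  assumes "u \<in> H1 \<Omega>" "v \<in> H1 \<Omega>"
  shows "(\<lambda>x. u x + c * v x) \<in> H1 \<Omega>"
    "AE x in lebesgue_on \<Omega>. weak_gradient \<Omega> (\<lambda>x. u x + c * v x) x = (\<chi> i. weak_gradient \<Omega> u x $ i + c * weak_gradient \<Omega> v x $ i)"
proof -
  note u = H1_weak_gradient[OF assms(1)] and v = H1_weak_gradient[OF assms(2)]
  have w: "is_weak_gradient \<Omega> (\<lambda>x. u x + c * v x) (\<lambda>x. \<chi> i. weak_gradient \<Omega> u x $ i + c * weak_gradient \<Omega> v x $ i)"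
    by (rule is_weak_gradient_comb[OF u(2) v(2) u(1) v(1)])
  show h: "(\<lambda>x. u x + c * v x) \<in> H1 \<Omega>"
    using w L2_add[OF u(1) L2_scale[OF v(1)]] by (auto simp: H1_def)
  show "AE x in lebesgue_on \<Omega>. weak_gradient \<Omega> (\<lambda>x. u x + c * v x) x = (\<chi> i. weak_gradient \<Omega> u x $ i + c * weak_gradient \<Omega> v x $ i)"
    by (rule is_weak_gradient_unique[OF H1_weak_gradient(2)[OF h] w])
qed

lemma H1_zero: "(\<lambda>x. 0) \<in> H1 \<Omega>" "AE x in lebesgue_on \<Omega>. weak_gradient \<Omega> (\<lambda>x. 0) x = 0"
proof -
  have L0: "(\<lambda>x. 0) \<in> L2 \<Omega>" using L2_scale[OF L2_one[OF open_dom bounded_dom], of 0] by simp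
  have w: "is_weak_gradient \<Omega> (\<lambda>x. 0) (\<lambda>x. 0)"
    unfolding is_weak_gradient_def
  proof (intro conjI allI impI)
    show "(\<lambda>x. (0 :: complex^'d) $ i) \<in> L2 \<Omega>" for i using L0 by (simp only: zero_index)
    show "(LINT x|lebesgue_on \<Omega>. 0 * complex_of_real (D\<phi> x $ i)) = - (LINT x|lebesgue_on \<Omega>. (0 :: complex^'d) $ i * complex_of_real (\<phi> x))"
      for \<phi> and D\<phi> :: "real^'d \<Rightarrow> real^'d" and i
      by (simp only: zero_index mult_zero_left Bochner_Integration.integral_zero minus_zero)
  qed
  show h: "(\<lambda>x. 0) \<in> H1 \<Omega>" unfolding H1_def mem_Collect_eq by (intro conjI exI[of _ "\<lambda>x. 0"] L0 w)
  show "AE x in lebesgue_on \<Omega>. weak_gradient \<Omega> (\<lambda>x. 0) x = 0"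
    by (rule is_weak_gradient_unique[OF H1_weak_gradient(2)[OF h] w])
qed

section \<open>The H^1 norm and traces\<close>

lemma norm_vec_power2: "(norm (x :: complex^'d))\<^sup>2 = (\<Sum>i\<in>UNIV. (cmod (x $ i))\<^sup>2)"
  by (simp add: norm_vec_def L2_set_def sum_nonneg)

lemma H1_integrable:
  assumes "u \<in> H1 \<Omega>"
  shows "integrable (lebesgue_on \<Omega>) (\<lambda>x. (cmod (u x))\<^sup>2)"
    "integrable (lebesgue_on \<Omega>) (\<lambda>x. (cmod (u x))\<^sup>2 + (norm (weak_gradient \<Omega> u x))\<^sup>2)"
proof -
  note u = H1_weak_gradient[OF assms]
  show *: "integrable (lebesgue_on \<Omega>) (\<lambda>x. (cmod (u x))\<^sup>2)" using u(1) by (simp add: L2_iff)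
  have "integrable (lebesgue_on \<Omega>) (\<lambda>x. (cmod (weak_gradient \<Omega> u x $ i))\<^sup>2)" for i
    using u(3)[of i] by (simp add: L2_iff)
  then show "integrable (lebesgue_on \<Omega>) (\<lambda>x. (cmod (u x))\<^sup>2 + (norm (weak_gradient \<Omega> u x))\<^sup>2)"
    unfolding norm_vec_power2 using * by (intro Bochner_Integration.integrable_add Bochner_Integration.integrable_sum)
qed

lemma H1_norm_power2: "(H1_norm \<Omega> u)\<^sup>2 = (LINT x|lebesgue_on \<Omega>. (cmod (u x))\<^sup>2 + (norm (weak_gradient \<Omega> u x))\<^sup>2)"
  unfolding H1_norm_def by (rule real_sqrt_pow2) (rule integral_nonneg_AE, simp)

lemma H1_norm_nonneg: "0 \<le> H1_norm \<Omega> u"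
  unfolding H1_norm_def by (rule real_sqrt_ge_zero) (rule integral_nonneg_AE, simp)

lemma L2_norm_le_H1_norm:
  assumes "u \<in> H1 \<Omega>"
  shows "(LINT x|lebesgue_on \<Omega>. (cmod (u x))\<^sup>2) \<le> (H1_norm \<Omega> u)\<^sup>2"
  unfolding H1_norm_power2 by (intro integral_mono H1_integrable assms) simp

text \<open>Pointwise (p + q)^2 \<le> 2 p^2 + 2 q^2; the factor 2 is harmless, as the bound serves
  to pass to limits in the definition of the trace.\<close>

lemma H1_norm_comb:
  assumes "u \<in> H1 \<Omega>" "v \<in> H1 \<Omega>"
  shows "(H1_norm \<Omega> (\<lambda>x. u x + c * v x))\<^sup>2 \<le> 2 * (H1_norm \<Omega> u)\<^sup>2 + 2 * (cmod c)\<^sup>2 * (H1_norm \<Omega> v)\<^sup>2"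
proof -
  have sq: "(norm (p + q))\<^sup>2 \<le> 2 * (norm p)\<^sup>2 + 2 * (norm q)\<^sup>2" for p q :: "'b::real_normed_vector"
  proof -
    have "(norm (p + q))\<^sup>2 \<le> (norm p + norm q)\<^sup>2" by (intro power_mono norm_triangle_ineq) auto
    also have "\<dots> \<le> 2 * (norm p)\<^sup>2 + 2 * (norm q)\<^sup>2"
      using zero_le_power2[of "norm p - norm q"] by (simp add: power2_eq_square algebra_simps)
    finally show ?thesis .
  qed
  note h = H1_comb[OF assms, of c]
  let ?I = "\<lambda>u x. (cmod (u x))\<^sup>2 + (norm (weak_gradient \<Omega> u x))\<^sup>2"
  have "(H1_norm \<Omega> (\<lambda>x. u x + c * v x))\<^sup>2 \<le> (LINT x|lebesgue_on \<Omega>. 2 * ?I u x + 2 * (cmod c)\<^sup>2 * ?I v x)"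
    unfolding H1_norm_power2
  proof (rule integral_mono_AE)
    show "integrable (lebesgue_on \<Omega>) (\<lambda>x. ?I (\<lambda>x. u x + c * v x) x)" by (rule H1_integrable(2)[OF h(1)])
    show "integrable (lebesgue_on \<Omega>) (\<lambda>x. 2 * ?I u x + 2 * (cmod c)\<^sup>2 * ?I v x)"
      by (intro Bochner_Integration.integrable_add integrable_mult_right H1_integrable assms)
    show "AE x in lebesgue_on \<Omega>. ?I (\<lambda>x. u x + c * v x) x \<le> 2 * ?I u x + 2 * (cmod c)\<^sup>2 * ?I v x"
      using h(2)
    proof eventually_elim
      case (elim x)
      have "(cmod (u x + c * v x))\<^sup>2 \<le> 2 * (cmod (u x))\<^sup>2 + 2 * ((cmod c)\<^sup>2 * (cmod (v x))\<^sup>2)"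
        using sq[of "u x" "c * v x"] by (simp add: norm_mult power_mult_distrib)
      moreover have "(norm (weak_gradient \<Omega> (\<lambda>x. u x + c * v x) x))\<^sup>2 \<le>
          2 * (norm (weak_gradient \<Omega> u x))\<^sup>2 + 2 * ((cmod c)\<^sup>2 * (norm (weak_gradient \<Omega> v x))\<^sup>2)"
        unfolding elim norm_vec_power2 sum_distrib_left sum.distrib[symmetric]
      proof (rule sum_mono)
        fix i
        show "(cmod ((\<chi> i. weak_gradient \<Omega> u x $ i + c * weak_gradient \<Omega> v x $ i) $ i))\<^sup>2 \<le>
            2 * (cmod (weak_gradient \<Omega> u x $ i))\<^sup>2 + 2 * ((cmod c)\<^sup>2 * (cmod (weak_gradient \<Omega> v x $ i))\<^sup>2)"
          using sq[of "weak_gradient \<Omega> u x $ i" "c * weak_gradient \<Omega> v x $ i"] by (simp add: norm_mult power_mult_distrib)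
      qed
      ultimately show ?case by (simp add: distrib_left)
    qed
  qed
  also have "\<dots> = 2 * (H1_norm \<Omega> u)\<^sup>2 + 2 * (cmod c)\<^sup>2 * (H1_norm \<Omega> v)\<^sup>2"
  proof -
    have lin: "(LINT x|lebesgue_on \<Omega>. 2 * f x + 2 * (cmod c)\<^sup>2 * g x) =
        2 * (LINT x|lebesgue_on \<Omega>. f x) + 2 * (cmod c)\<^sup>2 * (LINT x|lebesgue_on \<Omega>. g x)"
      if "integrable (lebesgue_on \<Omega>) f" "integrable (lebesgue_on \<Omega>) g" for f g :: "real^'d \<Rightarrow> real"
      using that by simp
    show ?thesis unfolding H1_norm_power2 by (rule lin) (intro H1_integrable assms)+
  qed
  finally show ?thesis .
qed

lemma H1_norm_zero: "H1_norm \<Omega> (\<lambda>x. 0) = 0"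
proof -
  have "(LINT x|lebesgue_on \<Omega>. (cmod 0)\<^sup>2 + (norm (weak_gradient \<Omega> (\<lambda>x. 0) x))\<^sup>2) = 0"
    by (rule integral_eq_zero_AE) (use H1_zero(2) in \<open>auto elim: eventually_mono\<close>)
  then show ?thesis by (simp add: H1_norm_def)
qed

text \<open>\<open>measure_of\<close> keeps the generated family of measurable sets whatever the set
  function is, so measurability on the boundary is Borel measurability.\<close>

lemma sets_boundary_measure: "sets (boundary_measure \<Omega>) = sets (restrict_space borel (frontier \<Omega>))"
  unfolding boundary_measure_def
  by (intro sets_restrict_space_cong) (metis sets.sets_measure_of_eq space_borel)

lemma borel_measurable_boundary:
  assumes "continuous_on (closure \<Omega>) (w :: real^'d \<Rightarrow> complex)"
  shows "w \<in> borel_measurable (boundary_measure \<Omega>)"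
proof -
  have "continuous_on (frontier \<Omega>) w" using assms by (rule continuous_on_subset) (auto simp: frontier_def)
  then have "w \<in> borel_measurable (restrict_space borel (frontier \<Omega>))" by (rule borel_measurable_continuous_on_restrict)
  then show ?thesis using measurable_cong_sets[OF sets_boundary_measure refl] by blast
qed

text \<open>The approximating sequences are combined termwise. The boundary part is estimated in
  \<open>ennreal\<close>, where the integrals may be infinite for small n.\<close>

lemma has_trace_comb:
  assumes u: "has_trace \<Omega> u g" and v: "has_trace \<Omega> v k"
  shows "has_trace \<Omega> (\<lambda>x. u x + c * v x) (\<lambda>x. g x + c * k x)"
proof -
  obtain w1 where w1: "\<And>n. w1 n \<in> H1 \<Omega>" "\<And>n. continuous_on (closure \<Omega>) (w1 n)"
    "(\<lambda>n. H1_norm \<Omega> (\<lambda>x. w1 n x - u x)) \<longlonglongrightarrow> 0"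
    "(\<lambda>n. \<integral>\<^sup>+x. ennreal ((cmod (w1 n x - g x))\<^sup>2) \<partial>boundary_measure \<Omega>) \<longlonglongrightarrow> 0"
    using u unfolding has_trace_def by blast
  obtain w2 where w2: "\<And>n. w2 n \<in> H1 \<Omega>" "\<And>n. continuous_on (closure \<Omega>) (w2 n)"
    "(\<lambda>n. H1_norm \<Omega> (\<lambda>x. w2 n x - v x)) \<longlonglongrightarrow> 0"
    "(\<lambda>n. \<integral>\<^sup>+x. ennreal ((cmod (w2 n x - k x))\<^sup>2) \<partial>boundary_measure \<Omega>) \<longlonglongrightarrow> 0"
    using v unfolding has_trace_def by blast
  have uv: "u \<in> H1 \<Omega>" "v \<in> H1 \<Omega>" "g \<in> borel_measurable (boundary_measure \<Omega>)" "k \<in> borel_measurable (boundary_measure \<Omega>)"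
    using u v by (auto simp: has_trace_def)
  define w where "w n x = w1 n x + c * w2 n x" for n x
  have d: "(\<lambda>x. w1 n x - u x) \<in> H1 \<Omega>" "(\<lambda>x. w2 n x - v x) \<in> H1 \<Omega>" for n
    using H1_comb(1)[OF w1(1)[of n] uv(1), of "-1"] H1_comb(1)[OF w2(1)[of n] uv(2), of "-1"] by simp_all
  have "(\<lambda>n. H1_norm \<Omega> (\<lambda>x. w n x - (u x + c * v x))) \<longlonglongrightarrow> 0"
  proof (rule real_tendsto_sandwich)
    let ?b = "\<lambda>n. sqrt (2 * (H1_norm \<Omega> (\<lambda>x. w1 n x - u x))\<^sup>2 + 2 * (cmod c)\<^sup>2 * (H1_norm \<Omega> (\<lambda>x. w2 n x - v x))\<^sup>2)"
    show "\<forall>\<^sub>F n in sequentially. 0 \<le> H1_norm \<Omega> (\<lambda>x. w n x - (u x + c * v x))"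
      by (simp add: H1_norm_nonneg)
    show "\<forall>\<^sub>F n in sequentially. H1_norm \<Omega> (\<lambda>x. w n x - (u x + c * v x)) \<le> ?b n"
    proof (intro always_eventually allI real_le_rsqrt)
      fix n
      have "(\<lambda>x. w n x - (u x + c * v x)) = (\<lambda>x. (w1 n x - u x) + c * (w2 n x - v x))"
        by (auto simp: w_def algebra_simps)
      then show "(H1_norm \<Omega> (\<lambda>x. w n x - (u x + c * v x)))\<^sup>2 \<le>
          2 * (H1_norm \<Omega> (\<lambda>x. w1 n x - u x))\<^sup>2 + 2 * (cmod c)\<^sup>2 * (H1_norm \<Omega> (\<lambda>x. w2 n x - v x))\<^sup>2"
        using H1_norm_comb[OF d(1)[of n] d(2)[of n], of c] by simp
    qed
    have "?b \<longlonglongrightarrow> sqrt (2 * 0\<^sup>2 + 2 * (cmod c)\<^sup>2 * 0\<^sup>2)"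
      by (intro tendsto_intros w1 w2)
    then show "?b \<longlonglongrightarrow> 0" by simp
  qed simp
  moreover have "(\<lambda>n. \<integral>\<^sup>+x. ennreal ((cmod (w n x - (g x + c * k x)))\<^sup>2) \<partial>boundary_measure \<Omega>) \<longlonglongrightarrow> 0"
  proof -
    let ?B = "\<lambda>n. 2 * (\<integral>\<^sup>+x. ennreal ((cmod (w1 n x - g x))\<^sup>2) \<partial>boundary_measure \<Omega>) +
      ennreal (2 * (cmod c)\<^sup>2) * (\<integral>\<^sup>+x. ennreal ((cmod (w2 n x - k x))\<^sup>2) \<partial>boundary_measure \<Omega>)"
    note [measurable] = uv(3,4) borel_measurable_boundary[OF w1(2)] borel_measurable_boundary[OF w2(2)]
    have le: "\<forall>\<^sub>F n in sequentially. (\<integral>\<^sup>+x. ennreal ((cmod (w n x - (g x + c * k x)))\<^sup>2) \<partial>boundary_measure \<Omega>) \<le> ?B n"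
    proof (intro always_eventually allI)
      fix n
      have "(\<integral>\<^sup>+x. ennreal ((cmod (w n x - (g x + c * k x)))\<^sup>2) \<partial>boundary_measure \<Omega>) \<le>
        (\<integral>\<^sup>+x. 2 * ennreal ((cmod (w1 n x - g x))\<^sup>2) + ennreal (2 * (cmod c)\<^sup>2) * ennreal ((cmod (w2 n x - k x))\<^sup>2) \<partial>boundary_measure \<Omega>)"
      proof (rule nn_integral_mono)
        fix x
        let ?p = "w1 n x - g x" and ?q = "c * (w2 n x - k x)"
        have "(cmod (?p + ?q))\<^sup>2 \<le> (cmod ?p + cmod ?q)\<^sup>2" by (intro power_mono norm_triangle_ineq) auto
        also have "\<dots> \<le> 2 * (cmod ?p)\<^sup>2 + 2 * (cmod ?q)\<^sup>2"
          using zero_le_power2[of "cmod ?p - cmod ?q"] by (simp add: power2_eq_square algebra_simps)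
        also have "\<dots> = 2 * (cmod ?p)\<^sup>2 + 2 * (cmod c)\<^sup>2 * (cmod (w2 n x - k x))\<^sup>2"
          by (simp add: norm_mult power_mult_distrib)
        also have "?p + ?q = w n x - (g x + c * k x)" by (simp add: w_def algebra_simps)
        finally have "ennreal ((cmod (w n x - (g x + c * k x)))\<^sup>2) \<le> ennreal (2 * (cmod ?p)\<^sup>2 + 2 * (cmod c)\<^sup>2 * (cmod (w2 n x - k x))\<^sup>2)"
          by (rule ennreal_leI)
        also have "\<dots> = 2 * ennreal ((cmod ?p)\<^sup>2) + ennreal (2 * (cmod c)\<^sup>2) * ennreal ((cmod (w2 n x - k x))\<^sup>2)"
          by (simp add: ennreal_plus ennreal_mult del: ennreal_plus[symmetric])
        finally show "ennreal ((cmod (w n x - (g x + c * k x)))\<^sup>2) \<le> 2 * ennreal ((cmod ?p)\<^sup>2) + ennreal (2 * (cmod c)\<^sup>2) * ennreal ((cmod (w2 n x - k x))\<^sup>2)" .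
      qed
      also have "\<dots> = ?B n" by (simp add: nn_integral_add nn_integral_cmult)
      finally show "(\<integral>\<^sup>+x. ennreal ((cmod (w n x - (g x + c * k x)))\<^sup>2) \<partial>boundary_measure \<Omega>) \<le> ?B n" .
    qed
    have "?B \<longlonglongrightarrow> 2 * 0 + ennreal (2 * (cmod c)\<^sup>2) * 0"
      by (intro tendsto_add ennreal_tendsto_cmult w1 w2) simp_all
    then have B0: "?B \<longlonglongrightarrow> 0" by simp
    show ?thesis by (rule tendsto_sandwich[OF _ le tendsto_const B0]) simp
  qed
  moreover have "w n \<in> H1 \<Omega>" "continuous_on (closure \<Omega>) (w n)" for n
    unfolding w_def using H1_comb(1)[OF w1(1)[of n] w2(1)[of n], of c] w1(2)[of n] w2(2)[of n]
    by (auto intro!: continuous_intros)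
  ultimately show ?thesis unfolding has_trace_def
    using H1_comb(1)[OF uv(1,2), of c] uv(3,4) by (intro conjI exI[of _ w]) auto
qed

lemma H1_vanishing_comb:
  assumes "u \<in> H1_vanishing \<Omega> \<Gamma>" "v \<in> H1_vanishing \<Omega> \<Gamma>"
  shows "(\<lambda>x. u x + c * v x) \<in> H1_vanishing \<Omega> \<Gamma>"
proof -
  obtain g k where g: "has_trace \<Omega> u g" "AE x in boundary_measure \<Omega>. x \<in> \<Gamma> \<longrightarrow> g x = 0"
    and k: "has_trace \<Omega> v k" "AE x in boundary_measure \<Omega>. x \<in> \<Gamma> \<longrightarrow> k x = 0"
    using assms by (auto simp: H1_vanishing_def)
  have "AE x in boundary_measure \<Omega>. x \<in> \<Gamma> \<longrightarrow> g x + c * k x = 0"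
    using g(2) k(2) by eventually_elim auto
  then show ?thesis using has_trace_comb[OF g(1) k(1), of c] by (auto simp: H1_vanishing_def has_trace_def)
qed

lemma H1_vanishing_zero: "(\<lambda>x. 0) \<in> H1_vanishing \<Omega> \<Gamma>"
proof -
  have "has_trace \<Omega> (\<lambda>x. 0) (\<lambda>x. 0)"
    unfolding has_trace_def by (intro conjI exI[of _ "\<lambda>n x. 0"]) (simp_all add: H1_zero H1_norm_zero)
  then show ?thesis using H1_zero(1) by (auto simp: H1_vanishing_def)
qed

section \<open>Finite element functions and the L^2 pairing\<close>

lemma fe_space_comb:
  assumes "u \<in> fe_space \<Omega> \<Gamma> \<T>" "v \<in> fe_space \<Omega> \<Gamma> \<T>"
  shows "(\<lambda>x. u x + c * v x) \<in> fe_space \<Omega> \<Gamma> \<T>"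
  unfolding fe_space_def mem_Collect_eq
proof (intro conjI ballI allI impI)
  show "(\<lambda>x. u x + c * v x) \<in> H1_vanishing \<Omega> \<Gamma>" using assms by (intro H1_vanishing_comb) (auto simp: fe_space_def)
  show "continuous_on (closure \<Omega>) (\<lambda>x. u x + c * v x)" using assms by (auto simp: fe_space_def intro!: continuous_intros)
  show "u x + c * v x = 0" if "x \<notin> closure \<Omega>" for x using assms that by (auto simp: fe_space_def)
  fix T assume T: "T \<in> \<T>"
  obtain L1 d1 where 1: "linear L1" "\<forall>x\<in>T. u x = L1 x + d1" using assms(1) T unfolding fe_space_def by blast
  obtain L2 d2 where 2: "linear L2" "\<forall>x\<in>T. v x = L2 x + d2" using assms(2) T unfolding fe_space_def by blast
  have "linear (\<lambda>x. L1 x + c * L2 x)"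
    using 1(1) 2(1) by (intro linear_compose_add) (auto simp: linear_iff algebra_simps scaleR_conv_of_real)
  moreover have "\<forall>x\<in>T. u x + c * v x = (L1 x + c * L2 x) + (d1 + c * d2)" using 1 2 by (simp add: algebra_simps)
  ultimately show "\<exists>L d. linear L \<and> (\<forall>x\<in>T. u x + c * v x = L x + d)"
    by (intro exI[of _ "\<lambda>x. L1 x + c * L2 x"] exI[of _ "d1 + c * d2"] conjI)
qed

lemma fe_space_zero: "(\<lambda>x. 0) \<in> fe_space \<Omega> \<Gamma> \<T>"
proof -
  have "linear (\<lambda>x :: real^'d. 0 :: complex)" by (simp add: linear_iff)
  then show ?thesis by (auto simp: fe_space_def H1_vanishing_zero intro!: exI[of _ "\<lambda>x. 0"])
qed

lemma fe_space_H1: "u \<in> fe_space \<Omega> \<Gamma> \<T> \<Longrightarrow> u \<in> H1_vanishing \<Omega> \<Gamma>" "u \<in> H1_vanishing \<Omega> \<Gamma> \<Longrightarrow> u \<in> H1 \<Omega>"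
  by (auto simp: fe_space_def H1_vanishing_def)

lemma fe_space_L2: "u \<in> fe_space \<Omega> \<Gamma> \<T> \<Longrightarrow> u \<in> L2 \<Omega>"
  using fe_space_H1 H1_weak_gradient(1) by blast

lemma L2_inner_comb:
  assumes "u \<in> L2 \<Omega>" "v \<in> L2 \<Omega>" "w \<in> L2 \<Omega>"
  shows "L2_inner \<Omega> (\<lambda>x. u x + c * v x) w = L2_inner \<Omega> u w + c * L2_inner \<Omega> v w"
    "L2_inner \<Omega> w (\<lambda>x. u x + c * v x) = L2_inner \<Omega> w u + cnj c * L2_inner \<Omega> w v"
  using L2_mult_integrable[OF assms(1) L2_cnj[OF assms(3)]] L2_mult_integrable[OF assms(2) L2_cnj[OF assms(3)]]
    L2_mult_integrable[OF assms(3) L2_cnj[OF assms(1)]] L2_mult_integrable[OF assms(3) L2_cnj[OF assms(2)]]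
  by (simp_all add: L2_inner_def distrib_right distrib_left mult.assoc mult.left_commute)

lemma L2_inner_cnj: "L2_inner \<Omega> u v = cnj (L2_inner \<Omega> v u)"
proof -
  have "L2_inner \<Omega> u v = (LINT x|lebesgue_on \<Omega>. cnj (v x * cnj (u x)))"
    unfolding L2_inner_def by (simp only: complex_cnj_mult complex_cnj_cnj mult.commute)
  also have "\<dots> = cnj (L2_inner \<Omega> v u)" unfolding L2_inner_def by (rule Bochner_Integration.integral_cnj[of "lebesgue_on \<Omega>" "\<lambda>x. v x * cnj (u x)"])
  finally show ?thesis .
qed

lemma L2_inner_self: "L2_inner \<Omega> u u = of_real (LINT x|lebesgue_on \<Omega>. (cmod (u x))\<^sup>2)"
proof -
  have "L2_inner \<Omega> u u = (LINT x|lebesgue_on \<Omega>. of_real ((cmod (u x))\<^sup>2))"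
    unfolding L2_inner_def by (simp only: complex_norm_square)
  then show ?thesis by (simp only: integral_complex_of_real)
qed

lemma L2_norm_eq: "L2_norm \<Omega> u = sqrt (Re (L2_inner \<Omega> u u))"
  by (simp add: L2_norm_def L2_inner_self)

text \<open>The set where the continuous function v differs from 0 in \<Omega> is open and
  negligible, hence empty. Continuity extends this to the closure, and \<open>fe_space\<close>
  prescribes 0 elsewhere; so definiteness holds for functions and not just for classes.\<close>

lemma L2_inner_definite:
  assumes v: "v \<in> fe_space \<Omega> \<Gamma> \<T>" and 0: "L2_inner \<Omega> v v = 0"
  shows "v = (\<lambda>x. 0)"
proof -
  have lm: "\<Omega> \<in> lmeasurable" using open_dom bounded_dom by (rule bounded_open_lmeasurable)
  then have s: "\<Omega> \<in> sets lebesgue" by (simp add: fmeasurableD)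
  have "(LINT x|lebesgue_on \<Omega>. (cmod (v x))\<^sup>2) = 0" using 0 by (simp add: L2_inner_self)
  moreover have "integrable (lebesgue_on \<Omega>) (\<lambda>x. (cmod (v x))\<^sup>2)" using fe_space_L2[OF v] by (simp add: L2_iff)
  moreover have "AE x in lebesgue_on \<Omega>. 0 \<le> (cmod (v x))\<^sup>2" by (rule AE_I2) (rule zero_le_power2)
  ultimately have "AE x in lebesgue_on \<Omega>. (cmod (v x))\<^sup>2 = 0"
    by (simp only: integral_nonneg_eq_0_iff_AE)
  then have "AE x in lebesgue_on \<Omega>. v x = 0" by (rule eventually_mono) simp
  moreover have "\<Omega> \<inter> space lebesgue \<in> sets lebesgue" using s by simp
  ultimately have "AE x in lebesgue. x \<in> \<Omega> \<longrightarrow> v x = 0" by (simp only: AE_restrict_space_iff)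
  then obtain N where N: "N \<in> null_sets lebesgue" "{x \<in> space lebesgue. \<not> (x \<in> \<Omega> \<longrightarrow> v x = 0)} \<subseteq> N"
    unfolding eventually_ae_filter by blast
  define S where "S = {x\<in>\<Omega>. v x \<noteq> 0}"
  have "S \<subseteq> N" using N(2) by (auto simp: S_def)
  moreover have "negligible N" using N(1) by (simp only: negligible_iff_null_sets)
  ultimately have "negligible S" using negligible_subset by blast
  moreover have "open S"
  proof -
    have "continuous_on (closure \<Omega>) v" using v by (simp add: fe_space_def)
    then have "continuous_on \<Omega> v" using closure_subset by (rule continuous_on_subset)
    then have "open (\<Omega> \<inter> v -` (- {0}))" using open_dom open_delete[OF open_UNIV, of "0 :: complex"]
      unfolding Compl_eq_Diff_UNIV by (rule continuous_open_preimage)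
    moreover have "\<Omega> \<inter> v -` (- {0}) = S" by (auto simp: S_def)
    ultimately show ?thesis by simp
  qed
  ultimately have "S = {}" using open_not_negligible by (metis (full_types))
  then have 0: "v x = 0" if "x \<in> \<Omega>" for x using that by (auto simp: S_def)
  have "v x = 0" if "x \<in> closure \<Omega>" for x
  proof (rule continuous_constant_on_closure[OF _ 0 that])
    show "continuous_on (closure \<Omega>) v" using v by (simp add: fe_space_def)
  qed
  moreover have "v x = 0" if "x \<notin> closure \<Omega>" for x using v that by (simp add: fe_space_def)
  ultimately show ?thesis by (intro ext) (rule case_split)
qed

text \<open>The points are the vertices of all simplices: on a simplex the function is affine, so
  its values are convex combinations of the vertex values.\<close>

lemma fe_space_finite_determination:
  assumes "triangulation_of \<Omega> \<T>"
  shows "\<exists>X. finite X \<and> (\<forall>v\<in>fe_space \<Omega> \<Gamma> \<T>. (\<forall>x\<in>X. v x = 0) \<longrightarrow> v = (\<lambda>x. 0))"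
proof -
  have fin: "finite \<T>" and un: "\<Union>\<T> = closure \<Omega>" and "\<forall>T\<in>\<T>. int CARD('d) simplex T"
    using assms by (auto simp: triangulation_of_def triangulation_def)
  then have "\<forall>T\<in>\<T>. \<exists>C. finite C \<and> T = convex hull C"
    unfolding simplex_def using aff_independent_finite by blast
  from bchoice[OF this] obtain C where C': "\<forall>T\<in>\<T>. finite (C T) \<and> T = convex hull (C T)" by blast
  then have C: "finite (C T)" "T = convex hull (C T)" if "T \<in> \<T>" for T using bspec[OF C' that] by blast+
  have "v = (\<lambda>x. 0)" if v: "v \<in> fe_space \<Omega> \<Gamma> \<T>" "\<forall>x\<in>(\<Union>T\<in>\<T>. C T). v x = 0" for v
  proof
    fix x
    show "v x = 0"
    proof (cases "x \<in> closure \<Omega>")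
      case True
      then obtain T where T: "T \<in> \<T>" "x \<in> T" using un by blast
      obtain L d where L: "linear L" "\<And>x. x \<in> T \<Longrightarrow> v x = L x + d" using v(1) T(1) unfolding fe_space_def by blast
      have "x \<in> convex hull (C T)" using C(2)[OF T(1)] T(2) by blast
      then obtain t where t: "sum t (C T) = 1" "x = (\<Sum>y\<in>C T. t y *\<^sub>R y)"
        unfolding convex_hull_finite[OF C(1)[OF T(1)]] by blast
      have CT: "y \<in> T" if "y \<in> C T" for y using hull_subset[of "C T" convex] C(2)[OF T(1)] that by blast
      have "v x = (\<Sum>y\<in>C T. t y *\<^sub>R L y) + (\<Sum>y\<in>C T. t y) *\<^sub>R d"
        using L(2)[OF T(2)] t L(1) by (simp add: linear_sum linear_scale)
      also have "\<dots> = (\<Sum>y\<in>C T. t y *\<^sub>R (L y + d))"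
        by (simp add: scaleR_right_distrib sum.distrib scaleR_sum_left)
      also have "\<dots> = (\<Sum>y\<in>C T. t y *\<^sub>R v y)" using L(2) CT by (intro sum.cong) auto
      also have "\<dots> = 0" using v(2) T(1) by (intro sum.neutral) auto
      finally show ?thesis .
    next
      case False
      then show ?thesis using v(1) by (auto simp: fe_space_def)
    qed
  qed
  moreover have "finite (\<Union>T\<in>\<T>. C T)" using fin C(1) by blast
  ultimately show ?thesis by blast
qed

end

section \<open>Orthonormal expansions and the sesquilinear form\<close>

text \<open>The carrier is a parameter because the Gram-Schmidt induction passes to subspaces of
  functions that vanish at given points.\<close>

locale function_inner_space =
  fixes W :: "('x \<Rightarrow> complex) set" and ip :: "('x \<Rightarrow> complex) \<Rightarrow> ('x \<Rightarrow> complex) \<Rightarrow> complex"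
  assumes zero_mem: "(\<lambda>x. 0) \<in> W"
    and comb_mem: "\<And>u v c. u \<in> W \<Longrightarrow> v \<in> W \<Longrightarrow> (\<lambda>x. u x + c * v x) \<in> W"
    and ip_comb: "\<And>u v w c. u \<in> W \<Longrightarrow> v \<in> W \<Longrightarrow> w \<in> W \<Longrightarrow> ip (\<lambda>x. u x + c * v x) w = ip u w + c * ip v w"
    and ip_cnj: "\<And>u w. u \<in> W \<Longrightarrow> w \<in> W \<Longrightarrow> ip u w = cnj (ip w u)"
    and ip_nonneg: "\<And>u. u \<in> W \<Longrightarrow> 0 \<le> Re (ip u u)"
    and ip_definite: "\<And>u. u \<in> W \<Longrightarrow> ip u u = 0 \<Longrightarrow> u = (\<lambda>x. 0)"
begin

lemma ip_comb_right:
  assumes "u \<in> W" "v \<in> W" "w \<in> W"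
  shows "ip w (\<lambda>x. u x + c * v x) = ip w u + cnj c * ip w v"
  using ip_comb[OF assms, of c] ip_cnj[OF assms(3) comb_mem[OF assms(1,2)], of c] ip_cnj[OF assms(3,1)] ip_cnj[OF assms(3,2)]
  by (simp only: complex_cnj_add complex_cnj_mult)

text \<open>With \<open>h\<close> the identity this is linearity, with \<open>h\<close> the
  conjugation antilinearity, so both arguments of a sesquilinear form are served.\<close>

lemma additive_sum:
  assumes "finite B" "B \<subseteq> W"
    and \<phi>: "\<And>u v c. u \<in> W \<Longrightarrow> v \<in> W \<Longrightarrow> \<phi> (\<lambda>x. u x + c * v x) = \<phi> u + h c * (\<phi> v :: complex)" and h: "h 0 = 0"
  shows "(\<lambda>x. \<Sum>e\<in>B. c e * e x) \<in> W \<and> \<phi> (\<lambda>x. \<Sum>e\<in>B. c e * e x) = \<phi> (\<lambda>x. 0) + (\<Sum>e\<in>B. h (c e) * \<phi> e)"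
  using assms(1,2)
proof (induction B rule: finite_induct)
  case empty
  then show ?case by (simp add: zero_mem)
next
  case (insert b B)
  let ?s = "\<lambda>x. \<Sum>e\<in>B. c e * e x"
  have eq: "(\<lambda>x. \<Sum>e\<in>insert b B. c e * e x) = (\<lambda>x. ?s x + c b * b x)"
    using insert.hyps by (simp add: add.commute)
  have IH: "?s \<in> W" "\<phi> ?s = \<phi> (\<lambda>x. 0) + (\<Sum>e\<in>B. h (c e) * \<phi> e)" "b \<in> W" using insert by auto
  show ?case unfolding eq using comb_mem[OF IH(1,3), of "c b"] \<phi>[OF IH(1,3), of "c b"] IH(2) insert.hyps
    by simp
qed

lemma additive_zero:
  assumes \<phi>: "\<And>u v c. u \<in> W \<Longrightarrow> v \<in> W \<Longrightarrow> \<phi> (\<lambda>x. u x + c * v x) = \<phi> u + h c * (\<phi> v :: complex)" and h: "h 1 = 1"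
  shows "\<phi> (\<lambda>x. 0) = 0"
  using \<phi>[OF zero_mem zero_mem, of 1] h by simp

lemma sum_mem: "finite B \<Longrightarrow> B \<subseteq> W \<Longrightarrow> (\<lambda>x. \<Sum>e\<in>B. c e * e x) \<in> W"
  using additive_sum[of B "\<lambda>_. 0" "\<lambda>c. 0" c] by simp

lemma ip_sum:
  assumes "finite B" "B \<subseteq> W" "w \<in> W"
  shows "ip (\<lambda>x. \<Sum>e\<in>B. c e * e x) w = (\<Sum>e\<in>B. c e * ip e w)"
  using additive_sum[of B "\<lambda>u. ip u w" "\<lambda>c. c" c] additive_zero[of "\<lambda>u. ip u w" "\<lambda>c. c"] assms ip_comb by simp

text \<open>One Gram-Schmidt step. \<open>W0\<close> is the kernel of evaluation at a, so its
  codimension is at most 1; subtracting from u its expansion in \<open>B\<close> leaves a vector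
  orthogonal to \<open>W0\<close>, whose normalisation joins the basis.\<close>

lemma expansion_insert:
  fixes a :: 'x
  defines "W0 \<equiv> {v \<in> W. v a = 0}"
  assumes B: "finite B" "B \<subseteq> W0" and ex: "\<And>v. v \<in> W0 \<Longrightarrow> v = (\<lambda>x. \<Sum>e\<in>B. ip v e * e x)"
  shows "\<exists>B. finite B \<and> B \<subseteq> W \<and> (\<forall>v\<in>W. v = (\<lambda>x. \<Sum>e\<in>B. ip v e * e x))"
proof (cases "W \<subseteq> W0")
  case True
  then show ?thesis using B ex by (intro exI[of _ B]) (auto simp: W0_def)
next
  case False
  have BW: "B \<subseteq> W" using B(2) by (auto simp: W0_def)
  from False obtain u where u: "u \<in> W" "u a \<noteq> 0" by (auto simp: W0_def)
  define s where "s = (\<lambda>x. \<Sum>e\<in>B. ip u e * e x)"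
  define q where "q = (\<lambda>x. u x + (- 1) * s x)"
  have s: "s \<in> W" unfolding s_def using B(1) BW by (rule sum_mem)
  have q: "q \<in> W" unfolding q_def by (rule comb_mem[OF u(1) s])
  have "s a = 0" unfolding s_def using B(2) by (intro sum.neutral) (auto simp: W0_def)
  then have qa: "q a \<noteq> 0" using u(2) by (simp add: q_def)
  \<comment> \<open>Expanding v in \<open>B\<close> and using conjugate symmetry, the pairing of
    \<open>s\<close> with v equals that of u with v.\<close>
  have orth: "ip q v = 0" if v: "v \<in> W0" for v
  proof -
    have vW: "v \<in> W" using v by (simp add: W0_def)
    have "ip s v = (\<Sum>e\<in>B. ip u e * ip e v)" unfolding s_def by (rule ip_sum[OF B(1) BW vW])
    also have "\<dots> = (\<Sum>e\<in>B. cnj (ip v e * ip e u))"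
    proof (rule sum.cong[OF refl])
      fix e assume "e \<in> B"
      then have e: "e \<in> W" using BW by blast
      show "ip u e * ip e v = cnj (ip v e * ip e u)"
        using ip_cnj[OF u(1) e] ip_cnj[OF e vW] by (simp add: mult.commute)
    qed
    also have "\<dots> = cnj (ip (\<lambda>x. \<Sum>e\<in>B. ip v e * e x) u)" unfolding ip_sum[OF B(1) BW u(1)] cnj_sum ..
    also have "\<dots> = ip u v" using ex[OF v] ip_cnj[OF u(1) vW] by simp
    finally have "ip s v = ip u v" .
    then show ?thesis using ip_comb[OF u(1) s vW, of "- 1"] by (simp add: q_def)
  qed
  define r where "r = sqrt (Re (ip q q))"
  have "ip q q \<noteq> 0"
  proof
    assume "ip q q = 0"
    then have "q = (\<lambda>x. 0)" by (rule ip_definite[OF q])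
    then show False using qa by simp
  qed
  moreover have "Im (ip q q) = 0" using arg_cong[OF ip_cnj[OF q q], of Im] by simp
  ultimately have r: "ip q q = of_real r * of_real r" "r \<noteq> 0"
    using ip_nonneg[OF q] by (auto simp: r_def complex_eq_iff)
  define e0 where "e0 = (\<lambda>x. 0 + (1 / of_real r) * q x)"
  have e0: "e0 \<in> W" unfolding e0_def by (rule comb_mem[OF zero_mem q])
  have "e0 a \<noteq> 0" using qa r(2) by (simp add: e0_def)
  then have nB: "e0 \<notin> B" using B(2) by (auto simp: W0_def)
  have "v = (\<lambda>x. \<Sum>e\<in>insert e0 B. ip v e * e x)" if v: "v \<in> W" for v
  proof -
    \<comment> \<open>Matching the values at a splits v into an element of \<open>W0\<close> and a
      multiple of q.\<close>
    define c where "c = v a / q a"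
    define v0 where "v0 = (\<lambda>x. v x + (- c) * q x)"
    have v0W: "v0 \<in> W" unfolding v0_def by (rule comb_mem[OF v q])
    then have v0: "v0 \<in> W0" using qa by (simp add: W0_def v0_def c_def)
    have veq: "v = (\<lambda>x. v0 x + c * q x)" by (simp add: v0_def)
    have 1: "ip v e = ip v0 e" if "e \<in> B" for e
    proof -
      have e: "e \<in> W0" "e \<in> W" using that B(2) BW by auto
      have "ip v e = ip v0 e + c * ip q e" using ip_comb[OF v0W q e(2), of c] veq by simp
      then show ?thesis using orth[OF e(1)] by simp
    qed
    have "ip v q = ip v0 q + c * ip q q" using ip_comb[OF v0W q q, of c] veq by simp
    also have "ip v0 q = 0" using orth[OF v0] ip_cnj[OF v0W q] by simp
    finally have vq: "ip v q = c * (of_real r * of_real r)" using r(1) by simp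
    have "ip v (\<lambda>x. 0) = 0" using ip_comb_right[OF zero_mem zero_mem v, of 1] by simp
    then have "ip v e0 = c * of_real r"
      using ip_comb_right[OF zero_mem q v, of "1 / of_real r"] vq r(2) by (simp add: e0_def)
    then have 2: "ip v e0 * e0 x = c * q x" for x using r(2) by (simp add: e0_def)
    have "v x = (\<Sum>e\<in>insert e0 B. ip v e * e x)" for x
    proof -
      have "v x = v0 x + c * q x" by (simp add: v0_def)
      also have "v0 x = (\<Sum>e\<in>B. ip v0 e * e x)" using fun_cong[OF ex[OF v0], of x] .
      also have "\<dots> = (\<Sum>e\<in>B. ip v e * e x)" using 1 by (intro sum.cong) auto
      finally show ?thesis using nB B(1) 2 by (simp add: add.commute)
    qed
    then show ?thesis by (rule ext)
  qed
  moreover have "finite (insert e0 B)" "insert e0 B \<subseteq> W" using B(1) BW e0 by auto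
  ultimately show ?thesis by blast
qed

text \<open>The representer has the values of \<phi> on the basis as coefficients; they appear
  without conjugation because \<phi> is antilinear.\<close>

lemma riesz:
  assumes B: "finite B" "B \<subseteq> W" and ex: "\<And>v. v \<in> W \<Longrightarrow> v = (\<lambda>x. \<Sum>e\<in>B. ip v e * e x)"
    and \<phi>: "\<And>u v c. u \<in> W \<Longrightarrow> v \<in> W \<Longrightarrow> \<phi> (\<lambda>x. u x + c * v x) = \<phi> u + cnj c * \<phi> v"
  shows "\<exists>g. g \<in> W \<and> (\<forall>v\<in>W. ip g v = \<phi> v)"
proof (intro exI conjI ballI)
  show "(\<lambda>x. \<Sum>e\<in>B. \<phi> e * e x) \<in> W" using B by (rule sum_mem)
  fix v assume v: "v \<in> W"
  have "ip (\<lambda>x. \<Sum>e\<in>B. \<phi> e * e x) v = (\<Sum>e\<in>B. cnj (ip v e) * \<phi> e)"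
    unfolding ip_sum[OF B v]
  proof (rule sum.cong[OF refl])
    fix e assume "e \<in> B"
    then have "ip e v = cnj (ip v e)" using ip_cnj v B(2) by blast
    then show "\<phi> e * ip e v = cnj (ip v e) * \<phi> e" by simp
  qed
  also have "\<dots> = \<phi> (\<lambda>x. \<Sum>e\<in>B. ip v e * e x)"
    using additive_sum[of B \<phi> cnj "\<lambda>e. ip v e"] additive_zero[of \<phi> cnj] B \<phi> by simp
  also have "\<dots> = \<phi> v" using arg_cong[OF ex[OF v], of \<phi>] by simp
  finally show "ip (\<lambda>x. \<Sum>e\<in>B. \<phi> e * e x) v = \<phi> v" .
qed

lemma ip_eqI:
  assumes "g \<in> W" "k \<in> W" "\<And>v. v \<in> W \<Longrightarrow> ip g v = ip k v"
  shows "g = k"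
proof -
  let ?d = "\<lambda>x. g x + (- 1) * k x"
  have d: "?d \<in> W" by (rule comb_mem[OF assms(1,2)])
  have "ip ?d ?d = 0" using ip_comb[OF assms(1,2) d, of "- 1"] assms(3)[OF d] by simp
  then have "?d = (\<lambda>x. 0)" by (rule ip_definite[OF d])
  then have "g x + (- 1) * k x = 0" for x by (rule fun_cong)
  then show ?thesis by (simp add: fun_eq_iff)
qed

end

text \<open>Functions that vanish at one point are determined by the remaining ones, and with no
  point left the space is zero; so the induction runs over the points with the space
  varying.\<close>

lemma expansion_exists:
  assumes "finite X" "function_inner_space W ip" "\<And>v. v \<in> W \<Longrightarrow> (\<forall>x\<in>X. v x = 0) \<Longrightarrow> v = (\<lambda>x. 0)"
  shows "\<exists>B. finite B \<and> B \<subseteq> W \<and> (\<forall>v\<in>W. v = (\<lambda>x. \<Sum>e\<in>B. ip v e * e x))"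
  using assms
proof (induction X arbitrary: W rule: finite_induct)
  case empty
  then show ?case by (intro exI[of _ "{}"]) auto
next
  case (insert a X)
  interpret function_inner_space W ip by fact
  have "function_inner_space {v \<in> W. v a = 0} ip"
    by unfold_locales (auto simp: zero_mem comb_mem ip_comb ip_nonneg intro: ip_cnj ip_definite)
  then have "\<exists>B. finite B \<and> B \<subseteq> {v \<in> W. v a = 0} \<and> (\<forall>v\<in>{v \<in> W. v a = 0}. v = (\<lambda>x. \<Sum>e\<in>B. ip v e * e x))"
    using insert.prems(2) by (intro insert.IH) auto
  then obtain B where "finite B" "B \<subseteq> {v \<in> W. v a = 0}" "\<And>v. v \<in> {v \<in> W. v a = 0} \<Longrightarrow> v = (\<lambda>x. \<Sum>e\<in>B. ip v e * e x)"
    by blast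
  then show ?case by (rule expansion_insert)
qed

text \<open>\<open>LEAST\<close> on the reals is meaningful only if the infimum is attained. It is:
  where Re > 0 every admissible number bounds the quotient \<bar>Im\<bar>/Re, and where Re = 0 the
  bound by \<open>K\<close> forces Im = 0.\<close>

lemma form_index_bound:
  assumes nonneg: "\<And>v. v \<in> V \<Longrightarrow> 0 \<le> Re (A v v)"
    and K: "0 \<le> K" "\<And>v. v \<in> V \<Longrightarrow> cmod (A v v) \<le> K * Re (A v v)"
  shows "0 \<le> form_index A V \<and> (\<forall>v\<in>V. \<bar>Im (A v v)\<bar> \<le> form_index A V * Re (A v v))"
proof -
  define S where "S = {\<beta>. 0 \<le> \<beta> \<and> (\<forall>v\<in>V. \<bar>Im (A v v)\<bar> \<le> \<beta> * Re (A v v))}"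
  have im: "cmod (im_form A v v) = \<bar>Im (A v v)\<bar>" for v
  proof -
    have "of_real (2 * y) * \<i> = of_real y * (2 * \<i>)" for y by simp
    then have "im_form A v v = of_real (Im (A v v))"
      unfolding im_form_def adj_form_def complex_diff_cnj by (subst nonzero_divide_eq_eq) simp_all
    then show ?thesis by (simp only: norm_of_real)
  qed
  have re: "Re (re_form A v v) = Re (A v v)" for v by (simp add: re_form_def adj_form_def)
  have "K \<in> S" using K abs_Im_le_cmod order_trans by (fastforce simp: S_def)
  have bdd: "bdd_below S" by (auto simp: S_def bdd_below_def)
  have *: "0 \<le> Inf S \<and> (\<forall>v\<in>V. \<bar>Im (A v v)\<bar> \<le> Inf S * Re (A v v))"
  proof (intro conjI ballI)
    show "0 \<le> Inf S" using \<open>K \<in> S\<close> by (intro cInf_greatest) (auto simp: S_def)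
    fix v assume v: "v \<in> V"
    show "\<bar>Im (A v v)\<bar> \<le> Inf S * Re (A v v)"
    proof (cases "Re (A v v) = 0")
      case True
      then show ?thesis using \<open>K \<in> S\<close> v by (force simp: S_def)
    next
      case False
      then have pos: "0 < Re (A v v)" using nonneg[OF v] by simp
      have "\<bar>Im (A v v)\<bar> / Re (A v v) \<le> Inf S"
        using \<open>K \<in> S\<close> v pos by (intro cInf_greatest) (auto simp: S_def divide_le_eq)
      then show ?thesis using pos by (simp add: divide_le_eq)
    qed
  qed
  have e: "form_index A V = Inf S"
    unfolding form_index_def im re
  proof (rule Least_equality)
    show "0 \<le> Inf S \<and> (\<forall>v\<in>V. \<bar>Im (A v v)\<bar> \<le> Inf S * Re (A v v))" by (rule *)
    show "Inf S \<le> y" if "0 \<le> y \<and> (\<forall>v\<in>V. \<bar>Im (A v v)\<bar> \<le> y * Re (A v v))" for y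
      using that by (intro cInf_lower bdd) (simp add: S_def)
  qed
  show ?thesis unfolding e by (rule *)
qed

text \<open>Stated for arbitrary index functions so that it applies to the values of the weak
  gradients at a single point, once the almost everywhere identity has been inserted there.\<close>

lemma form_integrand_algebra:
  fixes G H S a :: "'i \<Rightarrow> complex" and C :: "'i \<Rightarrow> 'i \<Rightarrow> complex"
  shows "(\<Sum>i\<in>UNIV. \<Sum>j\<in>UNIV. (G i + c * H i) * C i j * cnj (S j)) +
      (\<Sum>i\<in>UNIV. a i * (G i + c * H i)) * cnj s + r * (u + c * v) * cnj s =
    ((\<Sum>i\<in>UNIV. \<Sum>j\<in>UNIV. G i * C i j * cnj (S j)) + (\<Sum>i\<in>UNIV. a i * G i) * cnj s + r * u * cnj s) +
    c * ((\<Sum>i\<in>UNIV. \<Sum>j\<in>UNIV. H i * C i j * cnj (S j)) + (\<Sum>i\<in>UNIV. a i * H i) * cnj s + r * v * cnj s)"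
    and "(\<Sum>i\<in>UNIV. \<Sum>j\<in>UNIV. S i * C i j * cnj (G j + c * H j)) +
      (\<Sum>i\<in>UNIV. a i * S i) * cnj (u + c * v) + r * s * cnj (u + c * v) =
    ((\<Sum>i\<in>UNIV. \<Sum>j\<in>UNIV. S i * C i j * cnj (G j)) + (\<Sum>i\<in>UNIV. a i * S i) * cnj u + r * s * cnj u) +
    cnj c * ((\<Sum>i\<in>UNIV. \<Sum>j\<in>UNIV. S i * C i j * cnj (H j)) + (\<Sum>i\<in>UNIV. a i * S i) * cnj v + r * s * cnj v)"
proof -
  have alg: "(P + c * P') + (Q + c * Q') * t + r * (u + c * v) * t = (P + Q * t + r * u * t) + c * (P' + Q' * t + r * v * t)"
    for P P' Q Q' t :: complex by (simp add: algebra_simps)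
  have alg': "(P + k * P') + Q * (t + k * t') + q * (t + k * t') = (P + Q * t + q * t) + k * (P' + Q * t' + q * t')"
    for P P' Q q k t t' :: complex by (simp add: algebra_simps)
  have 1: "(\<Sum>i\<in>UNIV. \<Sum>j\<in>UNIV. (G i + c * H i) * C i j * cnj (S j)) =
      (\<Sum>i\<in>UNIV. \<Sum>j\<in>UNIV. G i * C i j * cnj (S j)) + c * (\<Sum>i\<in>UNIV. \<Sum>j\<in>UNIV. H i * C i j * cnj (S j))"
    unfolding sum_distrib_left sum.distrib[symmetric] by (intro sum.cong refl) (simp only: distrib_right mult.assoc)
  have 2: "(\<Sum>i\<in>UNIV. a i * (G i + c * H i)) = (\<Sum>i\<in>UNIV. a i * G i) + c * (\<Sum>i\<in>UNIV. a i * H i)"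
    unfolding sum_distrib_left sum.distrib[symmetric] by (intro sum.cong refl) (simp only: distrib_left mult.left_commute)
  have 3: "(\<Sum>i\<in>UNIV. \<Sum>j\<in>UNIV. S i * C i j * cnj (G j + c * H j)) =
      (\<Sum>i\<in>UNIV. \<Sum>j\<in>UNIV. S i * C i j * cnj (G j)) + cnj c * (\<Sum>i\<in>UNIV. \<Sum>j\<in>UNIV. S i * C i j * cnj (H j))"
    unfolding sum_distrib_left sum.distrib[symmetric]
    by (intro sum.cong refl) (simp only: distrib_left complex_cnj_add complex_cnj_mult mult.left_commute)
  show "(\<Sum>i\<in>UNIV. \<Sum>j\<in>UNIV. (G i + c * H i) * C i j * cnj (S j)) +
      (\<Sum>i\<in>UNIV. a i * (G i + c * H i)) * cnj s + r * (u + c * v) * cnj s =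
    ((\<Sum>i\<in>UNIV. \<Sum>j\<in>UNIV. G i * C i j * cnj (S j)) + (\<Sum>i\<in>UNIV. a i * G i) * cnj s + r * u * cnj s) +
    c * ((\<Sum>i\<in>UNIV. \<Sum>j\<in>UNIV. H i * C i j * cnj (S j)) + (\<Sum>i\<in>UNIV. a i * H i) * cnj s + r * v * cnj s)"
    unfolding 1 2 by (rule alg)
  show "(\<Sum>i\<in>UNIV. \<Sum>j\<in>UNIV. S i * C i j * cnj (G j + c * H j)) +
      (\<Sum>i\<in>UNIV. a i * S i) * cnj (u + c * v) + r * s * cnj (u + c * v) =
    ((\<Sum>i\<in>UNIV. \<Sum>j\<in>UNIV. S i * C i j * cnj (G j)) + (\<Sum>i\<in>UNIV. a i * S i) * cnj u + r * s * cnj u) +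
    cnj c * ((\<Sum>i\<in>UNIV. \<Sum>j\<in>UNIV. S i * C i j * cnj (H j)) + (\<Sum>i\<in>UNIV. a i * S i) * cnj v + r * s * cnj v)"
    unfolding 3 unfolding complex_cnj_add complex_cnj_mult by (rule alg')
qed

section \<open>Sesquilinearity of the form and the discrete operator\<close>

context bounded_open
begin

text \<open>Integrability is assumed of every integrand because the Bochner integral of a
  non-integrable function is 0, which would destroy additivity. The integrands are related almost
  everywhere, through the weak gradients.\<close>

lemma sesq_form_comb:
  assumes H: "u \<in> H1 \<Omega>" "v \<in> H1 \<Omega>"
    and 1: "integrable (lebesgue_on \<Omega>) (form_integrand \<Omega> C a r u w)" "integrable (lebesgue_on \<Omega>) (form_integrand \<Omega> C a r v w)"
      "integrable (lebesgue_on \<Omega>) (form_integrand \<Omega> C a r (\<lambda>x. u x + c * v x) w)"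
    and 2: "integrable (lebesgue_on \<Omega>) (form_integrand \<Omega> C a r w u)" "integrable (lebesgue_on \<Omega>) (form_integrand \<Omega> C a r w v)"
      "integrable (lebesgue_on \<Omega>) (form_integrand \<Omega> C a r w (\<lambda>x. u x + c * v x))"
  shows "sesq_form \<Omega> C a r (\<lambda>x. u x + c * v x) w = sesq_form \<Omega> C a r u w + c * sesq_form \<Omega> C a r v w"
    "sesq_form \<Omega> C a r w (\<lambda>x. u x + c * v x) = sesq_form \<Omega> C a r w u + cnj c * sesq_form \<Omega> C a r w v"
proof -
  let ?F = "form_integrand \<Omega> C a r"
  have lin: "(LINT x|lebesgue_on \<Omega>. f x) = (LINT x|lebesgue_on \<Omega>. p x) + k * (LINT x|lebesgue_on \<Omega>. q x)"
    if i: "integrable (lebesgue_on \<Omega>) f" "integrable (lebesgue_on \<Omega>) p" "integrable (lebesgue_on \<Omega>) q"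
      and ae: "AE x in lebesgue_on \<Omega>. f x = p x + k * q x" for f p q :: "real^'d \<Rightarrow> complex" and k
  proof -
    have kq: "integrable (lebesgue_on \<Omega>) (\<lambda>x. k * q x)" using i(3) by (rule integrable_mult_right)
    have "(LINT x|lebesgue_on \<Omega>. f x) = (LINT x|lebesgue_on \<Omega>. p x + k * q x)"
      by (rule integral_cong_AE[OF borel_measurable_integrable[OF i(1)]
        borel_measurable_integrable[OF Bochner_Integration.integrable_add[OF i(2) kq]] ae])
    also have "\<dots> = (LINT x|lebesgue_on \<Omega>. p x) + (LINT x|lebesgue_on \<Omega>. k * q x)"
      by (rule Bochner_Integration.integral_add[OF i(2) kq])
    finally show ?thesis by (simp only: integral_mult_right_zero)
  qed
  note g = H1_comb(2)[OF H, of c]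
  show "sesq_form \<Omega> C a r (\<lambda>x. u x + c * v x) w = sesq_form \<Omega> C a r u w + c * sesq_form \<Omega> C a r v w"
    unfolding sesq_form_def
  proof (rule lin[OF 1(3) 1(1) 1(2)])
    show "AE x in lebesgue_on \<Omega>. ?F (\<lambda>x. u x + c * v x) w x = ?F u w x + c * ?F v w x"
      using g
    proof eventually_elim
      case (elim x)
      show ?case unfolding form_integrand_def elim vec_lambda_beta by (rule form_integrand_algebra(1))
    qed
  qed
  show "sesq_form \<Omega> C a r w (\<lambda>x. u x + c * v x) = sesq_form \<Omega> C a r w u + cnj c * sesq_form \<Omega> C a r w v"
    unfolding sesq_form_def
  proof (rule lin[OF 2(3) 2(1) 2(2)])
    show "AE x in lebesgue_on \<Omega>. ?F w (\<lambda>x. u x + c * v x) x = ?F w u x + cnj c * ?F w v x"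
      using g
    proof eventually_elim
      case (elim x)
      show ?case unfolding form_integrand_def elim vec_lambda_beta by (rule form_integrand_algebra(2))
    qed
  qed
qed

lemma L2_inner_self_nonneg: "0 \<le> Re (L2_inner \<Omega> u u)"
  unfolding L2_inner_self Re_complex_of_real by (rule integral_nonneg_AE) simp

lemma fe_space_inner_space: "function_inner_space (fe_space \<Omega> \<Gamma> \<T>) (L2_inner \<Omega>)"
proof (rule function_inner_space.intro)
  show "(\<lambda>x. 0) \<in> fe_space \<Omega> \<Gamma> \<T>" by (rule fe_space_zero)
  show "L2_inner \<Omega> u w = cnj (L2_inner \<Omega> w u)" for u w by (rule L2_inner_cnj)
  show "0 \<le> Re (L2_inner \<Omega> u u)" for u by (rule L2_inner_self_nonneg)
  fix u v w assume u: "u \<in> fe_space \<Omega> \<Gamma> \<T>"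
  show "L2_inner \<Omega> u u = 0 \<Longrightarrow> u = (\<lambda>x. 0)" by (rule L2_inner_definite[OF u])
  assume v: "v \<in> fe_space \<Omega> \<Gamma> \<T>"
  show "(\<lambda>x. u x + c * v x) \<in> fe_space \<Omega> \<Gamma> \<T>" for c by (rule fe_space_comb[OF u v])
  assume w: "w \<in> fe_space \<Omega> \<Gamma> \<T>"
  show "L2_inner \<Omega> (\<lambda>x. u x + c * v x) w = L2_inner \<Omega> u w + c * L2_inner \<Omega> v w" for c
    by (rule L2_inner_comb(1)[OF fe_space_L2[OF u] fe_space_L2[OF v] fe_space_L2[OF w]])
qed

end

context bounded_open
begin

text \<open>Existence together with uniqueness, so that the \<open>THE\<close> in
  \<open>discrete_operator\<close> and \<open>L2_projection\<close> denotes the intended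
  function.\<close>

lemma fe_riesz:
  assumes tri: "triangulation_of \<Omega> \<T>"
    and \<phi>: "\<And>u v c. u \<in> fe_space \<Omega> \<Gamma> \<T> \<Longrightarrow> v \<in> fe_space \<Omega> \<Gamma> \<T> \<Longrightarrow> \<phi> (\<lambda>x. u x + c * v x) = \<phi> u + cnj c * \<phi> v"
  shows "\<exists>!g. g \<in> fe_space \<Omega> \<Gamma> \<T> \<and> (\<forall>v\<in>fe_space \<Omega> \<Gamma> \<T>. L2_inner \<Omega> g v = \<phi> v)"
proof -
  interpret fe: function_inner_space "fe_space \<Omega> \<Gamma> \<T>" "L2_inner \<Omega>" by (rule fe_space_inner_space)
  obtain X where X: "finite X" "\<forall>v\<in>fe_space \<Omega> \<Gamma> \<T>. (\<forall>x\<in>X. v x = 0) \<longrightarrow> v = (\<lambda>x. 0)"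
    using fe_space_finite_determination[OF tri, of \<Gamma>] by (elim exE conjE)
  have "\<exists>B. finite B \<and> B \<subseteq> fe_space \<Omega> \<Gamma> \<T> \<and> (\<forall>v\<in>fe_space \<Omega> \<Gamma> \<T>. v = (\<lambda>x. \<Sum>e\<in>B. L2_inner \<Omega> v e * e x))"
    by (rule expansion_exists[OF X(1) fe_space_inner_space]) (rule mp[OF bspec[OF X(2)]])
  then obtain B where B: "finite B" "B \<subseteq> fe_space \<Omega> \<Gamma> \<T>"
    "\<forall>v\<in>fe_space \<Omega> \<Gamma> \<T>. v = (\<lambda>x. \<Sum>e\<in>B. L2_inner \<Omega> v e * e x)"
    by (elim exE conjE)
  have "\<exists>g. g \<in> fe_space \<Omega> \<Gamma> \<T> \<and> (\<forall>v\<in>fe_space \<Omega> \<Gamma> \<T>. L2_inner \<Omega> g v = \<phi> v)"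
    by (rule fe.riesz[OF B(1,2) bspec[OF B(3)] \<phi>])
  then show ?thesis
  proof (elim exE conjE, intro ex1I conjI)
    fix g k assume g: "g \<in> fe_space \<Omega> \<Gamma> \<T>" "\<forall>v\<in>fe_space \<Omega> \<Gamma> \<T>. L2_inner \<Omega> g v = \<phi> v"
    show "g \<in> fe_space \<Omega> \<Gamma> \<T>" "\<forall>v\<in>fe_space \<Omega> \<Gamma> \<T>. L2_inner \<Omega> g v = \<phi> v" by fact+
    assume k: "k \<in> fe_space \<Omega> \<Gamma> \<T> \<and> (\<forall>v\<in>fe_space \<Omega> \<Gamma> \<T>. L2_inner \<Omega> k v = \<phi> v)"
    show "k = g"
      by (rule fe.ip_eqI[OF conjunct1[OF k] g(1)]) (use k g(2) in simp)
  qed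
qed

lemma L2_projection_mem:
  assumes "triangulation_of \<Omega> \<T>" "f \<in> L2 \<Omega>"
  shows "L2_projection \<Omega> (fe_space \<Omega> \<Gamma> \<T>) f \<in> fe_space \<Omega> \<Gamma> \<T>"
proof -
  have "\<exists>!g. g \<in> fe_space \<Omega> \<Gamma> \<T> \<and> (\<forall>v\<in>fe_space \<Omega> \<Gamma> \<T>. L2_inner \<Omega> g v = L2_inner \<Omega> f v)"
    by (rule fe_riesz[OF assms(1)]) (rule L2_inner_comb(2)[OF fe_space_L2 fe_space_L2 assms(2)])
  from theI'[OF this] show ?thesis unfolding L2_projection_def by (rule conjunct1)
qed

text \<open>The L^2 norm is at most the H^1 norm, so coercivity passes to the L^2 pairing with the
  same constant. The sector is inherited by restriction from V to the finite element space, whatever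
  the mesh.\<close>

lemma fe_sectorial_operator:
  fixes \<Gamma> \<T> A
  defines "W \<equiv> fe_space \<Omega> \<Gamma> \<T>" and "V \<equiv> H1_vanishing \<Omega> \<Gamma>"
  assumes tri: "triangulation_of \<Omega> \<T>"
    and A1: "\<And>u v w c. u \<in> V \<Longrightarrow> v \<in> V \<Longrightarrow> w \<in> V \<Longrightarrow> A (\<lambda>x. u x + c * v x) w = A u w + c * A v w"
    and A2: "\<And>u v w c. u \<in> V \<Longrightarrow> v \<in> V \<Longrightarrow> w \<in> V \<Longrightarrow> A w (\<lambda>x. u x + c * v x) = A w u + cnj c * A w v"
    and c: "0 < c" and coercive: "\<And>v. v \<in> V \<Longrightarrow> c * (H1_norm \<Omega> v)\<^sup>2 \<le> Re (A v v)"
    and \<beta>: "0 \<le> \<beta>" and sector: "\<And>v. v \<in> V \<Longrightarrow> \<bar>Im (A v v)\<bar> \<le> \<beta> * Re (A v v)"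
  shows "sectorial_operator W (discrete_operator \<Omega> A W) (L2_inner \<Omega>) c \<beta>"
proof -
  interpret fe: function_inner_space W "L2_inner \<Omega>" unfolding W_def by (rule fe_space_inner_space)
  have WV: "w \<in> V" if "w \<in> W" for w using that fe_space_H1(1) unfolding W_def V_def by blast
  define T where "T = discrete_operator \<Omega> A W"
  have T: "T w \<in> W" "\<forall>v\<in>W. L2_inner \<Omega> (T w) v = A w v" if w: "w \<in> W" for w
  proof -
    have "\<exists>!g. g \<in> fe_space \<Omega> \<Gamma> \<T> \<and> (\<forall>v\<in>fe_space \<Omega> \<Gamma> \<T>. L2_inner \<Omega> g v = A w v)"
    proof (rule fe_riesz[OF tri])
      fix u v k assume "u \<in> fe_space \<Omega> \<Gamma> \<T>" "v \<in> fe_space \<Omega> \<Gamma> \<T>"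
      then have "u \<in> W" "v \<in> W" by (simp_all only: W_def)
      then show "A w (\<lambda>x. u x + k * v x) = A w u + cnj k * A w v" by (intro A2 WV w)
    qed
    from theI'[OF this] have "T w \<in> W \<and> (\<forall>v\<in>W. L2_inner \<Omega> (T w) v = A w v)"
      unfolding T_def discrete_operator_def W_def .
    then show "T w \<in> W" "\<forall>v\<in>W. L2_inner \<Omega> (T w) v = A w v" by (rule conjunct1, rule conjunct2)
  qed
  have T_comb: "T (\<lambda>x. u x + k * v x) = (\<lambda>x. T u x + k * T v x)" if u: "u \<in> W" and v: "v \<in> W" for u v k
  proof (rule fe.ip_eqI)
    have uv: "(\<lambda>x. u x + k * v x) \<in> W" by (rule fe.comb_mem[OF u v])
    show "T (\<lambda>x. u x + k * v x) \<in> W" by (rule T(1)[OF uv])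
    show "(\<lambda>x. T u x + k * T v x) \<in> W" by (rule fe.comb_mem[OF T(1)[OF u] T(1)[OF v]])
    fix w assume w: "w \<in> W"
    have "L2_inner \<Omega> (T (\<lambda>x. u x + k * v x)) w = A (\<lambda>x. u x + k * v x) w" by (rule bspec[OF T(2)[OF uv] w])
    also have "\<dots> = A u w + k * A v w" by (rule A1[OF WV[OF u] WV[OF v] WV[OF w]])
    also have "\<dots> = L2_inner \<Omega> (T u) w + k * L2_inner \<Omega> (T v) w"
      by (simp only: bspec[OF T(2)[OF u] w] bspec[OF T(2)[OF v] w])
    also have "\<dots> = L2_inner \<Omega> (\<lambda>x. T u x + k * T v x) w" by (rule fe.ip_comb[OF T(1)[OF u] T(1)[OF v] w, symmetric])
    finally show "L2_inner \<Omega> (T (\<lambda>x. u x + k * v x)) w = L2_inner \<Omega> (\<lambda>x. T u x + k * T v x) w" .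
  qed
  have T0: "T (\<lambda>x. 0) = (\<lambda>x. 0)" using T_comb[OF fe.zero_mem fe.zero_mem, of "- 1"] by simp
  have scale: "(\<lambda>x. k * u x) \<in> W" if "u \<in> W" for u k using fe.comb_mem[OF fe.zero_mem that, of k] by simp
  interpret op: fun_space_operator W T
  proof (rule fun_space_operator.intro)
    show "T (\<lambda>x. u x + v x) = (\<lambda>x. T u x + T v x)" if "u \<in> W" "v \<in> W" for u v using T_comb[OF that, of 1] by simp
    show "T (\<lambda>x. k * u x) = (\<lambda>x. k * T u x)" if "u \<in> W" for u k
      using T_comb[OF fe.zero_mem that, of k] T0 by simp
    show "(\<lambda>x. u x + v x) \<in> W" if "u \<in> W" "v \<in> W" for u v using fe.comb_mem[OF that, of 1] by simp
  qed (fact fe.zero_mem scale T(1))+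
  obtain X where X: "finite X" "\<forall>v\<in>fe_space \<Omega> \<Gamma> \<T>. (\<forall>x\<in>X. v x = 0) \<longrightarrow> v = (\<lambda>x. 0)"
    using fe_space_finite_determination[OF tri, of \<Gamma>] by (elim exE conjE)
  have X': "v = (\<lambda>x. 0)" if "v \<in> W" "\<And>x. x \<in> X \<Longrightarrow> v x = 0" for v
    using that unfolding W_def by (intro mp[OF bspec[OF X(2)]] ballI)
  have "\<exists>B. finite B \<and> B \<subseteq> W \<and> (\<forall>v\<in>W. v = (\<lambda>x. \<Sum>e\<in>B. L2_inner \<Omega> v e * e x))"
    unfolding W_def by (rule expansion_exists[OF X(1) fe_space_inner_space]) (rule mp[OF bspec[OF X(2)]])
  then obtain B where B: "finite B" "B \<subseteq> W" "\<forall>v\<in>W. v = (\<lambda>x. \<Sum>e\<in>B. L2_inner \<Omega> v e * e x)"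
    by (elim exE conjE)
  have fin: "\<exists>ls. \<forall>w\<in>W. op.shifts ls w = (\<lambda>x. 0)"
  proof (rule op.annihilating_list_exists[OF X(1) X' B(1,2)])
    fix v assume "v \<in> W"
    then show "\<exists>k. v = (\<lambda>x. \<Sum>e\<in>B. k e * e x)" by (intro exI[of _ "L2_inner \<Omega> v"]) (rule bspec[OF B(3)])
  qed
  have Tv: "L2_inner \<Omega> (T v) v = A v v" if "v \<in> W" for v by (rule bspec[OF T(2)[OF that] that])
  have "sectorial_operator W T (L2_inner \<Omega>) c \<beta>"
  proof (intro sectorial_operator.intro op.fun_space_operator_axioms sectorial_operator_axioms.intro)
    show "L2_inner \<Omega> (\<lambda>x. u x + v x) w = L2_inner \<Omega> u w + L2_inner \<Omega> v w" if "u \<in> W" "v \<in> W" "w \<in> W" for u v w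
      using fe.ip_comb[OF that, of 1] by simp
    show "L2_inner \<Omega> (\<lambda>x. k * u x) w = k * L2_inner \<Omega> u w" if "u \<in> W" "w \<in> W" for k u w
      using fe.ip_comb[OF fe.zero_mem that, of k] fe.ip_comb[OF fe.zero_mem fe.zero_mem that(2), of 1] by simp
    show "c * Re (L2_inner \<Omega> u u) \<le> Re (L2_inner \<Omega> (T u) u)" if u: "u \<in> W" for u
    proof -
      have "c * Re (L2_inner \<Omega> u u) \<le> c * (H1_norm \<Omega> u)\<^sup>2"
        unfolding L2_inner_self Re_complex_of_real using c
        by (intro mult_left_mono L2_norm_le_H1_norm fe_space_H1(2)[OF WV[OF u, unfolded V_def]]) simp
      also have "\<dots> \<le> Re (A u u)" by (rule coercive[OF WV[OF u]])
      finally show ?thesis unfolding Tv[OF u] .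
    qed
    show "\<bar>Im (L2_inner \<Omega> (T u) u)\<bar> \<le> \<beta> * Re (L2_inner \<Omega> (T u) u)" if u: "u \<in> W" for u
      unfolding Tv[OF u] by (rule sector[OF WV[OF u]])
  qed (fact fe.ip_cnj fe.ip_nonneg fe.ip_definite c \<beta> fin)+
  then show ?thesis unfolding T_def .
qed

end

theorem mainTheorem4:
  fixes \<Omega> \<Gamma>\<^sub>D \<Gamma>\<^sub>N :: "(real^'d) set"
    and C :: "real^'d \<Rightarrow> complex^'d^'d" and a :: "real^'d \<Rightarrow> complex^'d" and r :: "real^'d \<Rightarrow> complex"
    and V :: "(real^'d \<Rightarrow> complex) set"
    and A :: "(real^'d \<Rightarrow> complex) \<Rightarrow> (real^'d \<Rightarrow> complex) \<Rightarrow> complex"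
    and c\<^sub>0 c\<^sub>1 \<beta> \<sigma> :: real
  assumes domain: "polygonal_lipschitz_domain \<Omega>"
    and boundary: "boundary_partition \<Omega> \<Gamma>\<^sub>D \<Gamma>\<^sub>N"
    and V: "V = H1_vanishing \<Omega> \<Gamma>\<^sub>D"
    and A: "A = sesq_form \<Omega> C a r"
    and form_defined: "\<And>w v. w \<in> V \<Longrightarrow> v \<in> V \<Longrightarrow>
           integrable (lebesgue_on \<Omega>) (form_integrand \<Omega> C a r w v)"
    and c_pos: "c\<^sub>0 > 0" "c\<^sub>1 > 0"
    and coercive: "\<And>v. v \<in> V \<Longrightarrow> Re (A v v) \<ge> c\<^sub>0 * (H1_norm \<Omega> v)\<^sup>2"
    and continuous: "\<And>w v. w \<in> V \<Longrightarrow> v \<in> V \<Longrightarrow> cmod (A w v) \<le> c\<^sub>1 * H1_norm \<Omega> w * H1_norm \<Omega> v"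
    and \<beta>: "\<beta> = form_index A V"
    and \<sigma>: "\<sigma> > 0"
  shows "\<exists>C' :: real \<Rightarrow> real. \<forall>\<alpha>\<in>{0<..<1}.
    (\<forall>h \<T> b f \<tau> M N.
       triangulation_of \<Omega> \<T> \<and> mesh_size \<T> = h \<and> quasi_uniform \<sigma> \<T> \<and>
       mesh_respects_boundary \<Omega> \<Gamma>\<^sub>D \<Gamma>\<^sub>N \<T> \<and> b \<ge> 1 \<and> f \<in> L2 \<Omega> \<longrightarrow>
       (let V\<^sub>h = fe_space \<Omega> \<Gamma>\<^sub>D \<T>;
            A\<^sub>h = discrete_operator \<Omega> A V\<^sub>h;
            f\<^sub>h = L2_projection \<Omega> V\<^sub>h f;
            u\<^sub>h = discrete_solution V\<^sub>h A\<^sub>h \<alpha> b f\<^sub>h;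
            U = sinc_approx V\<^sub>h A\<^sub>h \<alpha> b \<tau> M N f\<^sub>h;
            \<kappa>\<^sub>1 = \<alpha> * (pi - arctan \<beta>);
            \<kappa>\<^sub>2 = (1 - \<alpha>) * pi
        in 0 < \<tau> \<and> \<tau> < pi - arctan \<beta> \<and>
           real M = max (\<alpha> / (\<alpha> + 1) * (2 * pi * min \<kappa>\<^sub>1 \<kappa>\<^sub>2 / \<tau>\<^sup>2 - ln b / \<tau>)) 0 \<and>
           real N = 2 * pi * min \<kappa>\<^sub>1 \<kappa>\<^sub>2 / \<tau>\<^sup>2 + ln b / \<tau> \<and>
           M > 0 \<longrightarrow>
           L2_norm \<Omega> (\<lambda>x. u\<^sub>h x - U x) \<le>
             C' \<alpha> * tau_factor \<alpha> \<kappa>\<^sub>1 \<kappa>\<^sub>2 \<tau> / b *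
             exp (- sqrt (pi * min \<kappa>\<^sub>1 \<kappa>\<^sub>2 * ((1 + 1 / \<alpha>) * real M + real N))) *
             L2_norm \<Omega> f\<^sub>h))"
\<comment> \<open>The witness is the prefactor of the Balakrishnan integral times the quadrature
  constant. Apart from \<alpha> it contains only \<open>c\<^sub>0\<close>.\<close>
proof (intro exI[of _ "\<lambda>\<alpha>. sin (pi * \<alpha>) / (pi * \<alpha>) * quad_const \<alpha> c\<^sub>0"] ballI allI impI)
  fix \<alpha> h :: real and \<T> f and b \<tau> :: real and M N :: nat
  assume \<alpha>: "\<alpha> \<in> {0<..<1}"
    and disc: "triangulation_of \<Omega> \<T> \<and> mesh_size \<T> = h \<and> quasi_uniform \<sigma> \<T> \<and>
       mesh_respects_boundary \<Omega> \<Gamma>\<^sub>D \<Gamma>\<^sub>N \<T> \<and> b \<ge> 1 \<and> f \<in> L2 \<Omega>"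
  interpret bounded_open \<Omega>
    using domain by unfold_locales (simp_all add: polygonal_lipschitz_domain_def)
  have tri: "triangulation_of \<Omega> \<T>" and b: "1 \<le> b" and f: "f \<in> L2 \<Omega>" using disc by blast+
  have lin: "A (\<lambda>x. u x + c * v x) w = A u w + c * A v w \<and> A w (\<lambda>x. u x + c * v x) = A w u + cnj c * A w v"
    if uvw: "u \<in> V" "v \<in> V" "w \<in> V" for u v w c
  proof -
    have uv: "(\<lambda>x. u x + c * v x) \<in> V" using uvw unfolding V by (intro H1_vanishing_comb)
    have H: "u \<in> H1 \<Omega>" "v \<in> H1 \<Omega>" using uvw fe_space_H1(2) unfolding V by blast+
    show ?thesis unfolding A
      by (intro conjI sesq_form_comb[OF H] form_defined uv uvw)
  qed
  have nonneg: "0 \<le> Re (A v v)" if "v \<in> V" for v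
    by (rule order_trans[OF _ coercive[OF that]]) (use c_pos(1) in simp)
  \<comment> \<open>Continuity divided by coercivity bounds the opening of the sector; this is what
    shows that \<open>form_index\<close> is a minimum over a nonempty set.\<close>
  have K: "cmod (A v v) \<le> c\<^sub>1 / c\<^sub>0 * Re (A v v)" if v: "v \<in> V" for v
  proof -
    have "cmod (A v v) \<le> c\<^sub>1 / c\<^sub>0 * (c\<^sub>0 * (H1_norm \<Omega> v)\<^sup>2)"
      using continuous[OF v v] c_pos by (simp add: power2_eq_square mult.assoc)
    also have "\<dots> \<le> c\<^sub>1 / c\<^sub>0 * Re (A v v)" using c_pos by (intro mult_left_mono coercive[OF v]) simp
    finally show ?thesis .
  qed
  have \<beta>': "0 \<le> \<beta>" "\<forall>v\<in>V. \<bar>Im (A v v)\<bar> \<le> \<beta> * Re (A v v)"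
    using form_index_bound[of V A "c\<^sub>1 / c\<^sub>0"] nonneg K c_pos unfolding \<beta> by simp_all
  let ?W = "fe_space \<Omega> \<Gamma>\<^sub>D \<T>"
  interpret op: sectorial_operator ?W "discrete_operator \<Omega> A ?W" "L2_inner \<Omega>" "c\<^sub>0" \<beta>
    by (rule fe_sectorial_operator[where \<Gamma> = "\<Gamma>\<^sub>D", OF tri, folded V])
      (use lin c_pos coercive \<beta>' in simp_all)
  have mem: "L2_projection \<Omega> ?W f \<in> ?W" by (rule L2_projection_mem[OF tri f])
  have nrm: "L2_norm \<Omega> u = op.nrm u" for u unfolding L2_norm_eq op.nrm_def ..
  have \<alpha>': "0 < \<alpha>" "\<alpha> < 1" using \<alpha> by simp_all
  show "let V\<^sub>h = fe_space \<Omega> \<Gamma>\<^sub>D \<T>;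
            A\<^sub>h = discrete_operator \<Omega> A V\<^sub>h;
            f\<^sub>h = L2_projection \<Omega> V\<^sub>h f;
            u\<^sub>h = discrete_solution V\<^sub>h A\<^sub>h \<alpha> b f\<^sub>h;
            U = sinc_approx V\<^sub>h A\<^sub>h \<alpha> b \<tau> M N f\<^sub>h;
            \<kappa>\<^sub>1 = \<alpha> * (pi - arctan \<beta>);
            \<kappa>\<^sub>2 = (1 - \<alpha>) * pi
        in 0 < \<tau> \<and> \<tau> < pi - arctan \<beta> \<and>
           real M = max (\<alpha> / (\<alpha> + 1) * (2 * pi * min \<kappa>\<^sub>1 \<kappa>\<^sub>2 / \<tau>\<^sup>2 - ln b / \<tau>)) 0 \<and>
           real N = 2 * pi * min \<kappa>\<^sub>1 \<kappa>\<^sub>2 / \<tau>\<^sup>2 + ln b / \<tau> \<and>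
           M > 0 \<longrightarrow>
           L2_norm \<Omega> (\<lambda>x. u\<^sub>h x - U x) \<le>
             sin (pi * \<alpha>) / (pi * \<alpha>) * quad_const \<alpha> c\<^sub>0 * tau_factor \<alpha> \<kappa>\<^sub>1 \<kappa>\<^sub>2 \<tau> / b *
             exp (- sqrt (pi * min \<kappa>\<^sub>1 \<kappa>\<^sub>2 * ((1 + 1 / \<alpha>) * real M + real N))) *
             L2_norm \<Omega> f\<^sub>h"
    unfolding Let_def nrm
    by (intro impI, elim conjE) (rule op.sinc_approx_error(2)[OF \<alpha>' b mem])
qed

end
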